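(* Let $d \geq 2$, let $\Lambda_d$ be the additive group of $d\times d$ integer matrices with trace $0$, and for $a \in \Lambda_d$ let $\mathcal{C}(a) = \det(tI - a) \in \mathbb{Z}[t]$ be its characteristic polynomial. Let $E \subset \Lambda_d$ be a set of positive upper Banach density and let $m$ be a positive integer. Then there exists a positive integer $k$ such that for every finite subset $F \subset \Lambda_d$ with $|F| = m$ there is some $b \in E$ with $$\mathcal{C}(kF) \subset \mathcal{C}(E-b).$$ If $E$ is an aperiodic Bohr set, then $k$ can be chosen to be $1$. In particular, if $E$ is an aperiodic Bohr$_o$-set, then $\mathcal{C}(E) = \mathcal{C}(\Lambda_d)$.
   Context: $\Lambda_d$ is identified with $\mathbb{Z}^N$, $N = d^2-1$, by a choice of $\mathbb{Z}$-basis, and the following notions for subsets of $\mathbb{Z}^N$ are transported to $\Lambda_d$. Upper Banach density: for $E \subset \mathbb{Z}^N$ and $F_n = [-n,n]^N \cap \mathbb{Z}^N$, $d^*(E) = \sup\{ \limsup_n |E \cap (F_n + a_n)|/|F_n| : (a_n) \text{ a sequence in } \mathbb{Z}^N\}$. $E$ has positive upper Banach density if $d^*(E)>0$. Bohr sets: $E \subset \mathbb{Z}^N$ is a Bohr set if there exist a compact second countable abelian group $K$ with Haar probability measure $m_K$, a homomorphism $\tau : \mathbb{Z}^N \to K$ with dense image, and a non-empty open set $U \subset K$ with $m_K(\overline{U}) = m_K(U)$ such that $E = \tau^{-1}(U)$. If moreover such $K$ can be taken connected, $E$ is an aperiodic Bohr set; if such $K$ can be taken connected with $U$ containing the identity element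 of $K$, $E$ is an aperiodic Bohr$_o$-set. Notation: $kF = \{kf : f \in F\}$, $E-b = \{e-b : e\in E\}$, $\mathcal{C}(S) = \{\mathcal{C}(s): s \in S\}$. *)

theory Defs
  imports "HOL-Probability.Probability_Measure" "Jordan_Normal_Form.Char_Poly"
begin

unbundle no vec_syntax \<comment> \<open>\<open>$\<close> is the indexing of \<^typ>\<open>int Matrix.vec\<close>\<close>

text \<open>The group \<open>\<int>\<^sup>N\<close> is \<^term>\<open>carrier_vec N :: int vec set\<close>.\<close>

definition int_box :: "nat \<Rightarrow> nat \<Rightarrow> int vec set" where
  "int_box N n = {v \<in> carrier_vec N. \<forall>i<N. - int n \<le> v $ i \<and> v $ i \<le> int n}"

definition upper_banach_density :: "nat \<Rightarrow> int vec set \<Rightarrow> ereal" where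
  "upper_banach_density N E =
     (SUP a \<in> {a :: nat \<Rightarrow> int vec. \<forall>n. a n \<in> carrier_vec N}.
        limsup (\<lambda>n. ereal (real (card (E \<inter> (\<lambda>v. v + a n) ` int_box N n))
                            / real (card (int_box N n)))))"

text \<open>On a compact second countable Hausdorff group every Borel probability measure is
  regular, so this determines the Haar probability measure uniquely.\<close>

definition haar_prob_measure :: "'k::topological_ab_group_add measure \<Rightarrow> bool" where
  "haar_prob_measure \<mu> \<longleftrightarrow> prob_space \<mu> \<and> sets \<mu> = sets borel \<and>
     (\<forall>x. \<forall>A \<in> sets borel. emeasure \<mu> ((\<lambda>y. x + y) ` A) = emeasure \<mu> A)"

text \<open>\<open>bohr_datum N \<mu> \<tau> U\<close>: the compact group \<open>K\<close> is the type \<open>'k\<close>, and the Bohr set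
  determined by the datum is \<open>\<tau>\<^sup>-\<^sup>1(U)\<close>. Compact groups are Hausdorff by convention.\<close>

definition bohr_datum ::
  "nat \<Rightarrow> 'k::{topological_ab_group_add, t2_space, second_countable_topology} measure
     \<Rightarrow> (int vec \<Rightarrow> 'k) \<Rightarrow> 'k set \<Rightarrow> bool" where
  "bohr_datum N \<mu> \<tau> U \<longleftrightarrow>
     compact (UNIV :: 'k set) \<and> haar_prob_measure \<mu> \<and>
     (\<forall>u \<in> carrier_vec N. \<forall>v \<in> carrier_vec N. \<tau> (u + v) = \<tau> u + \<tau> v) \<and>
     closure (\<tau> ` carrier_vec N) = UNIV \<and>
     open U \<and> U \<noteq> {} \<and> measure \<mu> (closure U) = measure \<mu> U"

text \<open>HOL cannot quantify existentially over types, so the group \<open>K\<close> is a type parameter here: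
  a set is an aperiodic Bohr set iff the predicate holds for some type \<open>'k\<close>. A theorem that
  assumes the predicate for a type variable \<open>'k\<close> covers every \<open>K\<close>.\<close>

definition aperiodic_bohr_set ::
  "'k::{topological_ab_group_add, t2_space, second_countable_topology} itself
     \<Rightarrow> nat \<Rightarrow> int vec set \<Rightarrow> bool" where
  "aperiodic_bohr_set K N E \<longleftrightarrow> connected (UNIV :: 'k set) \<and>
     (\<exists>(\<mu> :: 'k measure) \<tau> U. bohr_datum N \<mu> \<tau> U \<and> E = {v \<in> carrier_vec N. \<tau> v \<in> U})"

definition aperiodic_bohr0_set ::
  "'k::{topological_ab_group_add, t2_space, second_countable_topology} itself
     \<Rightarrow> nat \<Rightarrow> int vec set \<Rightarrow> bool" where
  "aperiodic_bohr0_set K N E \<longleftrightarrow> connected (UNIV :: 'k set) \<and>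
     (\<exists>(\<mu> :: 'k measure) \<tau> U. bohr_datum N \<mu> \<tau> U \<and> 0 \<in> U \<and>
        E = {v \<in> carrier_vec N. \<tau> v \<in> U})"

definition trace0_mats :: "nat \<Rightarrow> int mat set" where
  "trace0_mats d = {A \<in> carrier_mat d d. (\<Sum>i<d. A $$ (i, i)) = 0}"

definition mat_of_coords :: "nat \<Rightarrow> int mat list \<Rightarrow> int vec \<Rightarrow> int mat" where
  "mat_of_coords d bs v = Matrix.mat d d (\<lambda>(r, c). \<Sum>i<length bs. v $ i * (bs ! i) $$ (r, c))"

definition trace0_basis :: "nat \<Rightarrow> int mat list \<Rightarrow> bool" where
  "trace0_basis d bs \<longleftrightarrow> length bs = d\<^sup>2 - 1 \<and> set bs \<subseteq> trace0_mats d \<and>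
     bij_betw (mat_of_coords d bs) (carrier_vec (d\<^sup>2 - 1)) (trace0_mats d)"

definition coords_set :: "nat \<Rightarrow> int mat list \<Rightarrow> int mat set \<Rightarrow> int vec set" where
  "coords_set d bs E = {v \<in> carrier_vec (d\<^sup>2 - 1). mat_of_coords d bs v \<in> E}"

definition charpoly_pattern :: "nat \<Rightarrow> nat \<Rightarrow> int mat set \<Rightarrow> nat \<Rightarrow> bool" where
  "charpoly_pattern d m E k \<longleftrightarrow>
     (\<forall>F. F \<subseteq> trace0_mats d \<and> finite F \<and> card F = m \<longrightarrow>
        (\<exists>b \<in> E. char_poly ` ((\<lambda>f. int k \<cdot>\<^sub>m f) ` F) \<subseteq> char_poly ` ((\<lambda>e. e - b) ` E)))"

end

theory Submission
  imports Defs "HOL-Library.Function_Algebras"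
begin

text \<open>Let \<open>f\<close> be the indicator of \<open>E\<close> on \<open>\<int>\<^sup>N\<close>. Choose \<open>k\<close> and an invariant mean such that the
  projection of \<open>f\<close> to the \<open>k\<close>-periodic functions has almost the largest possible norm among all
  multiples of \<open>k\<close> and all invariant means; then the rest \<open>g\<close> of \<open>f\<close> has small averages along
  every sublattice of \<open>k \<int>\<^sup>N\<close>. If \<open>R\<^sup>2 = 0\<close>, where \<open>R = v w\<^sup>T\<close>, the matrices
  \<open>(1 + n R) A (1 - n R) = A + n (R A - A R) - n\<^sup>2 (w\<^sup>T A v) R\<close> all have the characteristic
  polynomial of \<open>A\<close>, and by van der Corput the average of \<open>g\<close> along \<open>k\<close> times this quadratic
  sequence is controlled by averages along multiples of \<open>k R\<close>. Let \<open>R = R\<^sub>s\<close> run over a polynomial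
  curve such that any sufficiently many of the \<open>R\<^sub>s\<close> span the traceless matrices over
  \<open>\<rat>\<close>. Then \<open>g\<close> cannot correlate with many directions at once, so for the average over \<open>s\<close>
  and \<open>n\<close> only the periodic part of \<open>f\<close> survives, and this part returns to itself with positive
  density. On a connected compact group all periodic parts are nearly constant, whence \<open>k = 1\<close>.\<close>

section \<open>Averages along progressions\<close>

text \<open>The obstacle is to fix \<open>k\<close> before \<open>F\<close> is known, and to do so
  without a limit object. This is why all invariant means compete in the choice of \<open>k\<close>:
  a failure of smallness is local. If boxes of arbitrarily large side carry too much energy along
  \<open>k j \<int>^N\<close> somewhere, a cluster point of averages over larger boxes at those
  places is again an invariant mean, and it beats the near-maximum. Hence some finite side
  \<open>H\<close> bounds the energy at all points, and this finite statement is what the averaging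
  argument consumes. The gap \<epsilon> depends only on a lower bound for the energy, on
  \<open>m\<close> and on the number of directions, so one \<open>k\<close> serves every
  \<open>F\<close>. That number is rounded up to a power of two because passing from single
  directions to tuples squares the sum at each stage. Trace zero enters twice: square-zero matrices
  span at most the traceless ones, and w^T A v would vanish identically on scalar matrices. In the
  Bohr case each matrix of \<open>F\<close> is found separately near the identity of the compact
  group.\<close>

declare plus_fun_apply [simp del] zero_fun_apply [simp del] minus_apply [simp del]
  uminus_apply [simp del] times_fun_apply [simp del]

lemmas fun_apply = plus_fun_apply zero_fun_apply minus_apply uminus_apply

text \<open>\<open>\<int>^N\<close> is placed inside the type \<open>nat \<Rightarrow> int\<close>,
  where the group laws hold without carrier conditions. The functions to be averaged live on the
  whole type; invariance will be asked only for translations from \<open>lat N\<close>.\<close>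

definition lat :: "nat \<Rightarrow> (nat \<Rightarrow> int) set" where
  "lat N = {v. \<forall>i\<ge>N. v i = 0}"

definition unit :: "nat \<Rightarrow> nat \<Rightarrow> int" where
  "unit l = (\<lambda>i. if i = l then 1 else 0)"

definition sc :: "int \<Rightarrow> (nat \<Rightarrow> int) \<Rightarrow> nat \<Rightarrow> int" where
  "sc c v = (\<lambda>i. c * v i)"

lemma sc_simps [simp]:
  "sc 0 v = 0" "sc 1 v = v" "sc a (sc b v) = sc (a * b) v" "sc a 0 = 0"
  by (auto simp: sc_def fun_eq_iff fun_apply)

lemma sc_add: "sc (a + b) v = sc a v + sc b v" "sc a (v + w) = sc a v + sc a w"
  "sc (a - b) v = sc a v - sc b v" "sc a (v - w) = sc a v - sc a w" "sc (- a) v = - sc a v"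
  "sc a (- v) = - sc a v"
  by (auto simp: sc_def fun_eq_iff algebra_simps fun_apply)

lemma lat_closed [simp, intro]:
  "0 \<in> lat N" "v \<in> lat N \<Longrightarrow> w \<in> lat N \<Longrightarrow> v + w \<in> lat N" "v \<in> lat N \<Longrightarrow> - v \<in> lat N"
  "v \<in> lat N \<Longrightarrow> w \<in> lat N \<Longrightarrow> v - w \<in> lat N"
  "v \<in> lat N \<Longrightarrow> sc c v \<in> lat N" "l < N \<Longrightarrow> unit l \<in> lat N"
  by (auto simp: lat_def unit_def fun_apply sc_def)

section \<open>Bounded functions and iterated averages\<close>

definition bd :: "('a \<Rightarrow> real) \<Rightarrow> bool" where
  "bd f \<longleftrightarrow> (\<exists>M. \<forall>x. \<bar>f x\<bar> \<le> M)"

lemma bdI: "(\<And>x. \<bar>f x\<bar> \<le> M) \<Longrightarrow> bd f"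
  by (auto simp: bd_def)

lemma bdE: assumes "bd f" obtains M where "M \<ge> 0" "\<And>x. \<bar>f x\<bar> \<le> M"
  using assms unfolding bd_def by (metis abs_ge_zero order_trans)

lemma bd_const [intro, simp]: "bd (\<lambda>x. c)"
  by (rule bdI[of _ "\<bar>c\<bar>"]) simp

lemma bd_add [simp, intro]: assumes "bd f" "bd g" shows "bd (\<lambda>x. f x + g x)"
proof -
  obtain M1 M2 where "\<And>x. \<bar>f x\<bar> \<le> M1" "\<And>x. \<bar>g x\<bar> \<le> M2" using assms by (auto simp: bd_def)
  then show ?thesis by (intro bdI[of _ "M1 + M2"]) (meson abs_triangle_ineq add_mono order_trans)
qed

lemma bd_mult [simp, intro]: assumes "bd f" "bd g" shows "bd (\<lambda>x. f x * g x)"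
proof -
  obtain M1 where M1: "M1 \<ge> 0" "\<And>x. \<bar>f x\<bar> \<le> M1" using bdE[OF assms(1)] by blast
  obtain M2 where M2: "M2 \<ge> 0" "\<And>x. \<bar>g x\<bar> \<le> M2" using bdE[OF assms(2)] by blast
  show ?thesis
    by (rule bdI[of _ "M1 * M2"]) (simp add: abs_mult mult_mono M1 M2)
qed

lemma bd_minus [simp, intro]: "bd f \<Longrightarrow> bd (\<lambda>x. - f x)"
  using bd_mult[of "\<lambda>x. -1" f] by simp

lemma bd_diff [simp, intro]: "bd f \<Longrightarrow> bd g \<Longrightarrow> bd (\<lambda>x. f x - g x)"
  using bd_add[of f "\<lambda>x. - g x"] bd_minus by auto

lemma bd_power [simp, intro]: "bd f \<Longrightarrow> bd (\<lambda>x. f x ^ n)"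
  by (induction n) auto

lemma bd_divide [simp, intro]: "bd f \<Longrightarrow> bd (\<lambda>x. f x / c)"
  using bd_mult[of f "\<lambda>x. inverse c"] by (simp add: divide_inverse)

lemma bd_abs [simp, intro]: "bd f \<Longrightarrow> bd (\<lambda>x. \<bar>f x\<bar>)"
  by (simp add: bd_def)

lemma bd_shift [simp, intro]: "bd f \<Longrightarrow> bd (\<lambda>x. f (x + v))" "bd f \<Longrightarrow> bd (\<lambda>x. f (x - v))"
  by (auto simp: bd_def)

lemma bd_sum [simp, intro]: "(\<And>i. i \<in> I \<Longrightarrow> bd (f i)) \<Longrightarrow> bd (\<lambda>x. \<Sum>i\<in>I. f i x)"
  by (induction I rule: infinite_finite_induct) auto

lemma bd_prod [simp, intro]: "(\<And>i. i \<in> I \<Longrightarrow> bd (f i)) \<Longrightarrow> bd (\<lambda>x. \<Prod>i\<in>I. f i x)"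
  by (induction I rule: infinite_finite_induct) auto

definition av :: "(nat \<Rightarrow> int) \<Rightarrow> nat \<Rightarrow> ((nat \<Rightarrow> int) \<Rightarrow> real) \<Rightarrow> (nat \<Rightarrow> int) \<Rightarrow> real" where
  "av c L f x = (\<Sum>n<L. f (x + sc (int n) c)) / real L"

text \<open>The directions form a list because repetitions count; the order does not, since single
  averages commute.\<close>

definition avs :: "(nat \<Rightarrow> int) list \<Rightarrow> nat \<Rightarrow> ((nat \<Rightarrow> int) \<Rightarrow> real) \<Rightarrow> (nat \<Rightarrow> int) \<Rightarrow> real" where
  "avs cs L f = foldr (\<lambda>c. av c L) cs f"

lemma avs_simps [simp]:
  "avs [] L f = f" "avs (c # cs) L f = av c L (avs cs L f)"
  "avs (cs @ ds) L f = avs cs L (avs ds L f)"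
  by (auto simp: avs_def)

lemma av_bound: "(\<And>n. n < L \<Longrightarrow> \<bar>f (x + sc (int n) c)\<bar> \<le> M) \<Longrightarrow> M \<ge> 0 \<Longrightarrow> \<bar>av c L f x\<bar> \<le> M"
proof -
  assume a: "\<And>n. n < L \<Longrightarrow> \<bar>f (x + sc (int n) c)\<bar> \<le> M" "M \<ge> 0"
  have "\<bar>\<Sum>n<L. f (x + sc (int n) c)\<bar> \<le> (\<Sum>n<L. M)"
    by (rule order_trans[OF sum_abs]) (intro sum_mono a, auto)
  then show ?thesis using a(2)
    by (cases "L = 0") (auto simp: av_def field_simps)
qed

lemma avs_bound: assumes "\<And>x. \<bar>f x\<bar> \<le> M" shows "\<bar>avs cs L f x\<bar> \<le> M"
proof -
  have "M \<ge> 0" using assms[of 0] by simp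
  then show ?thesis using assms
    by (induction cs arbitrary: x) (auto intro: av_bound)
qed

lemma bd_av [simp, intro]: assumes "bd f" shows "bd (av c L f)"
proof -
  obtain M where "M \<ge> 0" "\<And>x. \<bar>f x\<bar> \<le> M" using bdE[OF assms] by blast
  then show ?thesis by (intro bdI[of _ M] av_bound)
qed

lemma bd_avs [simp, intro]: "bd f \<Longrightarrow> bd (avs cs L f)"
  by (induction cs) auto

lemma av_mono: "(\<And>x. f x \<le> g x) \<Longrightarrow> av c L f x \<le> av c L g x"
  unfolding av_def by (intro divide_right_mono sum_mono) auto

lemma avs_mono: "(\<And>x. f x \<le> g x) \<Longrightarrow> avs cs L f x \<le> avs cs L g x"
  by (induction cs arbitrary: x) (auto intro: av_mono)

lemma av_const: "L > 0 \<Longrightarrow> av c L (\<lambda>x. a) = (\<lambda>x. a)"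
  by (auto simp: av_def fun_eq_iff)

lemma avs_const: "L > 0 \<Longrightarrow> avs cs L (\<lambda>x. a) = (\<lambda>x. a)"
  by (induction cs) (auto simp: av_const)

lemma av_add: "av c L (\<lambda>x. f x + g x) = (\<lambda>x. av c L f x + av c L g x)"
  by (auto simp: av_def fun_eq_iff sum.distrib add_divide_distrib)

lemma av_cmult: "av c L (\<lambda>x. a * f x) = (\<lambda>x. a * av c L f x)"
  by (auto simp: av_def fun_eq_iff sum_distrib_left)

lemma avs_add: "avs cs L (\<lambda>x. f x + g x) = (\<lambda>x. avs cs L f x + avs cs L g x)"
  by (induction cs) (auto simp: av_add)

lemma avs_cmult: "avs cs L (\<lambda>x. a * f x) = (\<lambda>x. a * avs cs L f x)"
  by (induction cs) (auto simp: av_cmult)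

lemma avs_diff: "avs cs L (\<lambda>x. f x - g x) = (\<lambda>x. avs cs L f x - avs cs L g x)"
  using avs_add[of cs L f "\<lambda>x. (-1) * g x"] avs_cmult[of cs L "-1" g] by (simp add: fun_eq_iff)

lemma avs_nonneg: "(\<And>x. 0 \<le> f x) \<Longrightarrow> 0 \<le> avs cs L f x"
  using avs_mono[of "\<lambda>x. 0" f cs L x] avs_cmult[of cs L 0 "\<lambda>x. 0"] by auto

lemma av_shift: "av c L (\<lambda>y. f (y + v)) x = av c L f (x + v)"
  by (simp add: av_def add_ac)

lemma avs_shift: "avs cs L (\<lambda>y. f (y + v)) = (\<lambda>x. avs cs L f (x + v))"
proof (induction cs)
  case (Cons c cs)
  show ?case
    using av_shift[of c L "avs cs L f" v] by (auto simp: Cons)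
qed simp

lemma av_commute: "av c L (av d K f) = av d K (av c L f)"
proof
  fix x
  have "(\<Sum>n<L. \<Sum>n'<K. f (x + sc (int n) c + sc (int n') d)) =
        (\<Sum>n'<K. \<Sum>n<L. f (x + sc (int n') d + sc (int n) c))"
    by (subst sum.swap) (simp add: add_ac)
  then show "av c L (av d K f) x = av d K (av c L f) x"
    by (simp add: av_def sum_divide_distrib[symmetric])
qed

lemma av_avs_commute: "av c L (avs ds K f) = avs ds K (av c L f)"
  by (induction ds) (auto simp: av_commute)

lemma avs_commute: "avs cs L (avs ds K f) = avs ds K (avs cs L f)"
  by (induction cs) (auto simp: av_avs_commute)

text \<open>Passing from \<open>x\<close> to \<open>x + c\<close> trades only the first term of the
  sum for one new term.\<close>

lemma av_telescope:
  assumes "\<And>x. \<bar>f x\<bar> \<le> M"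
  shows "\<bar>av c L f (x + c) - av c L f x\<bar> \<le> 2 * M / real L"
proof -
  have *: "x + c + sc (int n) c = x + sc (int (Suc n)) c" for n
    by (simp add: sc_add algebra_simps)
  have "(\<Sum>n<L. f (x + c + sc (int n) c)) - (\<Sum>n<L. f (x + sc (int n) c)) =
     f (x + sc (int L) c) - f x"
    unfolding * sum_subtractf[symmetric]
    by (induction L) (auto simp: algebra_simps)
  then have "\<bar>av c L f (x + c) - av c L f x\<bar> = \<bar>f (x + sc (int L) c) - f x\<bar> / real L"
    by (simp add: av_def diff_divide_distrib[symmetric])
  also have "\<dots> \<le> 2 * M / real L"
    using assms[of "x + sc (int L) c"] assms[of x] by (intro divide_right_mono) auto
  finally show ?thesis .
qed

text \<open>The bound is uniform in \<open>f\<close> and \<open>x\<close>, so \<open>f\<close> may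
  itself be an average. Shifts with such a bound form a subgroup containing all of
  \<open>cs\<close>; in this way a finite-index property of the directions turns into an
  estimate.\<close>

definition almost_period :: "(nat \<Rightarrow> int) list \<Rightarrow> (nat \<Rightarrow> int) \<Rightarrow> real \<Rightarrow> bool" where
  "almost_period cs v K \<longleftrightarrow> K \<ge> 0 \<and>
    (\<forall>L f x. L > 0 \<longrightarrow> (\<forall>y. \<bar>f y\<bar> \<le> 1) \<longrightarrow> \<bar>avs cs L f (x + v) - avs cs L f x\<bar> \<le> K / real L)"

text \<open>The average along \<open>c\<close> may be moved outermost, where it telescopes.\<close>

lemma almost_period_mem: assumes "c \<in> set cs" shows "almost_period cs c 2"
  unfolding almost_period_def
proof (intro conjI allI impI)
  fix L :: nat and f :: "(nat \<Rightarrow> int) \<Rightarrow> real" and x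
  assume L: "L > 0" and f: "\<forall>y. \<bar>f y\<bar> \<le> 1"
  obtain as bs where cs: "cs = as @ c # bs" using assms by (meson split_list)
  have "avs cs L f = av c L (avs (as @ bs) L f)"
    by (simp add: cs av_avs_commute)
  then show "\<bar>avs cs L f (x + c) - avs cs L f x\<bar> \<le> 2 / real L"
    using av_telescope[of "avs (as @ bs) L f" 1 c L x] avs_bound[of f 1 "as @ bs" L] f by auto
qed simp

lemma almost_period_add:
  assumes "almost_period cs v K" "almost_period cs w K'" shows "almost_period cs (v + w) (K + K')"
  unfolding almost_period_def
proof (intro conjI allI impI)
  fix L :: nat and f :: "(nat \<Rightarrow> int) \<Rightarrow> real" and x
  assume "L > 0" and "\<forall>y. \<bar>f y\<bar> \<le> 1"
  then have "\<bar>avs cs L f (x + v + w) - avs cs L f (x + v)\<bar> \<le> K' / real L"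
    "\<bar>avs cs L f (x + v) - avs cs L f x\<bar> \<le> K / real L"
    using assms unfolding almost_period_def by blast+
  then show "\<bar>avs cs L f (x + (v + w)) - avs cs L f x\<bar> \<le> (K + K') / real L"
    by (simp add: add_divide_distrib add.assoc)
qed (use assms in \<open>auto simp: almost_period_def\<close>)

lemma almost_period_uminus:
  assumes "almost_period cs v K" shows "almost_period cs (- v) K"
  unfolding almost_period_def
proof (intro conjI allI impI)
  fix L :: nat and f :: "(nat \<Rightarrow> int) \<Rightarrow> real" and x
  assume "L > 0" and "\<forall>y. \<bar>f y\<bar> \<le> 1"
  then have "\<bar>avs cs L f (x - v + v) - avs cs L f (x - v)\<bar> \<le> K / real L"
    using assms unfolding almost_period_def by blast
  then show "\<bar>avs cs L f (x + - v) - avs cs L f x\<bar> \<le> K / real L"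
    by simp
qed (use assms in \<open>auto simp: almost_period_def\<close>)

lemma almost_period_zero: "almost_period cs 0 0"
  by (auto simp: almost_period_def)

definition add_subgroup :: "'a::ab_group_add set \<Rightarrow> bool" where
  "add_subgroup H \<longleftrightarrow> 0 \<in> H \<and> (\<forall>v\<in>H. \<forall>w\<in>H. v + w \<in> H) \<and> (\<forall>v\<in>H. - v \<in> H)"

lemma add_subgroup_sum: "add_subgroup H \<Longrightarrow> (\<And>i. i \<in> I \<Longrightarrow> f i \<in> H) \<Longrightarrow> (\<Sum>i\<in>I. f i) \<in> H"
  by (induction I rule: infinite_finite_induct) (auto simp: add_subgroup_def)

lemma add_subgroup_sc: assumes "add_subgroup H" "v \<in> H" shows "sc c v \<in> H"
proof -
  have nat: "sc (int n) v \<in> H" for n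
    by (induction n) (use assms in \<open>auto simp: add_subgroup_def sc_add\<close>)
  show ?thesis
  proof (cases "c \<ge> 0")
    case True
    then show ?thesis using nat[of "nat c"] by simp
  next
    case False
    then have "sc c v = - sc (int (nat (- c))) v" by (simp add: sc_add)
    then show ?thesis using nat[of "nat (- c)"] assms(1) unfolding add_subgroup_def by metis
  qed
qed

definition almost_periods :: "(nat \<Rightarrow> int) list \<Rightarrow> (nat \<Rightarrow> int) set" where
  "almost_periods cs = {v. \<exists>K. almost_period cs v K}"

lemma add_subgroup_almost_periods: "add_subgroup (almost_periods cs)"
  unfolding add_subgroup_def almost_periods_def
  using almost_period_zero almost_period_add almost_period_uminus by blast

lemma set_almost_periods: "c \<in> set cs \<Longrightarrow> c \<in> almost_periods cs"
  using almost_period_mem by (auto simp: almost_periods_def)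

abbreviation units :: "nat \<Rightarrow> (nat \<Rightarrow> int) list" where
  "units N \<equiv> map unit [0..<N]"

lemma lat_eq_sum: assumes "v \<in> lat N" shows "v = (\<Sum>l<N. sc (v l) (unit l))"
proof
  fix i
  have "(\<Sum>l<N. sc (v l) (unit l)) i = (\<Sum>l<N. v l * unit l i)"
    by (induction N) (auto simp: fun_apply sc_def)
  also have "\<dots> = (\<Sum>l<N. if i = l then v l else 0)"
    by (intro sum.cong) (auto simp: unit_def)
  also have "\<dots> = v i" using assms by (auto simp: lat_def)
  finally show "v i = (\<Sum>l<N. sc (v l) (unit l)) i" ..
qed

lemma lat_almost_periods: "v \<in> lat N \<Longrightarrow> v \<in> almost_periods (units N)"
  by (subst lat_eq_sum, assumption)
    (intro add_subgroup_sum add_subgroup_sc add_subgroup_almost_periods set_almost_periods, auto)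

text \<open>Every translation in the inner average is an almost period of the outer one. The inner
  side \<open>H\<close> stays fixed while \<open>L\<close> grows, so \<open>K\<close> may depend on
  \<open>H\<close> and \<open>ds\<close>.\<close>

lemma avs_absorb:
  assumes "\<And>d. d \<in> set ds \<Longrightarrow> d \<in> almost_periods cs" and "H > 0"
  shows "\<exists>K. \<forall>L f x. L > 0 \<longrightarrow> (\<forall>y. \<bar>f y\<bar> \<le> 1) \<longrightarrow>
    \<bar>avs cs L (avs ds H f) x - avs cs L f x\<bar> \<le> K / real L"
  using assms(1)
proof (induction ds)
  case Nil
  then show ?case by (intro exI[of _ 0]) auto
next
  case (Cons d ds)
  obtain K where K: "\<And>L f x. L > 0 \<Longrightarrow> (\<forall>y. \<bar>f y\<bar> \<le> 1) \<Longrightarrow>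
    \<bar>avs cs L (avs ds H f) x - avs cs L f x\<bar> \<le> K / real L"
    using Cons by (metis list.set_intros(2))
  have "d \<in> almost_periods cs" using Cons.prems by simp
  then have "\<exists>K. almost_period cs (sc (int n) d) K" for n
    using add_subgroup_sc[OF add_subgroup_almost_periods] by (auto simp: almost_periods_def)
  then obtain Q where Q: "\<And>n. almost_period cs (sc (int n) d) (Q n)" by metis
  then have Q0: "Q n \<ge> 0" for n by (auto simp: almost_period_def)
  show ?case
  proof (intro exI[of _ "(\<Sum>n<H. Q n) + K"] allI impI)
    fix L :: nat and f :: "(nat \<Rightarrow> int) \<Rightarrow> real" and x
    assume L: "L > 0" and f: "\<forall>y. \<bar>f y\<bar> \<le> 1"
    define h where "h = avs ds H f"
    have h: "\<forall>y. \<bar>h y\<bar> \<le> 1" using f avs_bound unfolding h_def by blast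
    have "\<bar>avs cs L h (x + sc (int n) d) - avs cs L h x\<bar> \<le> (\<Sum>n<H. Q n) / real L" if "n < H" for n
    proof -
      have "\<bar>avs cs L h (x + sc (int n) d) - avs cs L h x\<bar> \<le> Q n / real L"
        using Q L h unfolding almost_period_def by blast
      also have "\<dots> \<le> (\<Sum>n<H. Q n) / real L"
        using that Q0 by (intro divide_right_mono member_le_sum) auto
      finally show ?thesis .
    qed
    then have "\<bar>av d H (\<lambda>y. avs cs L h y - avs cs L h x) x\<bar> \<le> (\<Sum>n<H. Q n) / real L"
      by (rule av_bound) (use Q0 in \<open>auto intro!: sum_nonneg divide_nonneg_nonneg\<close>)
    also have "av d H (\<lambda>y. avs cs L h y - avs cs L h x) x = avs cs L (av d H h) x - avs cs L h x"
      using assms(2) by (simp add: av_avs_commute[symmetric] av_def sum_subtractf diff_divide_distrib)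
    finally have "\<bar>avs cs L (avs (d # ds) H f) x - avs cs L h x\<bar> \<le> (\<Sum>n<H. Q n) / real L"
      by (simp add: h_def)
    moreover have "\<bar>avs cs L h x - avs cs L f x\<bar> \<le> K / real L"
      using K[OF L f] by (simp add: h_def)
    ultimately show "\<bar>avs cs L (avs (d # ds) H f) x - avs cs L f x\<bar> \<le> ((\<Sum>n<H. Q n) + K) / real L"
      by (simp add: add_divide_distrib)
  qed
qed

lemma avs_swap: "avs cs L (\<lambda>y. avs ds K (F y) x') x = avs ds K (\<lambda>z. avs cs L (\<lambda>y. F y z) x) x'"
proof (induction cs arbitrary: x)
  case (Cons c cs)
  have s: "avs ds K (\<lambda>z. \<Sum>i\<in>I. G i z) x' = (\<Sum>i\<in>I. avs ds K (G i) x')" for I :: "nat set" and G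
    by (induction I rule: infinite_finite_induct)
      (use avs_cmult[of ds K 0 "\<lambda>x. 0"] in \<open>auto simp: avs_add\<close>)
  show ?case
    using avs_cmult[of ds K "1 / real L" "\<lambda>z. \<Sum>n<L. avs cs L (\<lambda>y. F y z) (x + sc (int n) c)"]
    by (simp add: av_def Cons s)
qed simp

section \<open>Finitely additive invariant means\<close>

locale invariant_mean =
  fixes N :: nat and l :: "((nat \<Rightarrow> int) \<Rightarrow> real) \<Rightarrow> real"
  assumes mean_add: "bd f \<Longrightarrow> bd g \<Longrightarrow> l (\<lambda>x. f x + g x) = l f + l g"
    and mean_cmult: "bd f \<Longrightarrow> l (\<lambda>x. a * f x) = a * l f"
    and mean_nonneg: "bd f \<Longrightarrow> (\<And>x. 0 \<le> f x) \<Longrightarrow> 0 \<le> l f"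
    and mean_one: "l (\<lambda>x. 1) = 1"
    and mean_shift: "bd f \<Longrightarrow> v \<in> lat N \<Longrightarrow> l (\<lambda>x. f (x + v)) = l f"
begin

lemma mean_const: "l (\<lambda>x. a) = a"
  using mean_cmult[of "\<lambda>x. 1" a] mean_one by simp

lemma mean_diff: "bd f \<Longrightarrow> bd g \<Longrightarrow> l (\<lambda>x. f x - g x) = l f - l g"
  using mean_add[of f "\<lambda>x. (-1) * g x"] mean_cmult[of g "-1"] bd_minus[of g] by simp

lemma mean_mono: "bd f \<Longrightarrow> bd g \<Longrightarrow> (\<And>x. f x \<le> g x) \<Longrightarrow> l f \<le> l g"
  using mean_nonneg[of "\<lambda>x. g x - f x"] mean_diff[of g f] by auto

lemma mean_divide: "bd f \<Longrightarrow> l (\<lambda>x. f x / a) = l f / a"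
  using mean_cmult[of f "1 / a"] by simp

lemma mean_sum: "(\<And>i. i \<in> I \<Longrightarrow> bd (f i)) \<Longrightarrow> l (\<lambda>x. \<Sum>i\<in>I. f i x) = (\<Sum>i\<in>I. l (f i))"
  by (induction I rule: infinite_finite_induct) (auto simp: mean_const mean_add bd_sum)

lemma mean_bound: assumes "\<And>x. \<bar>f x\<bar> \<le> M" shows "\<bar>l f\<bar> \<le> M"
proof -
  have "bd f" using assms by (rule bdI)
  then have "l f \<le> l (\<lambda>x. M)" "l (\<lambda>x. - M) \<le> l f"
    using assms by (auto intro!: mean_mono simp: abs_le_iff) (meson minus_le_iff)
  then show ?thesis by (simp add: mean_const)
qed

lemma mean_av: assumes "bd f" "c \<in> lat N" "L > 0" shows "l (av c L f) = l f"
proof -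
  have "l (av c L f) = (\<Sum>n<L. l (\<lambda>x. f (x + sc (int n) c))) / real L"
    unfolding av_def[abs_def] using assms(1) by (subst mean_divide) (auto simp: mean_sum bd_sum bd_shift)
  also have "\<dots> = l f" using assms by (simp add: mean_shift)
  finally show ?thesis .
qed

lemma mean_avs: "bd f \<Longrightarrow> set cs \<subseteq> lat N \<Longrightarrow> L > 0 \<Longrightarrow> l (avs cs L f) = l f"
  by (induction cs) (auto simp: mean_av bd_avs)

text \<open>An average is a finite sum, so finite additivity of the mean suffices for this
  exchange.\<close>

lemma mean_avs_swap:
  assumes "\<And>y. bd (F y)"
  shows "bd (\<lambda>z. avs cs L (\<lambda>y. F y z) x) \<and>
    l (\<lambda>z. avs cs L (\<lambda>y. F y z) x) = avs cs L (\<lambda>y. l (F y)) x"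
proof (induction cs arbitrary: x)
  case (Cons c cs)
  then show ?case
    by (auto simp: av_def mean_divide bd_sum mean_sum bd_divide)
qed (simp add: assms)

text \<open>Shift invariance moves each translation to the other factor with the opposite
  sign.\<close>

lemma mean_avs_adjoint:
  assumes "bd f" "bd g" "set cs \<subseteq> lat N"
  shows "l (\<lambda>x. avs cs L f x * g x) = l (\<lambda>x. f x * avs (map uminus cs) L g x)"
  using assms
proof (induction cs arbitrary: g)
  case (Cons c cs)
  have one: "l (\<lambda>x. av c L f x * g x) = l (\<lambda>x. f x * av (- c) L g x)" if "bd f" "bd g" for f g
  proof -
    have "l (\<lambda>x. f (x + sc (int n) c) * g x) = l (\<lambda>x. f x * g (x + sc (int n) (- c)))" for n
      using mean_shift[of "\<lambda>x. f x * g (x + sc (int n) (- c))" "sc (int n) c"] that Cons.prems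
      by (auto simp: sc_add bd_mult bd_shift)
    then have "(\<Sum>n<L. l (\<lambda>x. f (x + sc (int n) c) * g x)) / real L =
        (\<Sum>n<L. l (\<lambda>x. f x * g (x + sc (int n) (- c)))) / real L" by simp
    also have "(\<Sum>n<L. l (\<lambda>x. f (x + sc (int n) c) * g x)) / real L = l (\<lambda>x. av c L f x * g x)"
      unfolding av_def[abs_def] times_divide_eq_left sum_distrib_right
      using that by (subst mean_divide) (auto simp: mean_sum bd_sum bd_shift bd_mult)
    also have "(\<Sum>n<L. l (\<lambda>x. f x * g (x + sc (int n) (- c)))) / real L = l (\<lambda>x. f x * av (- c) L g x)"
      unfolding av_def[abs_def] times_divide_eq_right sum_distrib_left
      using that by (subst mean_divide) (auto simp: mean_sum bd_sum bd_shift bd_mult)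
    finally show ?thesis .
  qed
  show ?case
    using one[of "avs cs L f" g] Cons.IH[of "av (- c) L g"] Cons.prems
    by (auto simp: av_avs_commute bd_avs bd_av)
qed simp

lemma mean_shift_adjoint:
  assumes "bd f" "bd g" "u \<in> lat N" "v \<in> lat N"
  shows "l (\<lambda>x. f (x + u) * g (x + v)) = l (\<lambda>x. f x * g (x + (v - u)))"
proof -
  have "bd (\<lambda>x. f x * g (x + (v - u)))" using assms by (intro bd_mult bd_shift)
  from mean_shift[OF this assms(3)] show ?thesis by (simp add: algebra_simps)
qed

lemma mean_avs_square_le:
  assumes "bd f" "set cs \<subseteq> lat N" "L > 0"
  shows "l (\<lambda>x. (avs cs L f x)\<^sup>2) \<le> l (\<lambda>x. (f x)\<^sup>2)"
  using assms(2)
proof (induction cs)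
  case (Cons c cs)
  define h where "h = avs cs L f"
  have h: "bd h" using assms(1) by (auto simp: h_def)
  have "(av c L h x)\<^sup>2 \<le> av c L (\<lambda>x. (h x)\<^sup>2) x" for x
    using sum_squared_le_sum_of_squares[of "\<lambda>n. h (x + sc (int n) c)" "{..<L}"] assms(3)
    by (simp add: av_def power_divide field_simps power2_eq_square)
  then have "l (\<lambda>x. (av c L h x)\<^sup>2) \<le> l (av c L (\<lambda>x. (h x)\<^sup>2))"
    using h by (intro mean_mono) auto
  also have "\<dots> = l (\<lambda>x. (h x)\<^sup>2)" using h Cons assms by (intro mean_av) auto
  finally show ?case using Cons by (auto simp: h_def)
qed simp

lemma mean_Cauchy_Schwarz:
  assumes "bd f" "bd g" "l (\<lambda>x. (f x)\<^sup>2) \<le> 1"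
  shows "(l (\<lambda>x. f x * g x))\<^sup>2 \<le> l (\<lambda>x. (g x)\<^sup>2)"
proof -
  define C where "C = l (\<lambda>x. f x * g x)"
  \<comment> \<open>Expanding gives 2 C^2 \<le> |g|^2 + C^2 |f|^2 with |f| \<le> 1. There is no
    division by the norm of \<open>f\<close>, hence no degenerate case.\<close>
  have "0 \<le> l (\<lambda>x. (g x - C * f x)\<^sup>2)" using assms by (intro mean_nonneg) auto
  also have "(\<lambda>x. (g x - C * f x)\<^sup>2) =
      (\<lambda>x. ((g x)\<^sup>2 + C\<^sup>2 * (f x)\<^sup>2) - (2 * C) * (f x * g x))"
    by (auto simp: fun_eq_iff power2_eq_square algebra_simps)
  also have "l \<dots> = l (\<lambda>x. (g x)\<^sup>2) + C\<^sup>2 * l (\<lambda>x. (f x)\<^sup>2) - 2 * C * C"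
    using assms by (subst mean_diff) (auto simp: mean_add mean_cmult C_def bd_mult bd_power intro!: bd_add bd_mult bd_power)
  finally have "2 * C\<^sup>2 \<le> l (\<lambda>x. (g x)\<^sup>2) + C\<^sup>2 * l (\<lambda>x. (f x)\<^sup>2)"
    by (simp add: power2_eq_square)
  moreover have "C\<^sup>2 * l (\<lambda>x. (f x)\<^sup>2) \<le> C\<^sup>2" using assms(3) by (simp add: mult_left_le)
  ultimately show ?thesis unfolding C_def by linarith
qed

end

section \<open>Averages along quadratic sequences\<close>

definition lists_of :: "'a set \<Rightarrow> nat \<Rightarrow> 'a list set" where
  "lists_of I n = {xs. set xs \<subseteq> I \<and> length xs = n}"

lemma finite_lists_of: "finite I \<Longrightarrow> finite (lists_of I n)"
  unfolding lists_of_def by (rule finite_lists_length_eq)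

lemma card_lists_of: "finite I \<Longrightarrow> card (lists_of I n) = card I ^ n"
  unfolding lists_of_def by (rule card_lists_length_eq)

lemma sum_lists_of_append:
  "(\<Sum>xs\<in>lists_of I n. \<Sum>ys\<in>lists_of I k. f (xs @ ys)) = (\<Sum>zs\<in>lists_of I (n + k). (f zs :: real))"
proof -
  have "bij_betw (\<lambda>(xs, ys). xs @ ys) (lists_of I n \<times> lists_of I k) (lists_of I (n + k))"
    by (rule bij_betw_byWitness[where f' = "\<lambda>zs. (take n zs, drop n zs)"])
      (auto simp: lists_of_def dest: in_set_takeD in_set_dropD)
  then show ?thesis
    by (subst sum.reindex_bij_betw[symmetric, of "\<lambda>(xs, ys). xs @ ys"])
      (auto simp: sum.cartesian_product case_prod_unfold)
qed

lemma sum_lists_of_Suc: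
  "(\<Sum>zs\<in>lists_of I (Suc n). (f zs :: real)) = (\<Sum>i\<in>I. \<Sum>xs\<in>lists_of I n. f (i # xs))"
proof -
  have "bij_betw (\<lambda>(i, xs). i # xs) (I \<times> lists_of I n) (lists_of I (Suc n))"
    by (rule bij_betw_byWitness[where f' = "\<lambda>zs. (hd zs, tl zs)"])
      (auto simp: lists_of_def length_Suc_conv)
  then show ?thesis
    by (subst sum.reindex_bij_betw[symmetric, of "\<lambda>(i, xs). i # xs"])
      (auto simp: sum.cartesian_product case_prod_unfold)
qed

text \<open>The index \<open>(s, h, h')\<close> stands for the direction \<open>s\<close> and the difference \<open>h - h'\<close>.\<close>

definition generic :: "(nat \<times> nat \<times> nat) list \<Rightarrow> bool" where
  "generic xs \<longleftrightarrow> distinct (map fst xs) \<and> (\<forall>(s, h, h')\<in>set xs. h \<noteq> h')"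

text \<open>A union bound. A new entry spoils genericity if its two parameters \<open>h\<close>,
  \<open>h'\<close> coincide or if it repeats one of the \<open>n\<close> earlier directions; each
  of these \<open>n + 1\<close> events has proportion at most 1/M, and the proportions add up along
  the tuple.\<close>

lemma card_nongeneric:
  assumes "finite S" "card S = M" "M > 0" "I = S \<times> {..<M} \<times> {..<M}"
  shows "(\<Sum>xs\<in>lists_of I n. of_bool (\<not> generic xs)) \<le> real (n + n\<^sup>2) / real M * real (card I) ^ n"
proof (induction n)
  case 0
  then show ?case by (simp add: lists_of_def generic_def sum_nonneg)
next
  case (Suc n)
  have I: "finite I" "card I = M * M * M" using assms by (auto simp: card_cartesian_product)
  define cI where "cI = real (card I)"
  have cI: "cI = real M * real M * real M" by (simp add: cI_def I)
  let ?b = "\<lambda>xs. of_bool (\<not> generic xs) :: real"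
  have split: "?b (i # xs) \<le> ?b xs + of_bool (fst (snd i) = snd (snd i)) + (\<Sum>x\<leftarrow>xs. of_bool (fst i = fst x))"
    for i xs
  proof -
    have nn: "0 \<le> (\<Sum>x\<leftarrow>xs. of_bool (fst i = fst x) :: real)" by (intro sum_list_nonneg) auto
    have "1 \<le> (\<Sum>x\<leftarrow>xs. of_bool (fst i = fst x) :: real)" if "fst i \<in> fst ` set xs"
      using that
    proof (induction xs)
      case (Cons x xs)
      have "0 \<le> (\<Sum>x\<leftarrow>xs. of_bool (fst i = fst x) :: real)" by (intro sum_list_nonneg) auto
      then show ?case using Cons by (cases "fst i = fst x") auto
    qed simp
    then show ?thesis using nn by (cases i) (auto simp: generic_def of_bool_def)
  qed
  have c1: "(\<Sum>i\<in>I. of_bool (fst (snd i) = snd (snd i))) = real M * real M"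
  proof -
    have "I \<inter> {i. fst (snd i) = snd (snd i)} = (\<lambda>(s, h). (s, h, h)) ` (S \<times> {..<M})"
      using assms(4) by (auto simp: image_iff)
    moreover have "card ((\<lambda>(s, h). (s, h, h)) ` (S \<times> {..<M})) = M * M"
      by (subst card_image) (auto simp: inj_on_def card_cartesian_product assms)
    ultimately show ?thesis using I by (simp add: of_bool_def sum.If_cases)
  qed
  have c2: "(\<Sum>i\<in>I. of_bool (fst i = s)) \<le> real M * real M" for s
  proof -
    have "I \<inter> {i. fst i = s} \<subseteq> {s} \<times> {..<M} \<times> {..<M}" using assms(4) by auto
    then have "card (I \<inter> {i. fst i = s}) \<le> card ({s} \<times> {..<M} \<times> {..<M})"
      by (intro card_mono) auto
    then have "card (I \<inter> {i. fst i = s}) \<le> M * M" by (simp add: card_cartesian_product)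
    then have "real (card (I \<inter> {i. fst i = s})) \<le> real (M * M)" by (rule of_nat_mono)
    then show ?thesis using I by (simp add: of_bool_def sum.If_cases)
  qed
  have c3: "(\<Sum>i\<in>I. \<Sum>x\<leftarrow>xs. of_bool (fst i = fst x)) \<le> real (length xs) * (real M * real M)" for xs :: "(nat \<times> nat \<times> nat) list"
  proof (induction xs)
    case (Cons x xs)
    then show ?case using c2[of "fst x"] by (simp add: sum.distrib algebra_simps)
  qed simp
  have "(\<Sum>zs\<in>lists_of I (Suc n). ?b zs) = (\<Sum>i\<in>I. \<Sum>xs\<in>lists_of I n. ?b (i # xs))"
    by (rule sum_lists_of_Suc)
  also have "\<dots> \<le> (\<Sum>i\<in>I. \<Sum>xs\<in>lists_of I n. ?b xs + of_bool (fst (snd i) = snd (snd i)) + (\<Sum>x\<leftarrow>xs. of_bool (fst i = fst x)))"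
    by (intro sum_mono split)
  also have "\<dots> = (\<Sum>xs\<in>lists_of I n. \<Sum>i\<in>I. ?b xs + of_bool (fst (snd i) = snd (snd i)) + (\<Sum>x\<leftarrow>xs. of_bool (fst i = fst x)))"
    by (rule sum.swap)
  also have "\<dots> \<le> (\<Sum>xs\<in>lists_of I n. cI * ?b xs + real M * real M + real n * (real M * real M))"
  proof (intro sum_mono)
    fix xs assume "xs \<in> lists_of I n"
    then have "length xs = n" by (simp add: lists_of_def)
    then show "(\<Sum>i\<in>I. ?b xs + of_bool (fst (snd i) = snd (snd i)) + (\<Sum>x\<leftarrow>xs. of_bool (fst i = fst x)))
       \<le> cI * ?b xs + real M * real M + real n * (real M * real M)"
      using c3[of xs] c1 by (simp add: sum.distrib cI_def)
  qed
  also have "\<dots> = cI * (\<Sum>xs\<in>lists_of I n. ?b xs) + cI ^ n * (real (n + 1) * (real M * real M))"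
    using I by (simp add: sum.distrib sum_distrib_left card_lists_of cI_def algebra_simps)
  also have "\<dots> \<le> cI * (real (n + n\<^sup>2) / real M * cI ^ n) + cI ^ n * (real (n + 1) * (real M * real M))"
    using Suc.IH by (intro add_mono mult_left_mono) (auto simp: cI_def)
  also have "\<dots> = (real (n + n\<^sup>2) + real (n + 1)) / real M * cI ^ Suc n"
    using assms(3) by (simp add: cI field_simps)
  also have "\<dots> \<le> real (Suc n + (Suc n)\<^sup>2) / real M * cI ^ Suc n"
    by (intro mult_right_mono divide_right_mono) (auto simp: cI_def power2_eq_square)
  finally show ?case by (simp add: cI_def)
qed

text \<open>A finite-index condition stated through all subgroups containing the directions, so that
  it applies directly to groups of almost periods. The integer \<open>q\<close> depends on
  \<open>S\<close> but not on \<open>H\<close>.\<close>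

definition spanning :: "nat \<Rightarrow> (nat \<Rightarrow> nat \<Rightarrow> int) \<Rightarrow> nat \<Rightarrow> bool" where
  "spanning N R m \<longleftrightarrow> (\<forall>s. R s \<in> lat N) \<and> (\<forall>S. finite S \<and> card S = m \<longrightarrow>
     (\<exists>q>0. \<forall>H. add_subgroup H \<and> R ` S \<subseteq> H \<longrightarrow> (\<forall>l<N. sc q (unit l) \<in> H)))"

lemma add_subgroup_sc_vimage: "add_subgroup H \<Longrightarrow> add_subgroup {v. sc c v \<in> H}"
  by (auto simp: add_subgroup_def sc_add)

section \<open>Energies along tuples of directions\<close>

context invariant_mean
begin

definition energy :: "(nat \<Rightarrow> int) list \<Rightarrow> nat \<Rightarrow> ((nat \<Rightarrow> int) \<Rightarrow> real) \<Rightarrow> real" where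
  "energy cs L g = l (\<lambda>x. (avs cs L g x)\<^sup>2)"

lemma energy_nonneg: "bd g \<Longrightarrow> 0 \<le> energy cs L g"
  unfolding energy_def by (intro mean_nonneg) auto

lemma energy_le_one: "(\<And>x. \<bar>g x\<bar> \<le> 1) \<Longrightarrow> energy cs L g \<le> 1"
  using mean_bound[of "\<lambda>x. (avs cs L g x)\<^sup>2" 1] avs_bound[of g 1 cs L]
  by (auto simp: energy_def abs_square_le_1)

text \<open>With \<open>B xs\<close> the adjoint of the averaging operator \<open>A xs\<close>, the
  sum of the energies is the inner product of \<open>g\<close> with the sum \<open>P\<close> of all
  \<open>B xs (A xs g)\<close>. Cauchy-Schwarz bounds its square by the squared norm of
  \<open>P\<close>. Since all these operators commute, the cross terms are squared norms of
  \<open>A xs (A ys g)\<close>, that is, energies of concatenated tuples.\<close>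

lemma energy_doubling:
  assumes I: "finite I" and c: "\<And>i. i \<in> I \<Longrightarrow> c i \<in> lat N" and g: "\<And>x. \<bar>g x\<bar> \<le> 1"
  shows "(\<Sum>xs\<in>lists_of I n. energy (map c xs) L g)\<^sup>2 \<le> (\<Sum>xs\<in>lists_of I (n + n). energy (map c xs) L g)"
proof -
  have bg: "bd g" using g by (rule bdI)
  define A where "A xs = avs (map c xs) L" for xs
  define B where "B xs = avs (map uminus (map c xs)) L" for xs
  have bA: "bd f \<Longrightarrow> bd (A xs f)" and bB: "bd f \<Longrightarrow> bd (B xs f)" for xs f by (auto simp: A_def B_def)
  have lat: "set (map c xs) \<subseteq> lat N" "set (map uminus (map c xs)) \<subseteq> lat N" if "xs \<in> lists_of I n" for xs
    using that c by (auto simp: lists_of_def)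
  have uu: "map (uminus \<circ> (uminus \<circ> c)) xs = map c xs" for xs by simp
  have adj: "l (\<lambda>x. A xs f x * h x) = l (\<lambda>x. f x * B xs h x)" if "xs \<in> lists_of I n" "bd f" "bd h" for xs f h
    unfolding A_def B_def using that lat by (intro mean_avs_adjoint)
  have adj': "l (\<lambda>x. B xs f x * h x) = l (\<lambda>x. f x * A xs h x)" if "xs \<in> lists_of I n" "bd f" "bd h" for xs f h
    using mean_avs_adjoint[of f h "map uminus (map c xs)" L] that lat by (simp add: A_def B_def comp_def)
  have comm: "A xs (B ys f) = B ys (A xs f)" "A xs (A ys f) = A ys (A xs f)" for xs ys f
    unfolding A_def B_def by (rule avs_commute)+
  have e: "energy (map c xs) L g = l (\<lambda>x. g x * B xs (A xs g) x)" if "xs \<in> lists_of I n" for xs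
    using adj[OF that bg bA[OF bg]] by (simp add: energy_def A_def power2_eq_square)
  define P where "P x = (\<Sum>xs\<in>lists_of I n. B xs (A xs g) x)" for x
  have bP: "bd P" unfolding P_def by (intro bd_sum bA bB bg)
  have "(\<Sum>xs\<in>lists_of I n. energy (map c xs) L g) = l (\<lambda>x. g x * P x)"
    unfolding P_def sum_distrib_left using bg bA bB by (subst mean_sum) (auto intro!: sum.cong e)
  also have "\<dots>\<^sup>2 \<le> l (\<lambda>x. (P x)\<^sup>2)"
    using mean_bound[of "\<lambda>x. (g x)\<^sup>2" 1] g by (intro mean_Cauchy_Schwarz bg bP) (auto simp: abs_square_le_1)
  also have "\<dots> = (\<Sum>xs\<in>lists_of I n. \<Sum>ys\<in>lists_of I n. l (\<lambda>x. B xs (A xs g) x * B ys (A ys g) x))"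
    unfolding P_def power2_eq_square sum_product using bg bA bB
    by (simp add: mean_sum)
  also have "\<dots> = (\<Sum>xs\<in>lists_of I n. \<Sum>ys\<in>lists_of I n. energy (map c (xs @ ys)) L g)"
  proof (intro sum.cong refl)
    fix xs ys assume xy: "xs \<in> lists_of I n" "ys \<in> lists_of I n"
    have "l (\<lambda>x. B xs (A xs g) x * B ys (A ys g) x) = l (\<lambda>x. A xs g x * A xs (B ys (A ys g)) x)"
      using xy bg bA bB by (intro adj') auto
    also have "\<dots> = l (\<lambda>x. A xs g x * B ys (A xs (A ys g)) x)" by (simp add: comm)
    also have "\<dots> = l (\<lambda>x. A ys (A xs g) x * A xs (A ys g) x)"
      using xy bg bA bB by (intro adj[symmetric]) auto
    also have "\<dots> = energy (map c (xs @ ys)) L g"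
      by (simp add: energy_def comm(2)[of ys xs] power2_eq_square) (simp add: A_def)
    finally show "l (\<lambda>x. B xs (A xs g) x * B ys (A ys g) x) = energy (map c (xs @ ys)) L g" .
  qed
  also have "\<dots> = (\<Sum>xs\<in>lists_of I (n + n). energy (map c xs) L g)"
    by (rule sum_lists_of_append)
  finally show ?thesis .
qed

text \<open>Energy along many single directions forces joint energy along many tuples. Iterated
  doubling is the reason for tuple lengths of the form \<open>2 ^ r\<close>.\<close>

lemma energy_power:
  assumes I: "finite I" and c: "\<And>i. i \<in> I \<Longrightarrow> c i \<in> lat N" and g: "\<And>x. \<bar>g x\<bar> \<le> 1"
  shows "(\<Sum>i\<in>I. energy [c i] L g) ^ (2 ^ r) \<le> (\<Sum>xs\<in>lists_of I (2 ^ r). energy (map c xs) L g)"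
proof (induction r)
  case 0
  have "lists_of I 1 = (\<lambda>i. [i]) ` I" by (auto simp: lists_of_def length_Suc_conv image_iff)
  then show ?case by (simp add: sum.reindex inj_on_def)
next
  case (Suc r)
  have bg: "bd g" using g by (rule bdI)
  have "(\<Sum>i\<in>I. energy [c i] L g) ^ (2 ^ Suc r) = ((\<Sum>i\<in>I. energy [c i] L g) ^ (2 ^ r))\<^sup>2"
    by (simp add: power_mult[symmetric] mult.commute)
  also have "\<dots> \<le> (\<Sum>xs\<in>lists_of I (2 ^ r). energy (map c xs) L g)\<^sup>2"
    using Suc bg by (intro power_mono zero_le_power sum_nonneg energy_nonneg) auto
  also have "\<dots> \<le> (\<Sum>xs\<in>lists_of I (2 ^ r + 2 ^ r). energy (map c xs) L g)"
    by (rule energy_doubling[OF I c g])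
  finally show ?case by (simp add: mult_2)
qed

text \<open>The directions of a generic tuple generate a subgroup of finite index, so the iterated
  average along them absorbs averages over a sublattice.\<close>

lemma energy_generic:
  assumes R: "spanning N R m" and g: "\<And>x. \<bar>g x\<bar> \<le> 1" and k: "k > 0"
    and small: "\<And>j. j > 0 \<Longrightarrow> \<exists>H>0. energy (map (\<lambda>l. sc (int (k * j)) (unit l)) [0..<N]) H g \<le> \<epsilon>"
    and gen: "generic xs" "length xs = m" and a: "\<And>s h h'. (s, h, h') \<in> set xs \<Longrightarrow> a s \<noteq> 0"
    and \<delta>: "\<delta> > 0"
    and c: "c = (\<lambda>(s, h, h'). sc (int k * (2 * (int h - int h') * a s)) (R s))"
  shows "\<forall>\<^sub>F L in sequentially. energy (map c xs) L g \<le> \<epsilon> + \<delta>"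
proof -
  define w where "w = (\<lambda>(s, h, h'). 2 * (int h - int h') * a s)"
  have w0: "w i \<noteq> 0" if "i \<in> set xs" for i
    using that gen(1) a by (fastforce simp: w_def generic_def)
  \<comment> \<open>A common multiple of the factors in front of the directions, so that each
    \<open>sc (int k * J) (R s)\<close> with \<open>s \<in> S\<close> is a multiple of some
    \<open>c i\<close>.\<close>
  define J where "J = (\<Prod>i\<in>set xs. w i)"
  have J0: "J \<noteq> 0" using w0 by (simp add: J_def)
  define S where "S = fst ` set xs"
  have "card S = m" using gen distinct_card[of "map fst xs"] by (auto simp: S_def generic_def)
  then obtain q where q: "q > 0"
    "\<And>H. add_subgroup H \<Longrightarrow> R ` S \<subseteq> H \<Longrightarrow> (\<forall>l<N. sc q (unit l) \<in> H)"
    using R unfolding spanning_def S_def by (metis List.finite_set finite_imageI)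
  \<comment> \<open>The almost periods are pulled back along a dilation, so that
    \<open>spanning\<close> can be applied to the vectors \<open>R s\<close> themselves.\<close>
  define H where "H = {v. sc (int k * J) v \<in> almost_periods (map c xs)}"
  have H: "add_subgroup H" unfolding H_def
    by (intro add_subgroup_sc_vimage add_subgroup_almost_periods)
  have "R s \<in> H" if "s \<in> S" for s
  proof -
    obtain i where i: "i \<in> set xs" "s = fst i" using \<open>s \<in> S\<close> by (auto simp: S_def)
    have "w i dvd J" unfolding J_def using i by (intro dvd_prodI) auto
    then obtain z where z: "J = w i * z" by (auto simp: dvd_def)
    have "c i \<in> almost_periods (map c xs)" using i by (intro set_almost_periods) auto
    then have "sc z (c i) \<in> almost_periods (map c xs)"
      by (rule add_subgroup_sc[OF add_subgroup_almost_periods])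
    moreover have "sc z (c i) = sc (int k * J) (R s)"
    proof -
      obtain s' h h' where i': "i = (s', h, h')" by (cases i)
      show ?thesis using i z unfolding i' by (simp add: c w_def mult_ac)
    qed
    ultimately show ?thesis by (simp add: H_def)
  qed
  then have per: "sc q (unit l) \<in> H" if "l < N" for l using q(2)[OF H] that by blast
  \<comment> \<open>The smallness assumption wants a positive natural factor, while \<open>J\<close>
    may be negative; \<open>sgn J\<close> restores the sign below.\<close>
  define j where "j = nat (\<bar>J\<bar> * q)"
  have j: "j > 0" "int j = \<bar>J\<bar> * q" using J0 q(1) by (auto simp: j_def)
  define ds where "ds = map (\<lambda>l. sc (int (k * j)) (unit l)) [0..<N]"
  have ds: "d \<in> almost_periods (map c xs)" if "d \<in> set ds" for d
  proof -
    obtain l where l: "l < N" "d = sc (int (k * j)) (unit l)" using \<open>d \<in> set ds\<close> unfolding ds_def by auto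
    have "d = sc (sgn J) (sc (int k * J) (sc q (unit l)))"
      using j by (simp add: l abs_sgn mult_ac)
    then show ?thesis
      using per[OF l(1)] add_subgroup_sc[OF add_subgroup_almost_periods] unfolding H_def by blast
  qed
  obtain H where H: "H > 0" "energy ds H g \<le> \<epsilon>" using small[OF j(1)] by (auto simp: ds_def)
  obtain K where K: "\<And>L f x. L > 0 \<Longrightarrow> \<forall>y. \<bar>f y\<bar> \<le> 1 \<Longrightarrow>
      \<bar>avs (map c xs) L (avs ds H f) x - avs (map c xs) L f x\<bar> \<le> K / real L"
    using avs_absorb[OF ds H(1)] by metis
  have bg: "bd g" using g by (rule bdI)
  have "\<forall>\<^sub>F L in sequentially. K / real L < \<delta> / 2"
    using \<delta> by real_asymp
  moreover have "\<forall>\<^sub>F L in sequentially. L > 0" by (rule eventually_gt_at_top)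
  ultimately show ?thesis
  proof eventually_elim
    case (elim L)
    have lat: "set (map c xs) \<subseteq> lat N" using R by (auto simp: c spanning_def)
    have "(avs (map c xs) L g x)\<^sup>2 \<le> (avs (map c xs) L (avs ds H g) x)\<^sup>2 + \<delta>" for x
    proof -
      define a where "a = avs (map c xs) L g x"
      define b where "b = avs (map c xs) L (avs ds H g) x"
      have ab: "\<bar>a\<bar> \<le> 1" "\<bar>b\<bar> \<le> 1"
        using avs_bound[of g 1] avs_bound[of "avs ds H g" 1] g unfolding a_def b_def by auto
      have "\<bar>b - a\<bar> \<le> K / real L" using K[of L g x] elim g by (simp add: a_def b_def)
      then have "\<bar>a - b\<bar> \<le> \<delta> / 2" using elim by linarith
      have "a\<^sup>2 - b\<^sup>2 = (a - b) * (a + b)" by (simp add: power2_eq_square algebra_simps)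
      also have "\<dots> \<le> \<bar>a - b\<bar> * \<bar>a + b\<bar>" by (metis abs_ge_self abs_mult)
      also have "\<dots> \<le> (\<delta> / 2) * 2" using ab \<delta> \<open>\<bar>a - b\<bar> \<le> \<delta> / 2\<close> by (intro mult_mono) auto
      finally show ?thesis by (simp add: a_def b_def)
    qed
    then have "energy (map c xs) L g \<le> l (\<lambda>x. (avs (map c xs) L (avs ds H g) x)\<^sup>2 + \<delta>)"
      unfolding energy_def using bg by (intro mean_mono) auto
    also have "\<dots> = l (\<lambda>x. (avs (map c xs) L (avs ds H g) x)\<^sup>2) + \<delta>"
      using bg by (subst mean_add) (auto simp: mean_const)
    also have "\<dots> \<le> energy ds H g + \<delta>"
      unfolding energy_def using bg elim lat by (intro add_right_mono mean_avs_square_le) auto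
    finally show ?case using H(2) by simp
  qed
qed

text \<open>Van der Corput: differencing \<open>x s n\<close> in \<open>n\<close> leaves the linear average along
  \<open>2 (h - h') a\<^sub>s R\<^sub>s\<close>. Writing the parameter as \<open>r + h\<close> with independent
  \<open>r < L\<close> and \<open>h < M\<close> makes the inequality exact.\<close>

lemma van_der_Corput:
  fixes y b R :: "nat \<Rightarrow> nat \<Rightarrow> int" and a :: "nat \<Rightarrow> int"
  assumes lat: "\<And>s. y s \<in> lat N" "\<And>s. b s \<in> lat N" "\<And>s. R s \<in> lat N"
    and g: "\<And>x. \<bar>g x\<bar> \<le> 1" and M: "M > 0" and S: "finite S" "card S = M" and L: "L > 0"
    and x: "x = (\<lambda>s n. sc (int k) (y s + sc (int n) (b s) - sc ((int n)\<^sup>2 * a s) (R s)))"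
    and c: "c = (\<lambda>(s, h, h'). sc (int k * (2 * (int h - int h') * a s)) (R s))"
    and I: "I = S \<times> {..<M} \<times> {..<M}"
  shows "(l (\<lambda>z. ((\<Sum>(s, r, h)\<in>S \<times> {..<L} \<times> {..<M}. g (z + x s (r + h))) / real (M * L * M))\<^sup>2))\<^sup>2
    \<le> (\<Sum>i\<in>I. energy [c i] L g) / real (card I)"
proof -
  have bg: "bd g" using g by (rule bdI)
  have xlat: "x s n \<in> lat N" for s n using lat by (auto simp: x)
  have cI: "card I = M * (M * M)" using S by (simp add: I card_cartesian_product)
  define A where "A s r z = (\<Sum>h<M. g (z + x s (r + h)))" for s r z
  have bA: "bd (A s r)" for s r using bg unfolding A_def[abs_def] by auto
  define d where "d s h h' = x s h' - x s h" for s h h'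
  have dlat: "d s h h' \<in> lat N" for s h h' using xlat by (auto simp: d_def)
  \<comment> \<open>The terms quadratic in \<open>r\<close> cancel, leaving a sequence affine in
    \<open>r\<close> with slope \<open>c (s, h, h')\<close>.\<close>
  have diff: "x s (r + h') - x s (r + h) = d s h h' + sc (int r) (c (s, h, h'))" for s r h h'
    by (simp add: fun_eq_iff fun_apply sc_def x c d_def algebra_simps power2_eq_square)
  define V where "V = l (\<lambda>z. ((\<Sum>(s, r, h)\<in>S \<times> {..<L} \<times> {..<M}. g (z + x s (r + h))) / real (M * L * M))\<^sup>2)"
  \<comment> \<open>Cauchy-Schwarz over \<open>(s, r)\<close>, with the sum over \<open>h\<close>
    kept inside the square.\<close>
  have "V \<le> l (\<lambda>z. (\<Sum>(s, r)\<in>S \<times> {..<L}. (A s r z)\<^sup>2) / real (M * L * M * M))"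
    unfolding V_def
  proof (rule mean_mono)
    fix z
    have "(\<Sum>(s, r, h)\<in>S \<times> {..<L} \<times> {..<M}. g (z + x s (r + h))) = (\<Sum>(s, r)\<in>S \<times> {..<L}. A s r z)"
      by (simp add: A_def sum.cartesian_product[symmetric])
    then have "(\<Sum>(s, r, h)\<in>S \<times> {..<L} \<times> {..<M}. g (z + x s (r + h)))\<^sup>2
        \<le> (\<Sum>(s, r)\<in>S \<times> {..<L}. (A s r z)\<^sup>2) * real (M * L)"
      using sum_squared_le_sum_of_squares[of "\<lambda>(s, r). A s r z" "S \<times> {..<L}"] S
      by (simp add: card_cartesian_product case_prod_unfold)
    then show "((\<Sum>(s, r, h)\<in>S \<times> {..<L} \<times> {..<M}. g (z + x s (r + h))) / real (M * L * M))\<^sup>2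
        \<le> (\<Sum>(s, r)\<in>S \<times> {..<L}. (A s r z)\<^sup>2) / real (M * L * M * M)"
      using M L by (simp add: power_divide field_simps power2_eq_square)
  qed (use bg bA in \<open>auto simp: case_prod_unfold\<close>)
  also have "\<dots> = (\<Sum>(s, r)\<in>S \<times> {..<L}. l (\<lambda>z. (A s r z)\<^sup>2)) / real (M * L * M * M)"
    using bA by (simp add: mean_divide mean_sum case_prod_unfold)
  also have "(\<Sum>(s, r)\<in>S \<times> {..<L}. l (\<lambda>z. (A s r z)\<^sup>2)) =
      (\<Sum>s\<in>S. \<Sum>r<L. \<Sum>h<M. \<Sum>h'<M. l (\<lambda>z. g z * g (z + (d s h h' + sc (int r) (c (s, h, h'))))))"
    unfolding sum.cartesian_product[symmetric]
  proof (intro sum.cong refl)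
    fix s r
    have "l (\<lambda>z. (A s r z)\<^sup>2) = l (\<lambda>z. \<Sum>h<M. \<Sum>h'<M. g (z + x s (r + h)) * g (z + x s (r + h')))"
      by (simp add: A_def power2_eq_square sum_product)
    also have "\<dots> = (\<Sum>h<M. \<Sum>h'<M. l (\<lambda>z. g (z + x s (r + h)) * g (z + x s (r + h'))))"
      using bg by (simp add: mean_sum)
    also have "\<dots> = (\<Sum>h<M. \<Sum>h'<M. l (\<lambda>z. g z * g (z + (d s h h' + sc (int r) (c (s, h, h'))))))"
      by (simp only: mean_shift_adjoint[OF bg bg xlat xlat] diff)
    finally show "l (\<lambda>z. (A s r z)\<^sup>2) =
      (\<Sum>h<M. \<Sum>h'<M. l (\<lambda>z. g z * g (z + (d s h h' + sc (int r) (c (s, h, h'))))))" .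
  qed
  also have "\<dots> = (\<Sum>s\<in>S. \<Sum>h<M. \<Sum>h'<M. \<Sum>r<L. l (\<lambda>z. g z * g (z + (d s h h' + sc (int r) (c (s, h, h'))))))"
  proof (rule sum.cong[OF refl])
    fix s
    let ?F = "\<lambda>r h h'. l (\<lambda>z. g z * g (z + (d s h h' + sc (int r) (c (s, h, h')))))"
    have "(\<Sum>r<L. \<Sum>h<M. \<Sum>h'<M. ?F r h h') = (\<Sum>h<M. \<Sum>r<L. \<Sum>h'<M. ?F r h h')"
      by (rule sum.swap)
    also have "\<dots> = (\<Sum>h<M. \<Sum>h'<M. \<Sum>r<L. ?F r h h')"
      by (intro sum.cong refl sum.swap)
    finally show "(\<Sum>r<L. \<Sum>h<M. \<Sum>h'<M. ?F r h h') = (\<Sum>h<M. \<Sum>h'<M. \<Sum>r<L. ?F r h h')" .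
  qed
  also have "\<dots> = (\<Sum>s\<in>S. \<Sum>h<M. \<Sum>h'<M. real L * l (\<lambda>z. g z * av (c (s, h, h')) L g (z + d s h h')))"
  proof (intro sum.cong refl)
    fix s h h'
    have "real L * l (\<lambda>z. g z * av (c (s, h, h')) L g (z + d s h h')) =
        l (\<lambda>z. real L * (g z * av (c (s, h, h')) L g (z + d s h h')))"
      using bg by (simp add: mean_cmult)
    also have "\<dots> = l (\<lambda>z. \<Sum>r<L. g z * g (z + d s h h' + sc (int r) (c (s, h, h'))))"
      using L by (simp add: av_def sum_distrib_left[symmetric])
    also have "\<dots> = (\<Sum>r<L. l (\<lambda>z. g z * g (z + (d s h h' + sc (int r) (c (s, h, h'))))))"
      using bg by (subst mean_sum) (auto simp: add.assoc)
    finally show "(\<Sum>r<L. l (\<lambda>z. g z * g (z + (d s h h' + sc (int r) (c (s, h, h')))))) =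
      real L * l (\<lambda>z. g z * av (c (s, h, h')) L g (z + d s h h'))" ..
  qed
  also have "\<dots> / real (M * L * M * M) =
      (\<Sum>(s, h, h')\<in>I. l (\<lambda>z. g z * av (c (s, h, h')) L g (z + d s h h'))) / real (card I)"
  proof -
    have "(\<Sum>(s, h, h')\<in>I. l (\<lambda>z. g z * av (c (s, h, h')) L g (z + d s h h'))) =
        (\<Sum>s\<in>S. \<Sum>h<M. \<Sum>h'<M. l (\<lambda>z. g z * av (c (s, h, h')) L g (z + d s h h')))"
      unfolding I by (simp only: sum.cartesian_product[symmetric])
    then show ?thesis
      using L unfolding cI by (simp add: sum_distrib_left[symmetric])
  qed
  finally have V: "V \<le> (\<Sum>(s, h, h')\<in>I. l (\<lambda>z. g z * av (c (s, h, h')) L g (z + d s h h'))) / real (card I)" .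
  have "V \<ge> 0" unfolding V_def using bg by (intro mean_nonneg) (auto simp: case_prod_unfold)
  then have "V\<^sup>2 \<le> ((\<Sum>(s, h, h')\<in>I. l (\<lambda>z. g z * av (c (s, h, h')) L g (z + d s h h'))) / real (card I))\<^sup>2"
    using V by (intro power_mono)
  \<comment> \<open>A second Cauchy-Schwarz over \<open>I\<close>: once squared, each correlation
    with \<open>g\<close> is at most the energy along its slope, because |g| \<le> 1.\<close>
  also have "\<dots> \<le> (\<Sum>(s, h, h')\<in>I. (l (\<lambda>z. g z * av (c (s, h, h')) L g (z + d s h h')))\<^sup>2) / real (card I)"
    using sum_squared_le_sum_of_squares[of "\<lambda>(s, h, h'). l (\<lambda>z. g z * av (c (s, h, h')) L g (z + d s h h'))" I] M
    by (simp add: power_divide case_prod_unfold divide_simps power2_eq_square cI)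
  also have "\<dots> \<le> (\<Sum>(s, h, h')\<in>I. energy [c (s, h, h')] L g) / real (card I)"
  proof (intro divide_right_mono sum_mono, clarsimp)
    fix s h h'
    have "(l (\<lambda>z. g z * av (c (s, h, h')) L g (z + d s h h')))\<^sup>2 \<le> l (\<lambda>z. (av (c (s, h, h')) L g (z + d s h h'))\<^sup>2)"
      using mean_bound[of "\<lambda>x. (g x)\<^sup>2" 1] g bg
      by (intro mean_Cauchy_Schwarz bd_shift) (auto simp: abs_square_le_1)
    also have "\<dots> = energy [c (s, h, h')] L g"
      using mean_shift[of "\<lambda>z. (av (c (s, h, h')) L g z)\<^sup>2" "d s h h'"] bg dlat by (auto simp: energy_def)
    finally show "(l (\<lambda>z. g z * av (c (s, h, h')) L g (z + d s h h')))\<^sup>2 \<le> energy [c (s, h, h')] L g" .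
  qed auto
  finally show ?thesis by (simp add: V_def case_prod_unfold)
qed

end

context invariant_mean
begin

text \<open>The order of choices matters: \<open>M\<close> makes non-generic tuples rare, and only
  then is \<open>L\<close> taken large enough for the finitely many generic ones. The exponent of
  \<kappa> comes from V^2 \<le> Q and Q^m \<le> \<kappa>^(4 m) with \<open>m = 2 ^ r\<close>, where
  \<open>Q\<close> is the average energy along one direction. The triples in \<open>T\<close> count
  shifts with multiplicity.\<close>

lemma polynomial_average_small:
  fixes y b R :: "nat \<Rightarrow> nat \<Rightarrow> int" and a :: "nat \<Rightarrow> int"
  assumes R: "spanning N R (2 ^ r)" and g: "\<And>x. \<bar>g x\<bar> \<le> 1" and k: "k > 0"
    and lat: "\<And>s. y s \<in> lat N" "\<And>s. b s \<in> lat N" and a: "\<And>s. s \<ge> s0 \<Longrightarrow> a s \<noteq> 0"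
    and small: "\<And>j. j > 0 \<Longrightarrow> \<exists>H>0. energy (map (\<lambda>l. sc (int (k * j)) (unit l)) [0..<N]) H g \<le> \<epsilon>"
    and \<epsilon>: "\<epsilon> < \<kappa> ^ (4 * 2 ^ r)" and \<kappa>: "\<kappa> > 0"
  shows "\<exists>T u. finite T \<and> T \<noteq> {} \<and>
    (\<forall>t\<in>T. \<exists>s n. u t = sc (int k) (y s + sc (int n) (b s) - sc ((int n)\<^sup>2 * a s) (R s))) \<and>
    l (\<lambda>z. ((\<Sum>t\<in>(T :: (nat \<times> nat \<times> nat) set). g (z + u t)) / real (card T))\<^sup>2) \<le> \<kappa>\<^sup>2"
proof -
  define m :: nat where "m = 2 ^ r"
  have bg: "bd g" using g by (rule bdI)
  define \<eta> where "\<eta> = \<kappa> ^ (4 * m) - \<epsilon>"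
  have \<eta>: "\<eta> > 0" using \<epsilon> by (simp add: \<eta>_def m_def)
  have "\<forall>\<^sub>F M in sequentially. real (m + m\<^sup>2) / real M < \<eta> / 2" using \<eta> by real_asymp
  then obtain M where M: "M > 0" "real (m + m\<^sup>2) / real M < \<eta> / 2"
    by (metis (mono_tags, lifting) eventually_sequentially linorder_not_le nle_le zero_less_Suc Suc_le_eq)
  \<comment> \<open>Starting at \<open>s0\<close> keeps the quadratic coefficients
    \<open>a s\<close> nonzero.\<close>
  define S where "S = {s0..<s0 + M}"
  have S: "finite S" "card S = M" by (auto simp: S_def)
  define I where "I = S \<times> {..<M} \<times> {..<M}"
  have I: "finite I" "card I > 0" using S M by (auto simp: I_def card_cartesian_product)
  define c where "c = (\<lambda>(s, h, h'). sc (int k * (2 * (int h - int h') * a s)) (R s))"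
  have c: "c i \<in> lat N" for i using R by (cases i) (auto simp: c_def spanning_def)
  have "\<forall>xs\<in>lists_of I m. \<forall>\<^sub>F L in sequentially. generic xs \<longrightarrow> energy (map c xs) L g \<le> \<epsilon> + \<eta> / 2"
  proof
    fix xs assume xs: "xs \<in> lists_of I m"
    show "\<forall>\<^sub>F L in sequentially. generic xs \<longrightarrow> energy (map c xs) L g \<le> \<epsilon> + \<eta> / 2"
    proof (cases "generic xs")
      case True
      have "a s \<noteq> 0" if "(s, h, h') \<in> set xs" for s h h'
        using that xs a[of s] by (auto simp: lists_of_def I_def S_def)
      then have "\<forall>\<^sub>F L in sequentially. energy (map c xs) L g \<le> \<epsilon> + \<eta> / 2"
        using xs \<eta> True by (intro energy_generic[OF R g k small, where a = a]) (auto simp: lists_of_def m_def c_def)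
      then show ?thesis by simp
    qed simp
  qed
  then have "\<forall>\<^sub>F L in sequentially. \<forall>xs\<in>lists_of I m. generic xs \<longrightarrow> energy (map c xs) L g \<le> \<epsilon> + \<eta> / 2"
    by (rule eventually_ball_finite[OF finite_lists_of[OF I(1)]])
  then obtain L where L: "L > 0" "\<And>xs. xs \<in> lists_of I m \<Longrightarrow> generic xs \<Longrightarrow> energy (map c xs) L g \<le> \<epsilon> + \<eta> / 2"
    using eventually_happens'[OF sequentially_bot eventually_conj[OF eventually_gt_at_top[of 0]]] by blast
  define Q where "Q = (\<Sum>i\<in>I. energy [c i] L g) / real (card I)"
  have "\<exists>H>0. energy (map (\<lambda>l. sc (int (k * 1)) (unit l)) [0..<N]) H g \<le> \<epsilon>" by (rule small) simp
  then have "\<epsilon> \<ge> 0" using energy_nonneg[OF bg] order_trans by blast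
  have "(\<Sum>i\<in>I. energy [c i] L g) ^ m \<le> (\<Sum>xs\<in>lists_of I m. energy (map c xs) L g)"
    unfolding m_def using I c g by (intro energy_power)
  \<comment> \<open>Generic tuples contribute at most \<epsilon> + \<eta>/2, and the others at most
    the trivial bound 1.\<close>
  also have "\<dots> \<le> (\<Sum>xs\<in>lists_of I m. (\<epsilon> + \<eta> / 2) + of_bool (\<not> generic xs))"
  proof (intro sum_mono)
    fix xs assume "xs \<in> lists_of I m"
    then show "energy (map c xs) L g \<le> (\<epsilon> + \<eta> / 2) + of_bool (\<not> generic xs)"
      using L(2)[of xs] energy_le_one[of g "map c xs" L, OF g] \<open>\<epsilon> \<ge> 0\<close> \<eta> by (cases "generic xs") auto
  qed
  also have "\<dots> = (\<epsilon> + \<eta> / 2) * real (card I) ^ m + (\<Sum>xs\<in>lists_of I m. of_bool (\<not> generic xs))"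
    using I by (simp add: sum.distrib card_lists_of)
  also have "\<dots> \<le> (\<epsilon> + \<eta> / 2) * real (card I) ^ m + real (m + m\<^sup>2) / real M * real (card I) ^ m"
    by (intro add_left_mono card_nongeneric[OF S M(1) I_def])
  also have "\<dots> \<le> (\<epsilon> + \<eta> / 2) * real (card I) ^ m + \<eta> / 2 * real (card I) ^ m"
    using M(2) by (intro add_left_mono mult_right_mono) auto
  also have "\<dots> = \<kappa> ^ (4 * m) * real (card I) ^ m"
    by (simp add: \<eta>_def algebra_simps)
  finally have "Q ^ m \<le> (\<kappa> ^ 4) ^ m"
    using I by (simp add: Q_def power_divide divide_le_eq power_mult)
  then have "Q \<le> \<kappa> ^ 4" using \<kappa> by (intro power_le_imp_le_base[of Q "m - 1"]) (auto simp: m_def)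
  define u where "u = (\<lambda>(s, r, h). sc (int k) (y s + sc (int (r + h)) (b s) - sc ((int (r + h))\<^sup>2 * a s) (R s)))"
  define T where "T = S \<times> {..<L} \<times> {..<M}"
  have T: "finite T" "T \<noteq> {}" "card T = M * L * M"
    using S M L by (auto simp: T_def card_cartesian_product)
  define V where "V = l (\<lambda>z. ((\<Sum>t\<in>T. g (z + u t)) / real (card T))\<^sup>2)"
  have "V\<^sup>2 \<le> Q"
    using van_der_Corput[of y b R g M S L, OF lat _ g M(1) S L(1) refl c_def I_def] R
    by (simp add: spanning_def V_def T(3) Q_def u_def case_prod_unfold) (simp add: T_def)
  then have "V\<^sup>2 \<le> (\<kappa>\<^sup>2)\<^sup>2" using \<open>Q \<le> \<kappa> ^ 4\<close> by simp
  then have "V \<le> \<kappa>\<^sup>2" by (rule power2_le_imp_le) simp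
  then show ?thesis
  proof (intro exI[of _ T] exI[of _ u] conjI ballI)
    fix t assume "t \<in> T"
    obtain s r h where "t = (s, r, h)" by (cases t)
    then show "\<exists>s n. u t = sc (int k) (y s + sc (int n) (b s) - sc ((int n)\<^sup>2 * a s) (R s))"
      by (intro exI[of _ s] exI[of _ "r + h"]) (simp add: u_def)
  qed (use T in \<open>auto simp: V_def\<close>)
qed

end

section \<open>Periodic parts of bounded functions\<close>

lemma eventually_nhds_coordinate:
  fixes \<phi> :: "'i \<Rightarrow> real"
  assumes "\<epsilon> > 0" shows "\<forall>\<^sub>F \<psi> in nhds \<phi>. \<bar>\<phi> i - \<psi> i\<bar> < (\<epsilon> :: real)"
proof -
  have "open ((\<lambda>\<psi> :: 'i \<Rightarrow> real. \<psi> i) -` ball (\<phi> i) \<epsilon>)"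
    using continuous_on_open_vimage[OF open_UNIV, THEN iffD1, OF continuous_on_product_coordinates[of i]]
    by auto
  then show ?thesis using assms by (auto simp: eventually_nhds dist_real_def)
qed

text \<open>By Tychonoff the box averages, as points of a product of compact intervals, have a
  cluster point. It approximates any finite family of functions at arbitrarily late stages, and each
  axiom of a mean involves only finitely many functions at once. \<open>H n > n\<close> makes the
  boundary terms vanish, which gives invariance.\<close>

lemma invariant_mean_cluster:
  fixes x :: "nat \<Rightarrow> nat \<Rightarrow> int" and H :: "nat \<Rightarrow> nat"
  assumes H: "\<And>n. H n > n"
  obtains l where "invariant_mean N l"
    and "\<And>\<Phi> \<epsilon> n0. finite \<Phi> \<Longrightarrow> \<forall>\<phi>\<in>\<Phi>. bd \<phi> \<Longrightarrow> \<epsilon> > 0 \<Longrightarrow>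
      \<exists>n\<ge>n0. \<forall>\<phi>\<in>\<Phi>. \<bar>l \<phi> - avs (units N) (H n) \<phi> (x n)\<bar> < \<epsilon>"
proof -
  \<comment> \<open>The default 0 on unbounded functions keeps every coordinate in a compact
    interval.\<close>
  define m where "m n \<phi> = (if bd \<phi> then avs (units N) (H n) \<phi> (x n) else 0)" for n \<phi>
  have "\<exists>M. \<forall>n. \<bar>m n \<phi>\<bar> \<le> M" for \<phi>
  proof (cases "bd \<phi>")
    case True
    then obtain M where "\<And>x. \<bar>\<phi> x\<bar> \<le> M" by (auto simp: bd_def)
    then have "\<bar>m n \<phi>\<bar> \<le> M" for n using True avs_bound[of \<phi> M] by (simp add: m_def)
    then show ?thesis by blast
  qed (auto simp: m_def)
  then obtain B where B: "\<And>\<phi> n. \<bar>m n \<phi>\<bar> \<le> B \<phi>" by metis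
  define C where "C = PiE UNIV (\<lambda>\<phi>. {- B \<phi>..B \<phi>})"
  have "compactin (product_topology (\<lambda>_. euclidean) UNIV) C"
    unfolding C_def compactin_PiE by simp
  then have "compact C" by (simp only: euclidean_product_topology compactin_euclidean_iff)
  moreover have "eventually (\<lambda>\<phi>. \<phi> \<in> C) (filtermap m sequentially)"
  proof -
    have "- B \<phi> \<le> m n \<phi>" "m n \<phi> \<le> B \<phi>" for n \<phi> using B[of n \<phi>] by linarith+
    then show ?thesis by (simp add: C_def eventually_filtermap PiE_UNIV_domain)
  qed
  moreover have "filtermap m sequentially \<noteq> bot" by (simp add: filtermap_bot_iff)
  ultimately obtain l where l: "inf (nhds l) (filtermap m sequentially) \<noteq> bot"
    unfolding compact_filter by blast
  have approx: "\<exists>n\<ge>n0. \<forall>\<phi>\<in>\<Phi>. \<bar>l \<phi> - avs (units N) (H n) \<phi> (x n)\<bar> < \<epsilon>"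
    if \<Phi>: "finite \<Phi>" "\<forall>\<phi>\<in>\<Phi>. bd \<phi>" and \<epsilon>: "\<epsilon> > 0" for \<Phi> \<epsilon> n0
  proof (rule ccontr)
    assume none: "\<not> ?thesis"
    define P where "P \<psi> \<longleftrightarrow> (\<forall>\<phi>\<in>\<Phi>. \<bar>l \<phi> - \<psi> \<phi>\<bar> < \<epsilon>)" for \<psi> :: "((nat \<Rightarrow> int) \<Rightarrow> real) \<Rightarrow> real"
    have "eventually P (nhds l)"
      unfolding P_def
    proof (rule eventually_ball_finite[OF \<Phi>(1)], rule ballI)
      fix \<phi>
      show "\<forall>\<^sub>F \<psi> in nhds l. \<bar>l \<phi> - \<psi> \<phi>\<bar> < \<epsilon>"
        using \<epsilon> by (rule eventually_nhds_coordinate)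
    qed
    moreover have "\<not> P (m n)" if "n \<ge> n0" for n
      using none that \<Phi> unfolding P_def m_def by fastforce
    then have "eventually (\<lambda>\<psi>. \<not> P \<psi>) (filtermap m sequentially)"
      unfolding eventually_filtermap by (auto simp: eventually_sequentially)
    ultimately have "eventually (\<lambda>_. False) (inf (nhds l) (filtermap m sequentially))"
      unfolding eventually_inf by blast
    then show False using l by (simp add: trivial_limit_def)
  qed
  have "invariant_mean N l"
  proof
    fix f g :: "(nat \<Rightarrow> int) \<Rightarrow> real" assume fg: "bd f" "bd g"
    have "\<bar>l (\<lambda>x. f x + g x) - (l f + l g)\<bar> \<le> \<epsilon>" if \<epsilon>: "\<epsilon> > 0" for \<epsilon>
    proof -
      obtain n where "\<bar>l f - avs (units N) (H n) f (x n)\<bar> < \<epsilon> / 3"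
        "\<bar>l g - avs (units N) (H n) g (x n)\<bar> < \<epsilon> / 3"
        "\<bar>l (\<lambda>x. f x + g x) - (avs (units N) (H n) f (x n) + avs (units N) (H n) g (x n))\<bar> < \<epsilon> / 3"
        using approx[of "{f, g, \<lambda>x. f x + g x}" "\<epsilon> / 3" 0] \<epsilon> fg by (auto simp: avs_add)
      then show ?thesis by linarith
    qed
    then show "l (\<lambda>x. f x + g x) = l f + l g" by (metis dense_eq0_I eq_iff_diff_eq_0)
  next
    fix f :: "(nat \<Rightarrow> int) \<Rightarrow> real" and a :: real assume f: "bd f"
    have "\<bar>l (\<lambda>x. a * f x) - a * l f\<bar> \<le> \<epsilon>" if \<epsilon>: "\<epsilon> > 0" for \<epsilon>
    proof -
      \<comment> \<open>Solves \<delta> + |a| \<delta> = \<epsilon>.\<close>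
      define \<delta> where "\<delta> = \<epsilon> / (1 + \<bar>a\<bar>)"
      have "\<delta> > 0" using \<epsilon> by (simp add: \<delta>_def)
      then obtain n where n: "\<bar>l (\<lambda>x. a * f x) - a * avs (units N) (H n) f (x n)\<bar> < \<delta>"
        "\<bar>l f - avs (units N) (H n) f (x n)\<bar> < \<delta>"
        using approx[of "{f, \<lambda>x. a * f x}" \<delta> 0] f \<open>\<delta> > 0\<close> by (auto simp: avs_cmult)
      have "\<bar>l (\<lambda>x. a * f x) - a * l f\<bar> \<le>
        \<bar>l (\<lambda>x. a * f x) - a * avs (units N) (H n) f (x n)\<bar> + \<bar>a * (l f - avs (units N) (H n) f (x n))\<bar>"
        by (simp add: algebra_simps)
      also have "\<dots> \<le> \<delta> + \<bar>a\<bar> * \<delta>"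
        using n by (auto simp: abs_mult intro!: add_mono mult_left_mono)
      also have "\<dots> = \<epsilon>" 
      proof -
        have "\<delta> * (1 + \<bar>a\<bar>) = \<epsilon>" unfolding \<delta>_def by (rule nonzero_eq_divide_eq[THEN iffD1]) auto
        then show ?thesis by (simp add: algebra_simps)
      qed
      finally show ?thesis .
    qed
    then show "l (\<lambda>x. a * f x) = a * l f" by (metis dense_eq0_I eq_iff_diff_eq_0)
  next
    fix f :: "(nat \<Rightarrow> int) \<Rightarrow> real" assume f: "bd f" "\<And>x. 0 \<le> f x"
    have "- \<epsilon> \<le> l f" if \<epsilon>: "\<epsilon> > 0" for \<epsilon>
    proof -
      obtain n where "\<bar>l f - avs (units N) (H n) f (x n)\<bar> < \<epsilon>"
        using approx[of "{f}" \<epsilon> 0] f \<epsilon> by auto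
      moreover have "0 \<le> avs (units N) (H n) f (x n)" using f(2) by (rule avs_nonneg)
      ultimately show ?thesis by linarith
    qed
    then have "0 \<le> l f + \<epsilon>" if "\<epsilon> > 0" for \<epsilon> using that by fastforce
    then show "0 \<le> l f" by (rule field_le_epsilon)
  next
    have "\<bar>l (\<lambda>x. 1) - 1\<bar> \<le> \<epsilon>" if \<epsilon>: "\<epsilon> > 0" for \<epsilon>
    proof -
      obtain n where "\<bar>l (\<lambda>x. 1) - avs (units N) (H n) (\<lambda>x. 1) (x n)\<bar> < \<epsilon>"
        using approx[of "{\<lambda>x. 1}" \<epsilon> 0] \<epsilon> by auto
      moreover have "H n > 0" using H[of n] by simp
      ultimately show ?thesis by (simp add: avs_const)
    qed
    then show "l (\<lambda>x. 1) = 1" by (metis dense_eq0_I eq_iff_diff_eq_0)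
  next
    fix f :: "(nat \<Rightarrow> int) \<Rightarrow> real" and v assume f: "bd f" and v: "v \<in> lat N"
    obtain M0 where M0: "M0 \<ge> 0" "\<And>x. \<bar>f x\<bar> \<le> M0" using bdE[OF f] by blast
    \<comment> \<open>\<open>almost_period\<close> concerns functions bounded by 1; the added 1
      keeps the scale positive even if \<open>f\<close> vanishes.\<close>
    define M where "M = M0 + 1"
    have M: "M > 0" "\<And>x. \<bar>f x / M\<bar> \<le> 1" using M0 by (auto simp: M_def divide_le_eq intro: order_trans[OF M0(2)])
    obtain K where K: "almost_period (units N) v K"
      using lat_almost_periods[OF v] by (auto simp: almost_periods_def)
    have sh: "\<bar>avs (units N) (H n) (\<lambda>x. f (x + v)) (x n) - avs (units N) (H n) f (x n)\<bar> \<le> M * K / real n"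
      if "n > 0" for n
    proof -
      have "\<bar>avs (units N) (H n) (\<lambda>x. 1 / M * f x) (x n + v) - avs (units N) (H n) (\<lambda>x. 1 / M * f x) (x n)\<bar> \<le> K / real (H n)"
        using K M(2) H[of n] unfolding almost_period_def by simp
      then have "\<bar>avs (units N) (H n) f (x n + v) - avs (units N) (H n) f (x n)\<bar> / M \<le> K / real (H n)"
        using M(1) by (simp only: avs_cmult) (simp add: diff_divide_distrib[symmetric])
      also have "\<dots> \<le> K / real n"
        using K H[of n] that by (intro divide_left_mono) (auto simp: almost_period_def)
      finally show ?thesis using M by (simp add: avs_shift field_simps)
    qed
    have "\<bar>l (\<lambda>x. f (x + v)) - l f\<bar> \<le> \<epsilon>" if \<epsilon>: "\<epsilon> > 0" for \<epsilon>
    proof -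
      obtain n0 :: nat where n0: "real n0 > 3 * (M * K) / \<epsilon>" using reals_Archimedean2 by blast
      obtain n where n: "n \<ge> Suc n0" "\<bar>l (\<lambda>x. f (x + v)) - avs (units N) (H n) (\<lambda>x. f (x + v)) (x n)\<bar> < \<epsilon> / 3"
          "\<bar>l f - avs (units N) (H n) f (x n)\<bar> < \<epsilon> / 3"
        using approx[of "{f, \<lambda>x. f (x + v)}" "\<epsilon> / 3" "Suc n0"] \<epsilon> f by auto
      have "3 * (M * K) / \<epsilon> < real n" using n0 n by linarith
      then have "M * K / real n \<le> \<epsilon> / 3" using \<epsilon> n by (simp add: field_simps)
      then show ?thesis using n sh[of n] by linarith
    qed
    then show "l (\<lambda>x. f (x + v)) = l f" by (metis dense_eq0_I eq_iff_diff_eq_0)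
  qed
  then show thesis using approx that by blast
qed

section \<open>Coset indicators and periodic functions\<close>

definition chi :: "nat \<Rightarrow> nat \<Rightarrow> (nat \<Rightarrow> int) \<Rightarrow> (nat \<Rightarrow> int) \<Rightarrow> real" where
  "chi N k y z = of_bool (\<forall>l<N. int k dvd z l - y l)"

text \<open>Congruence is tested in the first \<open>N\<close> coordinates only, so a periodic
  function also ignores all later coordinates.\<close>

definition periodic :: "nat \<Rightarrow> nat \<Rightarrow> ((nat \<Rightarrow> int) \<Rightarrow> real) \<Rightarrow> bool" where
  "periodic N k \<psi> \<longleftrightarrow> (\<forall>x y. (\<forall>l<N. int k dvd x l - y l) \<longrightarrow> \<psi> x = \<psi> y)"

lemma bd_chi [simp]: "bd (chi N k y)" "bd (\<lambda>y. chi N k y z)"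
  by (auto intro!: bdI[of _ 1] simp: chi_def)

lemma chi_commute: "chi N k y z = chi N k z y"
  by (simp add: chi_def dvd_diff_commute)

lemma chi_nonneg: "0 \<le> chi N k y z"
  by (simp add: chi_def)

lemma periodic_mult_chi: "periodic N k \<psi> \<Longrightarrow> \<psi> y * chi N k y z = \<psi> z * chi N k y z"
  by (cases "\<forall>l<N. int k dvd z l - y l") (auto simp: chi_def periodic_def)

lemma periodic_chi: "periodic N k (chi N k y)"
proof -
  have "(\<forall>l<N. int k dvd x l - y l) \<longleftrightarrow> (\<forall>l<N. int k dvd x' l - y l)"
    if "\<forall>l<N. int k dvd x l - x' l" for x x'
  proof (intro all_cong)
    fix l assume "l < N"
    then have "int k dvd x l - x' l" using that by blast
    then show "int k dvd x l - y l \<longleftrightarrow> int k dvd x' l - y l"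
      by (metis diff_add_cancel diff_diff_eq2 dvd_add_right_iff add_diff_eq)
  qed
  then show ?thesis by (auto simp: periodic_def chi_def)
qed

lemma avs_mult_invariant:
  assumes "\<And>c x n. c \<in> set cs \<Longrightarrow> h (x + sc (int n) c) = h x"
  shows "avs cs L (\<lambda>z. h z * f z) = (\<lambda>z. h z * avs cs L f z)"
  using assms
proof (induction cs)
  case (Cons c cs)
  have "avs cs L (\<lambda>z. h z * f z) = (\<lambda>z. h z * avs cs L f z)" using Cons by simp
  moreover have "av c L (\<lambda>z. h z * avs cs L f z) x = h x * av c L (avs cs L f) x" for x
    using Cons.prems[of c] by (simp add: av_def sum_distrib_left)
  ultimately show ?case by auto
qed simp

lemma sum_residue: assumes "k > 0" shows "(\<Sum>n<k. of_bool (int k dvd a + int n) :: real) = 1"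
proof -
  define r where "r = nat ((- a) mod int k)"
  have r: "r < k" "int r = (- a) mod int k" using assms by (auto simp: r_def nat_less_iff)
  have "int k dvd a + int n \<longleftrightarrow> n = r" if "n < k" for n
  proof -
    have "int k dvd a + int n \<longleftrightarrow> int n mod int k = (- a) mod int k"
      unfolding mod_eq_dvd_iff by (simp add: add.commute)
    then show ?thesis using that r(1) unfolding r(2)[symmetric] by simp
  qed
  then have "(\<Sum>n<k. of_bool (int k dvd a + int n) :: real) = (\<Sum>n<k. if n = r then 1 else 0)"
    by (intro sum.cong) auto
  then show ?thesis using r by simp
qed

lemma avs_residue:
  assumes "k > 0" "distinct ls"
  shows "avs (map unit ls) k (\<lambda>z. of_bool (\<forall>l\<in>set ls. int k dvd z l - y l)) = (\<lambda>z. 1 / real k ^ length ls)"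
  using assms(2)
proof (induction ls)
  case (Cons i ls)
  have "avs (map unit (i # ls)) k (\<lambda>z. of_bool (\<forall>l\<in>set (i # ls). int k dvd z l - y l)) =
    av (unit i) k (avs (map unit ls) k (\<lambda>z. of_bool (int k dvd z i - y i) * of_bool (\<forall>l\<in>set ls. int k dvd z l - y l)))"
    by (simp add: of_bool_conj)
  also have "avs (map unit ls) k (\<lambda>z. of_bool (int k dvd z i - y i) * of_bool (\<forall>l\<in>set ls. int k dvd z l - y l)) =
    (\<lambda>z. of_bool (int k dvd z i - y i) * (1 / real k ^ length ls))"
  proof -
    define e where "e z = (of_bool (int k dvd z i - y i) :: real)" for z
    define h where "h z = (of_bool (\<forall>l\<in>set ls. int k dvd z l - y l) :: real)" for z
    have "e (x + sc (int n) c) = e x" if "c \<in> set (map unit ls)" for c x n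
    proof -
      obtain j where "j \<in> set ls" "c = unit j" using \<open>c \<in> set (map unit ls)\<close> by auto
      then have "(x + sc (int n) c) i = x i"
        using Cons.prems by (auto simp: fun_apply sc_def unit_def)
      then show ?thesis by (simp add: e_def)
    qed
    then have "avs (map unit ls) k (\<lambda>z. e z * h z) = (\<lambda>z. e z * avs (map unit ls) k h z)"
      by (rule avs_mult_invariant)
    moreover have "avs (map unit ls) k h = (\<lambda>z. 1 / real k ^ length ls)"
      using Cons unfolding h_def[abs_def] by simp
    ultimately show ?thesis by (simp add: e_def h_def)
  qed
  also have "av (unit i) k \<dots> = (\<lambda>z. 1 / real k ^ length (i # ls))"
  proof
    fix z
    have "(\<Sum>n<k. of_bool (int k dvd (z + sc (int n) (unit i)) i - y i) :: real) = 1"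
      using sum_residue[OF assms(1), of "z i - y i"] by (simp add: fun_apply sc_def unit_def algebra_simps)
    then show "av (unit i) k (\<lambda>z. of_bool (int k dvd z i - y i) * (1 / real k ^ length ls)) z = 1 / real k ^ length (i # ls)"
      by (simp add: av_def sum_distrib_right[symmetric] sum_divide_distrib[symmetric])
  qed
  finally show ?case .
qed simp

lemma avs_chi: "k > 0 \<Longrightarrow> avs (units N) k (chi N k y) = (\<lambda>z. 1 / real k ^ N)"
  using avs_residue[of k "[0..<N]" y] by (simp add: chi_def[abs_def] Ball_def)

text \<open>Writes a periodic function as a finite combination of coset indicators, in the form of
  an average over one period. Claims about periodic functions thus reduce to claims about
  \<open>chi\<close>.\<close>

lemma periodic_expand:
  assumes "k > 0" "periodic N k \<psi>"
  shows "real k ^ N * avs (units N) k (\<lambda>y. \<psi> y * chi N k y z) x = \<psi> z"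
proof -
  have "(\<lambda>y. \<psi> y * chi N k y z) = (\<lambda>y. \<psi> z * chi N k z y)"
  proof
    fix y
    show "\<psi> y * chi N k y z = \<psi> z * chi N k z y"
      using periodic_mult_chi[OF assms(2), of y z] chi_commute[of N k y z] by simp
  qed
  then show ?thesis using assms(1) by (simp add: avs_cmult avs_chi)
qed

text \<open>After expansion at \<open>x'\<close> and an exchange of the two averages only coset
  indicators are averaged from \<open>x\<close>, and their average is the same from every base
  point.\<close>

lemma periodic_avs_eq:
  assumes "k > 0" "periodic N k \<psi>"
  shows "avs (units N) k \<psi> x = avs (units N) k \<psi> x'"
proof -
  have "avs (units N) k \<psi> x = avs (units N) k (\<lambda>z. real k ^ N * avs (units N) k (\<lambda>y. \<psi> y * chi N k y z) x') x"
    by (simp add: periodic_expand[OF assms])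
  also have "\<dots> = real k ^ N * avs (units N) k (\<lambda>z. avs (units N) k (\<lambda>y. \<psi> y * chi N k y z) x') x"
    by (simp only: avs_cmult)
  also have "\<dots> = real k ^ N * avs (units N) k (\<lambda>y. avs (units N) k (\<lambda>z. \<psi> y * chi N k y z) x) x'"
    by (simp only: avs_swap[of "units N" k "units N" k "\<lambda>z y. \<psi> y * chi N k y z" x' x])
  also have "\<dots> = real k ^ N * avs (units N) k (\<lambda>y. 1 / real k ^ N * \<psi> y) x'"
    using assms(1) by (simp add: avs_cmult avs_chi)
  also have "\<dots> = avs (units N) k \<psi> x'"
    using assms(1) unfolding avs_cmult by simp
  finally show ?thesis .
qed

text \<open>Division of the parameter by \<open>k\<close>: the remainder runs through one period,
  the quotient along the direction \<open>sc (int k) c\<close>.\<close>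

lemma av_mult: "av c (k * H) f x = av c k (av (sc (int k) c) H f) x"
proof -
  have "(\<Sum>n<k * H. f (x + sc (int n) c)) = (\<Sum>q<H. \<Sum>n\<in>{q * k..<q * k + k}. f (x + sc (int n) c))"
    by (simp add: sum.nat_group mult.commute)
  also have "\<dots> = (\<Sum>q<H. \<Sum>n<k. f (x + sc (int (q * k + n)) c))"
  proof (rule sum.cong[OF refl])
    fix q
    show "(\<Sum>n\<in>{q * k..<q * k + k}. f (x + sc (int n) c)) = (\<Sum>n<k. f (x + sc (int (q * k + n)) c))"
      using sum.shift_bounds_nat_ivl[of "\<lambda>n. f (x + sc (int n) c)" 0 "q * k" k]
      by (simp add: atLeast0LessThan add.commute)
  qed
  also have "\<dots> = (\<Sum>n<k. \<Sum>q<H. f (x + sc (int n) c + sc (int q) (sc (int k) c)))"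
    by (subst sum.swap) (simp add: sc_add add_ac)
  finally show ?thesis by (simp add: av_def sum_divide_distrib[symmetric])
qed

lemma avs_mult: "avs cs (k * H) f = avs cs k (avs (map (sc (int k)) cs) H f)"
proof (induction cs)
  case (Cons c cs)
  have "avs (c # cs) (k * H) f = av c k (av (sc (int k) c) H (avs cs k (avs (map (sc (int k)) cs) H f)))"
    by (simp add: Cons av_mult[abs_def])
  then show ?case by (simp add: av_avs_commute)
qed simp

text \<open>Allows a function to be exchanged for a periodic one that agrees with it on the box at
  \<open>x\<close>.\<close>

lemma avs_cong_box:
  assumes "distinct ls"
    and "\<And>v. (\<And>i. i \<in> set ls \<Longrightarrow> 0 \<le> v i \<and> v i < int k) \<Longrightarrow> (\<And>i. i \<notin> set ls \<Longrightarrow> v i = 0) \<Longrightarrow> f (x + v) = g (x + v)"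
  shows "avs (map unit ls) k f x = avs (map unit ls) k g x"
  using assms
proof (induction ls arbitrary: x)
  case Nil
  then show ?case using Nil(2)[of 0] by (simp add: fun_apply)
next
  case (Cons i ls)
  have "avs (map unit ls) k f (x + sc (int n) (unit i)) = avs (map unit ls) k g (x + sc (int n) (unit i))"
    if "n < k" for n
  proof (rule Cons.IH)
    show "distinct ls" using Cons.prems by simp
    fix v assume v: "\<And>i. i \<in> set ls \<Longrightarrow> 0 \<le> v i \<and> v i < int k" "\<And>i. i \<notin> set ls \<Longrightarrow> v i = 0"
    have "f (x + (sc (int n) (unit i) + v)) = g (x + (sc (int n) (unit i) + v))"
      using Cons.prems(1) v that by (intro Cons.prems(2)) (auto simp: fun_apply sc_def unit_def)
    then show "f (x + sc (int n) (unit i) + v) = g (x + sc (int n) (unit i) + v)" by (simp add: add.assoc)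
  qed
  then show ?case by (simp add: av_def)
qed

lemma avs_invariant:
  assumes "\<And>c x n. c \<in> set cs \<Longrightarrow> h (x + sc (int n) c) = h x" "L > 0"
  shows "avs cs L h = h"
  using avs_mult_invariant[of cs h L "\<lambda>_. 1", OF assms(1)] assms(2) by (simp add: avs_const)

lemma periodic_shift: "periodic N k \<psi> \<Longrightarrow> \<psi> (x + sc (int k) v) = \<psi> x"
  by (auto simp: periodic_def fun_apply sc_def)

lemma periodic_shift': "periodic N k \<psi> \<Longrightarrow> \<psi> (x + sc (int n) (sc (int k * j) v)) = \<psi> x"
  using periodic_shift[of N k \<psi> x "sc (int n * j) v"] by (simp add: mult_ac)

text \<open>A cluster point controls only finitely many functions at a time; the coset indicators of
  one modulus are such a family.\<close>

lemma finite_range_chi: assumes "k > 0" shows "finite (range (chi N k))"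
proof -
  define U where "U = {v. \<forall>i. v i \<in> (if i < N then {0..<int k} else {0})}"
  define r where "r y = (\<lambda>i. if i < N then y i mod int k else 0)" for y
  have "chi N k y = chi N k (r y)" for y
  proof
    fix z
    have "int k dvd z i - y i \<longleftrightarrow> int k dvd z i - r y i" if "i < N" for i
      using that unfolding mod_eq_dvd_iff[symmetric] by (simp add: r_def)
    then show "chi N k y z = chi N k (r y) z" by (simp add: chi_def)
  qed
  moreover have "r y \<in> U" for y using assms by (auto simp: r_def U_def)
  ultimately have "range (chi N k) \<subseteq> chi N k ` U" by (metis image_eqI image_subsetI)
  moreover have "finite U"
  proof -
    have "finite (PiE {..<N} (\<lambda>_. {0..<int k}))" by (intro finite_PiE) auto
    moreover have "U \<subseteq> (\<lambda>f i. if i < N then f i else 0) ` PiE {..<N} (\<lambda>_. {0..<int k})"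
    proof
      fix v assume v: "v \<in> U"
      have vi: "v i \<in> (if i < N then {0..<int k} else {0})" for i using v unfolding U_def by blast
      have "v i = (if i < N then restrict v {..<N} i else 0)" for i using vi[of i] by (cases "i < N") auto
      then have "v = (\<lambda>i. if i < N then restrict v {..<N} i else 0)" by (rule ext)
      moreover have "restrict v {..<N} \<in> PiE {..<N} (\<lambda>_. {0..<int k})"
      proof (rule PiE_I)
        fix i assume "i \<in> {..<N}"
        then show "restrict v {..<N} i \<in> {0..<int k}" using vi[of i] by simp
      qed simp
      ultimately show "v \<in> (\<lambda>f i. if i < N then f i else 0) ` PiE {..<N} (\<lambda>_. {0..<int k})" by blast
    qed
    ultimately show ?thesis using finite_surj by blast
  qed
  ultimately show ?thesis using finite_surj by blast
qed

section \<open>Conditional expectation on periodic functions\<close>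

context invariant_mean
begin

lemma mean_chi: assumes "k > 0" shows "l (chi N k y) = 1 / real k ^ N"
proof -
  have "l (avs (units N) k (chi N k y)) = l (chi N k y)"
    using assms by (intro mean_avs) auto
  then show ?thesis using assms by (simp add: avs_chi mean_const)
qed

lemma mean_periodic:
  assumes "k > 0" "periodic N k \<psi>" "bd \<psi>"
  shows "l \<psi> = avs (units N) k \<psi> x"
proof -
  have "l \<psi> = l (avs (units N) k \<psi>)" using assms by (intro mean_avs[symmetric]) auto
  also have "avs (units N) k \<psi> = (\<lambda>_. avs (units N) k \<psi> x)"
    using periodic_avs_eq[OF assms(1,2)] by blast
  finally show ?thesis by (simp add: mean_const)
qed

text \<open>The factor \<open>real k ^ N\<close> is the inverse of the mean of a coset, so the value
  is the density of \<open>f\<close> relative to the coset of \<open>y\<close>.\<close>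

definition coset_density :: "nat \<Rightarrow> ((nat \<Rightarrow> int) \<Rightarrow> real) \<Rightarrow> (nat \<Rightarrow> int) \<Rightarrow> real" where
  "coset_density k f y = real k ^ N * l (\<lambda>z. f z * chi N k y z)"

lemma periodic_coset_density: "periodic N k (coset_density k f)"
proof -
  have "chi N k x = chi N k y" if "\<forall>i<N. int k dvd x i - y i" for x y
  proof
    fix z
    show "chi N k x z = chi N k y z"
      using periodic_chi[of N k z] that unfolding periodic_def chi_commute[of N k _ z] by blast
  qed
  then show ?thesis unfolding periodic_def coset_density_def by metis
qed

lemma coset_density_bounds:
  assumes f: "\<And>x. 0 \<le> f x" "\<And>x. f x \<le> 1" and k: "k > 0"
  shows "0 \<le> coset_density k f y" "coset_density k f y \<le> 1"
proof -
  have abs_f: "\<bar>f x\<bar> \<le> 1" for x using f[of x] by simp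
  then have bf: "bd f" by (rule bdI)
  have "0 \<le> l (\<lambda>z. f z * chi N k y z)" using bf f by (intro mean_nonneg) (auto simp: chi_nonneg)
  then show "0 \<le> coset_density k f y" by (simp add: coset_density_def)
  have "l (\<lambda>z. f z * chi N k y z) \<le> l (chi N k y)"
    using bf f by (intro mean_mono) (auto simp: chi_nonneg mult_left_le_one_le)
  then show "coset_density k f y \<le> 1" using k by (simp add: coset_density_def mean_chi field_simps)
qed

text \<open>In other words, \<open>f - coset_density k f\<close> is orthogonal to the periodic
  functions. It suffices to expand \<psi> in coset indicators and to exchange mean and
  average.\<close>

lemma coset_density_adjoint:
  assumes f: "\<And>x. 0 \<le> f x" "\<And>x. f x \<le> 1" and k: "k > 0" and \<psi>: "bd \<psi>" "periodic N k \<psi>"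
  shows "l (\<lambda>x. coset_density k f x * \<psi> x) = l (\<lambda>x. f x * \<psi> x)"
proof -
  have abs_f: "\<bar>f x\<bar> \<le> 1" for x using f[of x] by simp
  then have bf: "bd f" by (rule bdI)
  have "\<bar>coset_density k f x\<bar> \<le> 1" for x using coset_density_bounds[of f k x, OF f k] by simp
  then have bp: "bd (coset_density k f)" by (rule bdI)
  have "l (\<lambda>x. f x * \<psi> x) = l (\<lambda>z. avs (units N) k (\<lambda>y. real k ^ N * (f z * (\<psi> y * chi N k y z))) 0)"
  proof -
    have "avs (units N) k (\<lambda>y. real k ^ N * (f z * (\<psi> y * chi N k y z))) 0 = f z * \<psi> z" for z
    proof -
      have "avs (units N) k (\<lambda>y. real k ^ N * (f z * (\<psi> y * chi N k y z))) 0 =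
          f z * (real k ^ N * avs (units N) k (\<lambda>y. \<psi> y * chi N k y z) 0)"
        unfolding avs_cmult by (simp add: mult_ac)
      then show ?thesis by (simp only: periodic_expand[OF k \<psi>(2)])
    qed
    then show ?thesis by simp
  qed
  also have "\<dots> = avs (units N) k (\<lambda>y. l (\<lambda>z. real k ^ N * (f z * (\<psi> y * chi N k y z)))) 0"
    using bf by (intro mean_avs_swap[THEN conjunct2]) auto
  also have "\<dots> = avs (units N) k (\<lambda>y. coset_density k f y * \<psi> y) 0"
  proof -
    have "l (\<lambda>z. real k ^ N * (f z * (\<psi> y * chi N k y z))) = coset_density k f y * \<psi> y" for y
      using mean_cmult[of "\<lambda>z. f z * chi N k y z" "real k ^ N * \<psi> y"] bf
      by (simp add: coset_density_def mult_ac)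
    then show ?thesis by simp
  qed
  also have "\<dots> = l (\<lambda>y. coset_density k f y * \<psi> y)"
  proof -
    have "periodic N k (\<lambda>y. coset_density k f y * \<psi> y)"
      using \<psi>(2) periodic_coset_density unfolding periodic_def by metis
    then show ?thesis using bp \<psi> k by (intro mean_periodic[symmetric]) auto
  qed
  finally show ?thesis ..
qed

end

text \<open>\<open>reaches N f k t\<close>: some invariant mean gives the conditional expectation of \<open>f\<close> on the
  \<open>k\<close>-periodic functions a squared norm of at least \<open>t\<close>.\<close>

definition reaches :: "nat \<Rightarrow> ((nat \<Rightarrow> int) \<Rightarrow> real) \<Rightarrow> nat \<Rightarrow> real \<Rightarrow> bool" where
  "reaches N f k t \<longleftrightarrow> (\<exists>l. invariant_mean N l \<and> t \<le> l (\<lambda>x. (invariant_mean.coset_density N l k f x)\<^sup>2))"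

lemma square_diff_le:
  assumes "\<bar>a\<bar> \<le> 1" "\<bar>b\<bar> \<le> 1" "\<bar>a - b\<bar> \<le> \<delta>" shows "a\<^sup>2 - 2 * \<delta> \<le> (b :: real)\<^sup>2"
proof -
  have "a\<^sup>2 - b\<^sup>2 = (a - b) * (a + b)" by (simp add: power2_eq_square algebra_simps)
  also have "\<dots> \<le> \<bar>a - b\<bar> * \<bar>a + b\<bar>" by (metis abs_ge_self abs_mult)
  also have "\<dots> \<le> \<delta> * 2" using assms by (intro mult_mono) auto
  finally show ?thesis by simp
qed

text \<open>Applied in contrapositive form: if no mean reaches \<open>t\<close>, then from some side
  on the local energy is below \<open>t\<close> at every base point, and hence under any given mean.
  The mean constructed here is a cluster point of averages over boxes of side \<open>k * H n\<close>
  at the offending points; its coset densities inherit the local energy.\<close>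

lemma reaches_if_local_energy:
  assumes f: "\<And>x. 0 \<le> f x" "\<And>x. f x \<le> 1" and k: "k > 0"
    and large: "\<And>H0. \<exists>H\<ge>H0. \<exists>x. t \<le> avs (units N) k (\<lambda>y. (avs (map (sc (int k)) (units N)) H f y)\<^sup>2) x"
  shows "reaches N f k t"
proof -
  have abs_f: "\<bar>f x\<bar> \<le> 1" for x using f[of x] by simp
  then have bf: "bd f" by (rule bdI)
  have "\<forall>n. \<exists>H x. H \<ge> Suc n \<and> t \<le> avs (units N) k (\<lambda>y. (avs (map (sc (int k)) (units N)) H f y)\<^sup>2) x"
    using large by blast
  then obtain H X where HX: "\<And>n. H n \<ge> Suc n"
    "\<And>n. t \<le> avs (units N) k (\<lambda>y. (avs (map (sc (int k)) (units N)) (H n) f y)\<^sup>2) (X n)" by metis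
  have kH: "k * H n > n" for n
  proof -
    have "1 * Suc n \<le> k * H n" using HX(1)[of n] k by (intro mult_le_mono) auto
    then show ?thesis by simp
  qed
  obtain l where l: "invariant_mean N l"
    and approx: "\<And>\<Phi> \<epsilon> n0. finite \<Phi> \<Longrightarrow> \<forall>\<phi>\<in>\<Phi>. bd \<phi> \<Longrightarrow> \<epsilon> > 0 \<Longrightarrow>
      \<exists>n\<ge>n0. \<forall>\<phi>\<in>\<Phi>. \<bar>l \<phi> - avs (units N) (k * H n) \<phi> (X n)\<bar> < \<epsilon>"
    using invariant_mean_cluster[of "\<lambda>n. k * H n" N X] kH by metis
  interpret invariant_mean N l by (rule l)
  have p: "\<bar>coset_density k f y\<bar> \<le> 1" for y using coset_density_bounds[of f k y, OF f k] by simp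
  then have bp: "bd (coset_density k f)" by (rule bdI)
  have "t - 2 * \<delta> \<le> l (\<lambda>x. (coset_density k f x)\<^sup>2)" if \<delta>: "\<delta> > 0" for \<delta>
  proof -
    define \<Phi> where "\<Phi> = (\<lambda>c z. f z * c z) ` range (chi N k)"
    have "finite \<Phi>" unfolding \<Phi>_def using finite_range_chi[OF k] by blast
    moreover have "\<forall>\<phi>\<in>\<Phi>. bd \<phi>" using bf by (auto simp: \<Phi>_def)
    moreover have "\<delta> / real k ^ N > 0" using \<delta> k by simp
    ultimately obtain n where n: "\<And>\<phi>. \<phi> \<in> \<Phi> \<Longrightarrow> \<bar>l \<phi> - avs (units N) (k * H n) \<phi> (X n)\<bar> < \<delta> / real k ^ N"
      using approx[of \<Phi> "\<delta> / real k ^ N" 0] by auto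
    define F where "F = avs (map (sc (int k)) (units N)) (H n) f"
    define res where "res v = (\<lambda>i. if i < N then v i mod int k else 0)" for v :: "nat \<Rightarrow> int"
    \<comment> \<open>The periodic extension of \<open>F\<close> from one period at
      \<open>X n\<close>. Its values are exactly the coset densities of \<open>f\<close> in the
      large box, which the mean reproduces up to \<delta>.\<close>
    define \<psi> where "\<psi> y = F (X n + res (y - X n))" for y
    have \<psi>1: "\<bar>\<psi> y\<bar> \<le> 1" for y
      unfolding \<psi>_def F_def using abs_f by (rule avs_bound)
    have \<psi>: "periodic N k \<psi>"
    proof -
      have "res (x - X n) = res (y - X n)" if "\<forall>i<N. int k dvd x i - y i" for x y
      proof
        fix i
        have "(x - X n) i mod int k = (y - X n) i mod int k" if "i < N"
          unfolding mod_eq_dvd_iff fun_apply using \<open>\<forall>i<N. int k dvd x i - y i\<close> that by simp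
        then show "res (x - X n) i = res (y - X n) i" by (simp add: res_def)
      qed
      then show ?thesis by (auto simp: periodic_def \<psi>_def)
    qed
    have box: "\<psi> (X n + v) = F (X n + v)"
      if "\<And>i. i \<in> set [0..<N] \<Longrightarrow> 0 \<le> v i \<and> v i < int k" "\<And>i. i \<notin> set [0..<N] \<Longrightarrow> v i = 0" for v
    proof -
      have "res v = v" using that by (auto simp: res_def fun_eq_iff)
      then show ?thesis by (simp add: \<psi>_def)
    qed
    have "\<bar>\<psi> y - coset_density k f y\<bar> \<le> \<delta>" for y
    proof -
      have "avs (units N) (k * H n) (\<lambda>z. f z * chi N k y z) (X n) =
          avs (units N) k (avs (map (sc (int k)) (units N)) (H n) (\<lambda>z. chi N k y z * f z)) (X n)"
        by (simp add: avs_mult mult.commute)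
      also have "avs (map (sc (int k)) (units N)) (H n) (\<lambda>z. chi N k y z * f z) = (\<lambda>z. chi N k y z * F z)"
        unfolding F_def using periodic_shift'[OF periodic_chi, where j = 1] by (intro avs_mult_invariant) auto
      also have "avs (units N) k (\<lambda>z. chi N k y z * F z) (X n) = avs (units N) k (\<lambda>z. \<psi> z * chi N k z y) (X n)"
      proof (rule avs_cong_box)
        fix v assume "\<And>i. i \<in> set [0..<N] \<Longrightarrow> 0 \<le> v i \<and> v i < int k" "\<And>i. i \<notin> set [0..<N] \<Longrightarrow> v i = 0"
        then have "\<psi> (X n + v) = F (X n + v)" by (rule box)
        then show "chi N k y (X n + v) * F (X n + v) = \<psi> (X n + v) * chi N k (X n + v) y"
          by (simp add: chi_commute)
      qed simp
      finally have "\<psi> y = real k ^ N * avs (units N) (k * H n) (\<lambda>z. f z * chi N k y z) (X n)"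
        using periodic_expand[OF k \<psi>] by simp
      then have "\<bar>\<psi> y - coset_density k f y\<bar> =
          real k ^ N * \<bar>l (\<lambda>z. f z * chi N k y z) - avs (units N) (k * H n) (\<lambda>z. f z * chi N k y z) (X n)\<bar>"
        by (simp add: coset_density_def right_diff_distrib[symmetric] abs_mult abs_minus_commute)
      also have "\<dots> \<le> real k ^ N * (\<delta> / real k ^ N)"
        using n[of "\<lambda>z. f z * chi N k y z"] by (intro mult_left_mono) (auto simp: \<Phi>_def intro: less_imp_le)
      also have "\<dots> = \<delta>" using k by simp
      finally show ?thesis .
    qed
    then have sq: "(\<psi> y)\<^sup>2 - 2 * \<delta> \<le> (coset_density k f y)\<^sup>2" for y using p \<psi>1 by (intro square_diff_le)
    have "avs (units N) k (\<lambda>y. (F y)\<^sup>2) (X n) = avs (units N) k (\<lambda>y. (\<psi> y)\<^sup>2) (X n)"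
    proof (rule avs_cong_box)
      fix v assume "\<And>i. i \<in> set [0..<N] \<Longrightarrow> 0 \<le> v i \<and> v i < int k" "\<And>i. i \<notin> set [0..<N] \<Longrightarrow> v i = 0"
      then have "\<psi> (X n + v) = F (X n + v)" by (rule box)
      then show "(F (X n + v))\<^sup>2 = (\<psi> (X n + v))\<^sup>2" by simp
    qed simp
    then have "t - 2 * \<delta> \<le> avs (units N) k (\<lambda>y. (\<psi> y)\<^sup>2 - 2 * \<delta>) (X n)"
      using HX(2)[of n] k by (simp add: avs_diff avs_const F_def)
    also have "\<dots> \<le> avs (units N) k (\<lambda>y. (coset_density k f y)\<^sup>2) (X n)"
      using sq by (rule avs_mono)
    also have "\<dots> = l (\<lambda>y. (coset_density k f y)\<^sup>2)"
    proof -
      have "periodic N k (\<lambda>y. (coset_density k f y)\<^sup>2)" using periodic_coset_density[of k f] unfolding periodic_def by metis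
      then show ?thesis using bp k by (intro mean_periodic[symmetric]) auto
    qed
    finally show ?thesis .
  qed
  then have "t \<le> l (\<lambda>x. (coset_density k f x)\<^sup>2) + \<epsilon>" if "\<epsilon> > 0" for \<epsilon>
    using that[THEN half_gt_zero] by fastforce
  then have "t \<le> l (\<lambda>x. (coset_density k f x)\<^sup>2)" by (rule field_le_epsilon)
  then show ?thesis using l unfolding reaches_def by blast
qed

section \<open>Energy increment and counting\<close>

lemma reaches_le_one:
  assumes "\<And>x. 0 \<le> f x" "\<And>x. f x \<le> 1" "k > 0" "reaches N f k t" shows "t \<le> 1"
proof -
  obtain l where l: "invariant_mean N l" "t \<le> l (\<lambda>x. (invariant_mean.coset_density N l k f x)\<^sup>2)"
    using assms(4) by (auto simp: reaches_def)
  interpret invariant_mean N l by (rule l)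
  have "\<bar>l (\<lambda>x. (coset_density k f x)\<^sup>2)\<bar> \<le> 1"
  proof (rule mean_bound)
    fix x
    show "\<bar>(coset_density k f x)\<^sup>2\<bar> \<le> 1"
      using coset_density_bounds[of f k x, OF assms(1-3)] by (simp add: abs_square_le_1)
  qed
  then show ?thesis using l(2) by linarith
qed

text \<open>Squared norms never exceed 1, so increments by \<epsilon> must stop. \<open>J\<close> is
  the multiplicative set of admissible moduli: all positive integers for a set of positive density,
  only 1 for a connected group.\<close>

lemma exists_energy_saturated:
  assumes f: "\<And>x. 0 \<le> f x" "\<And>x. f x \<le> 1" and J: "\<And>j. j \<in> J \<Longrightarrow> j > 0" "1 \<in> J"
    "\<And>i j. i \<in> J \<Longrightarrow> j \<in> J \<Longrightarrow> i * j \<in> J"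
    and t0: "reaches N f 1 t0" and \<epsilon>: "\<epsilon> > 0"
  shows "\<exists>k\<in>J. \<exists>t\<ge>t0. reaches N f k t \<and> (\<forall>j\<in>J. \<not> reaches N f (k * j) (t + \<epsilon>))"
proof (rule ccontr)
  assume none: "\<not> ?thesis"
  have "\<exists>k\<in>J. reaches N f k (t0 + real n * \<epsilon>)" for n
  proof (induction n)
    case 0
    then show ?case using t0 J by auto
  next
    case (Suc n)
    then obtain k where k: "k \<in> J" "reaches N f k (t0 + real n * \<epsilon>)" by blast
    moreover have "t0 + real n * \<epsilon> \<ge> t0" using \<epsilon> by simp
    ultimately have "\<exists>j\<in>J. reaches N f (k * j) (t0 + real n * \<epsilon> + \<epsilon>)"
      using none by blast
    then obtain j where "j \<in> J" "reaches N f (k * j) (t0 + real n * \<epsilon> + \<epsilon>)" ..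
    then show ?case using J(3) k by (auto simp: algebra_simps intro!: bexI[of _ "k * j"])
  qed
  then have "t0 + real n * \<epsilon> \<le> 1" for n
  proof -
    from \<open>\<And>n. \<exists>k\<in>J. reaches N f k (t0 + real n * \<epsilon>)\<close>
    obtain k where "k \<in> J" "reaches N f k (t0 + real n * \<epsilon>)" by blast
    then show ?thesis using reaches_le_one[of f k N, OF f] J(1) by blast
  qed
  moreover obtain n :: nat where "real n > (1 - t0) / \<epsilon>" using reals_Archimedean2 by blast
  ultimately show False using \<epsilon> by (simp add: pos_divide_less_eq) (metis add.commute diff_less_eq not_less)
qed

text \<open>A substitute for Jensen's inequality: the lower bound is affine in \<open>p\<close>, so
  the mean of a power is bounded through the mean of \<open>p\<close>.\<close>

lemma power_mean_lower: "(c::real) \<ge> 0 \<Longrightarrow> p \<ge> 0 \<Longrightarrow> c ^ n * (p - c) \<le> p ^ Suc n"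
proof (cases "p \<ge> c")
  case True
  assume "c \<ge> 0" "p \<ge> 0"
  then have "c ^ n * (p - c) \<le> p ^ n * p" using True by (intro mult_mono power_mono) auto
  then show ?thesis by (simp add: mult.commute)
next
  case False
  assume c: "c \<ge> 0" "p \<ge> 0"
  then have "c ^ n * (p - c) \<le> 0" using False by (intro mult_nonneg_nonpos) auto
  also have "0 \<le> p ^ Suc n" using c by simp
  finally show ?thesis .
qed

text \<open>The average of \<open>f\<close> along the \<open>i\<close>-th sequence is close in mean
  to its periodic part \<open>p\<close>. So the product of \<open>f\<close> with all these averages
  has nearly the mean of \<open>p ^ (n + 1)\<close>, and one point where it is positive yields all
  returns at once. \<epsilon> is fixed before \<open>k\<close>, \<open>t\<close> and the sequences,
  which later makes the choice of \<open>k\<close> independent of \<open>F\<close>.\<close>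

theorem polynomial_pattern:
  fixes R :: "nat \<Rightarrow> nat \<Rightarrow> int" and f :: "(nat \<Rightarrow> int) \<Rightarrow> real"
  assumes R: "spanning N R (2 ^ r)" and f: "\<And>x. 0 \<le> f x" "\<And>x. f x \<le> 1" and t0: "t0 > 0"
  shows "\<exists>\<epsilon>>0. \<forall>k t y b a s0 (I :: 'a set). k > 0 \<longrightarrow> t \<ge> t0 \<longrightarrow> reaches N f k t \<longrightarrow>
      (\<forall>j>0. \<not> reaches N f (k * j) (t + \<epsilon>)) \<longrightarrow> finite I \<longrightarrow> card I \<le> m \<longrightarrow>
      (\<forall>i\<in>I. \<forall>s. y i s \<in> lat N) \<longrightarrow> (\<forall>i\<in>I. \<forall>s. b i s \<in> lat N) \<longrightarrow>
      (\<forall>i\<in>I. \<forall>s\<ge>s0 i. a i s \<noteq> 0) \<longrightarrow>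
      (\<exists>z. f z > 0 \<and> (\<forall>i\<in>I. \<exists>s n.
        f (z + sc (int k) (y i s + sc (int n) (b i s) - sc ((int n)\<^sup>2 * a i s) (R s))) > 0))"
proof -
  \<comment> \<open>At most \<open>m\<close> errors of size \<kappa> then stay below the main term
    \<open>c ^ (n + 1)\<close>, where \<open>c = t / 2\<close> is at least
    \<open>min t0 1 / 2\<close> and at most 1.\<close>
  define \<kappa> where "\<kappa> = (min t0 1 / 2) ^ (m + 1) / (m + 1)"
  define \<epsilon> where "\<epsilon> = \<kappa> ^ (4 * 2 ^ r) / 2"
  have \<kappa>: "\<kappa> > 0" using t0 by (simp add: \<kappa>_def)
  then have \<epsilon>: "\<epsilon> > 0" "\<epsilon> < \<kappa> ^ (4 * 2 ^ r)" by (auto simp: \<epsilon>_def)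
  show ?thesis
  proof (intro exI[of _ \<epsilon>] conjI allI impI, rule \<epsilon>(1))
    fix k :: nat and t and y b :: "'a \<Rightarrow> nat \<Rightarrow> nat \<Rightarrow> int" and a :: "'a \<Rightarrow> nat \<Rightarrow> int"
      and s0 :: "'a \<Rightarrow> nat" and I :: "'a set"
    assume k: "k > 0" and t: "t \<ge> t0" and reach: "reaches N f k t"
      and sat': "\<forall>j>0. \<not> reaches N f (k * j) (t + \<epsilon>)"
      and I: "finite I" "card I \<le> m"
      and lat': "\<forall>i\<in>I. \<forall>s. y i s \<in> lat N" "\<forall>i\<in>I. \<forall>s. b i s \<in> lat N"
      and a': "\<forall>i\<in>I. \<forall>s\<ge>s0 i. a i s \<noteq> 0"
    have sat: "\<And>j. j > 0 \<Longrightarrow> \<not> reaches N f (k * j) (t + \<epsilon>)" using sat' by blast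
    have lat: "\<And>i s. i \<in> I \<Longrightarrow> y i s \<in> lat N" "\<And>i s. i \<in> I \<Longrightarrow> b i s \<in> lat N" using lat' by blast+
    have a: "\<And>i s. i \<in> I \<Longrightarrow> s \<ge> s0 i \<Longrightarrow> a i s \<noteq> 0" using a' by blast
    define x where "x i s n = sc (int k) (y i s + sc (int n) (b i s) - sc ((int n)\<^sup>2 * a i s) (R s))" for i s n
    obtain l where l: "invariant_mean N l" "t \<le> l (\<lambda>x. (invariant_mean.coset_density N l k f x)\<^sup>2)"
      using reach by (auto simp: reaches_def)
    interpret invariant_mean N l by (rule l)
    have abs_f: "\<bar>f x\<bar> \<le> 1" for x using f[of x] by simp
    then have bf: "bd f" by (rule bdI)
    define p where "p = coset_density k f"
    have p: "0 \<le> p x" "p x \<le> 1" for x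
      unfolding p_def using coset_density_bounds[of f k x, OF f k] by auto
    then have abs_p: "\<bar>p x\<bar> \<le> 1" for x by (simp add: abs_le_iff order_trans[OF _ p(1)])
    then have bp: "bd p" by (rule bdI)
    have per: "periodic N k p" unfolding p_def by (rule periodic_coset_density)
    have adj: "l (\<lambda>x. f x * \<psi> x) = l (\<lambda>x. p x * \<psi> x)" if "bd \<psi>" "periodic N k \<psi>" for \<psi>
      using coset_density_adjoint[of f k \<psi>, OF f k that] by (simp add: p_def)
    define g where "g x = f x - p x" for x
    have g: "\<bar>g x\<bar> \<le> 1" for x using f[of x] p[of x] by (auto simp: g_def abs_le_iff)
    then have bg: "bd g" by (rule bdI)
    \<comment> \<open>Pythagoras: \<open>p\<close> is the projection of \<open>f\<close> and is
      fixed by averages along multiples of \<open>k\<close>, so the energy of \<open>g\<close> is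
      the energy of \<open>f\<close> minus the squared norm of \<open>p\<close>, at most (t +
      \<epsilon>) - t.\<close>
    have small: "\<exists>H>0. energy (map (\<lambda>i. sc (int (k * j)) (unit i)) [0..<N]) H g \<le> \<epsilon>" if j: "j > 0" for j
    proof -
      define ds where "ds = map (\<lambda>i. sc (int (k * j)) (unit i)) [0..<N]"
      have ds: "ds = map (sc (int (k * j))) (units N)" by (simp add: ds_def)
      have kj: "k * j > 0" using k j by simp
      obtain H0 where H0: "\<And>H x. H \<ge> H0 \<Longrightarrow> avs (units N) (k * j) (\<lambda>y. (avs ds H f y)\<^sup>2) x < t + \<epsilon>"
        using reaches_if_local_energy[of f "k * j" "t + \<epsilon>" N, OF f kj] sat[OF j]
        unfolding ds by (meson not_le)
      define H where "H = max 1 H0"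
      have H: "H > 0" "H \<ge> H0" by (auto simp: H_def)
      have "l (\<lambda>x. (avs ds H f x)\<^sup>2) = l (avs (units N) (k * j) (\<lambda>x. (avs ds H f x)\<^sup>2))"
        using bf kj by (intro mean_avs[symmetric]) auto
      also have "\<dots> \<le> l (\<lambda>x. t + \<epsilon>)"
        using bf H0[OF H(2)] by (intro mean_mono) (auto intro: less_imp_le)
      finally have e1: "l (\<lambda>x. (avs ds H f x)\<^sup>2) \<le> t + \<epsilon>" by (simp add: mean_const)
      have inv: "avs cs H p = p" if cs: "set cs \<subseteq> {sc (int k * u) v | u v. True}" for cs
      proof (rule avs_invariant)
        fix c x n assume "c \<in> set cs"
        then obtain u v where "c = sc (int k * u) v" using cs by blast
        then show "p (x + sc (int n) c) = p x"
          using periodic_shift[OF per, of x "sc (int n * u) v"] by (simp add: mult_ac)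
      qed (rule H)
      have e2: "l (\<lambda>x. avs ds H f x * p x) = l (\<lambda>x. (p x)\<^sup>2)"
      proof -
        have "l (\<lambda>x. avs ds H f x * p x) = l (\<lambda>x. f x * avs (map uminus ds) H p x)"
          using bf bp by (intro mean_avs_adjoint) (auto simp: ds_def)
        also have "avs (map uminus ds) H p = p"
          by (intro inv) (auto simp: ds_def sc_add(5)[symmetric] intro!: exI[of _ "- int j"])
        also have "l (\<lambda>x. f x * p x) = l (\<lambda>x. p x * p x)" using bp per by (rule adj)
        finally show ?thesis by (simp add: power2_eq_square)
      qed
      have "avs ds H p = p" by (intro inv) (auto simp: ds_def)
      then have "energy ds H g = l (\<lambda>x. ((avs ds H f x)\<^sup>2 + (p x)\<^sup>2) - 2 * (avs ds H f x * p x))"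
        unfolding energy_def g_def avs_diff by (simp add: power2_eq_square algebra_simps)
      also have "\<dots> = l (\<lambda>x. (avs ds H f x)\<^sup>2) + l (\<lambda>x. (p x)\<^sup>2) - 2 * l (\<lambda>x. (p x)\<^sup>2)"
        using bf bp by (simp add: mean_diff mean_add mean_cmult e2)
      also have "\<dots> \<le> \<epsilon>" using e1 l(2) by (simp add: p_def)
      finally show ?thesis using H(1) by (auto simp: ds_def)
    qed
    have "\<forall>i\<in>I. \<exists>T u. finite T \<and> T \<noteq> {} \<and> (\<forall>\<tau>\<in>T. \<exists>s n. u \<tau> = x i s n) \<and>
      l (\<lambda>z. ((\<Sum>\<tau>\<in>(T :: (nat \<times> nat \<times> nat) set). g (z + u \<tau>)) / real (card T))\<^sup>2) \<le> \<kappa>\<^sup>2"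
      unfolding x_def
      by (intro ballI polynomial_average_small[OF R g k _ _ _ small \<epsilon>(2) \<kappa>] lat a)
    then obtain T u where T: "\<And>i. i \<in> I \<Longrightarrow> finite (T i) \<and> T i \<noteq> {}"
      "\<And>i \<tau>. i \<in> I \<Longrightarrow> \<tau> \<in> T i \<Longrightarrow> \<exists>s n. u i \<tau> = x i s n"
      "\<And>i. i \<in> I \<Longrightarrow> l (\<lambda>z. ((\<Sum>\<tau>\<in>(T i :: (nat \<times> nat \<times> nat) set). g (z + u i \<tau>)) / real (card (T i)))\<^sup>2) \<le> \<kappa>\<^sup>2"
      by metis
    define A where "A i z = (\<Sum>\<tau>\<in>T i. f (z + u i \<tau>)) / real (card (T i))" for i z
    have A: "0 \<le> A i z" "A i z \<le> 1" for i z
    proof -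
      show "0 \<le> A i z" using f by (auto simp: A_def intro!: divide_nonneg_nonneg sum_nonneg)
      have "(\<Sum>\<tau>\<in>T i. f (z + u i \<tau>)) \<le> (\<Sum>\<tau>\<in>T i. 1)" using f by (intro sum_mono) auto
      then show "A i z \<le> 1" by (auto simp: A_def divide_le_eq_1)
    qed
    have bA: "bd (A i)" for i unfolding A_def[abs_def] using bf by auto
    have close: "l (\<lambda>z. \<bar>A i z - p z\<bar>) \<le> \<kappa>" if i: "i \<in> I" for i
    proof -
      have "(\<Sum>\<tau>\<in>T i. g (z + u i \<tau>)) / real (card (T i)) = A i z - p z" for z
      proof -
        \<comment> \<open>All shifts are multiples of \<open>k\<close>, which do not move
          \<open>p\<close>.\<close>
        have "p (z + u i \<tau>) = p z" if "\<tau> \<in> T i" for \<tau>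
        proof -
          obtain s n where "u i \<tau> = x i s n" using T(2)[OF i \<open>\<tau> \<in> T i\<close>] by blast
          then show ?thesis unfolding x_def by (simp add: periodic_shift[OF per])
        qed
        then show ?thesis using T(1)[OF i]
          by (simp add: g_def A_def sum_subtractf diff_divide_distrib)
      qed
      then have sq: "l (\<lambda>z. (A i z - p z)\<^sup>2) \<le> \<kappa>\<^sup>2" using T(3)[OF i] by simp
      \<comment> \<open>Converts the bound in quadratic mean into one for the mean of the absolute
        value, balanced at |w| = \<kappa>.\<close>
      have "\<bar>w\<bar> \<le> (w\<^sup>2 / \<kappa> + \<kappa>) / 2" for w
      proof -
        have "0 \<le> (\<bar>w\<bar> - \<kappa>)\<^sup>2" by simp
        then have "2 * \<kappa> * \<bar>w\<bar> \<le> w\<^sup>2 + \<kappa>\<^sup>2" by (simp add: power2_diff mult_ac)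
        then show ?thesis using \<kappa> by (simp add: field_simps power2_eq_square)
      qed
      then have "l (\<lambda>z. \<bar>A i z - p z\<bar>) \<le> l (\<lambda>z. ((A i z - p z)\<^sup>2 / \<kappa> + \<kappa>) / 2)"
        using bA bp by (intro mean_mono) auto
      also have "\<dots> = (l (\<lambda>z. (A i z - p z)\<^sup>2) / \<kappa> + \<kappa>) / 2"
        using bA bp by (simp add: mean_divide mean_add mean_const)
      also have "\<dots> \<le> (\<kappa>\<^sup>2 / \<kappa> + \<kappa>) / 2"
        using sq \<kappa> by (intro divide_right_mono add_right_mono) auto
      also have "\<dots> = \<kappa>" using \<kappa> by (simp add: power2_eq_square)
      finally show ?thesis .
    qed
    define n where "n = card I"
    \<comment> \<open>Replacing the factors \<open>A i\<close> by \<open>p\<close> costs one error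
      each. Then only \<open>f\<close> and the periodic function \<open>p ^ n\<close> remain, so
      \<open>f\<close> may be replaced by \<open>p\<close> as well.\<close>
    have main: "l (\<lambda>z. p z ^ Suc n) - real n * \<kappa> \<le> l (\<lambda>z. f z * (\<Prod>i\<in>I. A i z))"
    proof -
      have "f z * p z ^ n \<le> f z * (\<Prod>i\<in>I. A i z) + (\<Sum>i\<in>I. \<bar>A i z - p z\<bar>)" for z
      proof -
        have "norm ((\<Prod>i\<in>I. A i z) - (\<Prod>i\<in>I. p z)) \<le> (\<Sum>i\<in>I. norm (A i z - p z))"
          using A p by (intro norm_prod_diff) auto
        then have "\<bar>(\<Prod>i\<in>I. A i z) - p z ^ n\<bar> \<le> (\<Sum>i\<in>I. \<bar>A i z - p z\<bar>)" by (simp add: n_def)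
        moreover define e where "e = (\<Sum>i\<in>I. \<bar>A i z - p z\<bar>)"
        ultimately have "p z ^ n - (\<Prod>i\<in>I. A i z) \<le> e" by linarith
        then have "f z * (p z ^ n - (\<Prod>i\<in>I. A i z)) \<le> f z * e"
          using f(1) by (rule mult_left_mono)
        also have "\<dots> \<le> e" using f[of z] by (intro mult_left_le_one_le) (auto simp: e_def intro: sum_nonneg)
        finally have "f z * (p z ^ n - (\<Prod>i\<in>I. A i z)) \<le> (\<Sum>i\<in>I. \<bar>A i z - p z\<bar>)" by (simp add: e_def)
        then show ?thesis by (simp add: algebra_simps)
      qed
      then have "l (\<lambda>z. f z * p z ^ n) \<le> l (\<lambda>z. f z * (\<Prod>i\<in>I. A i z) + (\<Sum>i\<in>I. \<bar>A i z - p z\<bar>))"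
        using bf bp bA by (intro mean_mono) auto
      also have "\<dots> = l (\<lambda>z. f z * (\<Prod>i\<in>I. A i z)) + (\<Sum>i\<in>I. l (\<lambda>z. \<bar>A i z - p z\<bar>))"
        using bf bp bA by (subst mean_add) (auto simp: mean_sum)
      also have "(\<Sum>i\<in>I. l (\<lambda>z. \<bar>A i z - p z\<bar>)) \<le> (\<Sum>i\<in>I. \<kappa>)"
        by (intro sum_mono close)
      also have "\<dots> = real n * \<kappa>" by (simp add: n_def)
      also have "l (\<lambda>z. f z * p z ^ n) = l (\<lambda>z. p z * p z ^ n)"
      proof (rule adj)
        show "periodic N k (\<lambda>z. p z ^ n)" using per unfolding periodic_def by metis
      qed (use bp in auto)
      finally show ?thesis by simp
    qed
    \<comment> \<open>With this choice \<open>t - c = c\<close>, so the affine lower bound becomes a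
      pure power of \<open>c\<close>.\<close>
    define c where "c = t / 2"
    have l2: "l (\<lambda>x. (p x)\<^sup>2) \<ge> t" using l(2) by (simp add: p_def)
    have "l (\<lambda>x. (p x)\<^sup>2) \<le> 1" using mean_bound[of "\<lambda>x. (p x)\<^sup>2" 1] abs_p by (auto simp: abs_square_le_1)
    then have c: "c > 0" "c \<le> 1" "c \<ge> min t0 1 / 2" using l2 t t0 by (auto simp: c_def)
    have "t \<le> l p"
    proof -
      have "l (\<lambda>x. (p x)\<^sup>2) \<le> l p" using bp p by (intro mean_mono) (auto simp: power2_eq_square mult_left_le)
      then show ?thesis using l2 by simp
    qed
    have "(min t0 1 / 2) ^ (m + 1) \<le> c ^ (m + 1)" using c t0 by (intro power_mono) auto
    also have "\<dots> \<le> c ^ (n + 1)" using c I by (intro power_decreasing) (auto simp: n_def)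
    also have "\<dots> = c ^ n * (t - c)" by (simp add: c_def)
    also have "\<dots> \<le> c ^ n * (l p - c)" using c \<open>t \<le> l p\<close> by (intro mult_left_mono) auto
    also have "\<dots> = l (\<lambda>z. c ^ n * (p z - c))" using bp by (simp add: mean_cmult mean_diff mean_const)
    also have "\<dots> \<le> l (\<lambda>z. p z ^ Suc n)"
      using bp p c power_mean_lower[of c] by (intro mean_mono) (auto simp del: power_Suc)
    finally have "(min t0 1 / 2) ^ (m + 1) - real n * \<kappa> \<le> l (\<lambda>z. f z * (\<Prod>i\<in>I. A i z))"
      using main by linarith
    moreover have "real n * \<kappa> < (min t0 1 / 2) ^ (m + 1)"
    proof -
      have "real n * \<kappa> < real (m + 1) * \<kappa>" using \<kappa> I by (simp add: n_def)
      also have "\<dots> = (min t0 1 / 2) ^ (m + 1)"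
        unfolding \<kappa>_def times_divide_eq_right by (rule nonzero_mult_div_cancel_left) simp
      finally show ?thesis .
    qed
    ultimately have pos: "l (\<lambda>z. f z * (\<Prod>i\<in>I. A i z)) > 0" by linarith
    have "\<exists>z. f z * (\<Prod>i\<in>I. A i z) > 0"
    proof (rule ccontr)
      assume "\<not> ?thesis"
      then have "l (\<lambda>z. f z * (\<Prod>i\<in>I. A i z)) \<le> l (\<lambda>z. 0)"
        using bf bA by (intro mean_mono) (auto simp: not_less)
      then show False using pos by (simp add: mean_const)
    qed
    then obtain z where z: "f z * (\<Prod>i\<in>I. A i z) > 0" by blast
    have nz: "f z \<noteq> 0" "(\<Prod>i\<in>I. A i z) \<noteq> 0" using z by auto
    have "f z > 0" using nz(1) f(1)[of z] by simp
    moreover have "\<exists>s n. f (z + x i s n) > 0" if i: "i \<in> I" for i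
    proof -
      have "A i z \<noteq> 0" using nz(2) i I by (simp add: prod_zero_iff)
      then have "(\<Sum>\<tau>\<in>T i. f (z + u i \<tau>)) \<noteq> 0" by (auto simp: A_def)
      then obtain \<tau> where "\<tau> \<in> T i" "f (z + u i \<tau>) \<noteq> 0" by (meson sum.neutral)
      moreover obtain s n where "u i \<tau> = x i s n" using T(2)[OF i \<open>\<tau> \<in> T i\<close>] by blast
      ultimately show ?thesis using f(1)[of "z + u i \<tau>"] by (metis less_eq_real_def)
    qed
    ultimately show "\<exists>z. f z > 0 \<and> (\<forall>i\<in>I. \<exists>s n.
        f (z + sc (int k) (y i s + sc (int n) (b i s) - sc ((int n)\<^sup>2 * a i s) (R s))) > 0)"
      unfolding x_def by blast
  qed
qed

section \<open>A curve of square-zero matrices\<close>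

text \<open>For indices below \<open>d\<close> a nonzero exponent lies strictly between
  \<open>d\<close> and \<open>2 * d\<close>. A sum of two of them exceeds \<open>2 * d\<close> and
  cannot be confused with a single one.\<close>

definition v_exp :: "nat \<Rightarrow> nat \<Rightarrow> nat" where
  "v_exp d i = (if i = 0 then 0 else d + i)"

text \<open>One block of length \<open>5 * d\<close> for each column \<open>j \<ge> 1\<close>. The
  part coming from \<open>v_exp\<close> stays below \<open>4 * d\<close>, so quotient and remainder
  modulo \<open>5 * d\<close> recover the column and that part.\<close>

definition w_exp :: "nat \<Rightarrow> nat \<Rightarrow> nat" where
  "w_exp d j = 5 * d * (j - 1)"

definition v_curve :: "nat \<Rightarrow> nat \<Rightarrow> nat \<Rightarrow> int" where
  "v_curve d s i = int s ^ v_exp d i"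

text \<open>Since \<open>v_curve d s 0 = 1\<close>, orthogonality to \<open>v\<close> dictates the
  entry at 0.\<close>

definition w_curve :: "nat \<Rightarrow> nat \<Rightarrow> nat \<Rightarrow> int" where
  "w_curve d s j = (if j = 0 then - (\<Sum>i\<in>{1..<d}. int s ^ (v_exp d i + w_exp d i)) else int s ^ w_exp d j)"

lemma w_v_orthogonal: assumes "d \<ge> 2" shows "(\<Sum>i<d. w_curve d s i * v_curve d s i) = 0"
proof -
  have "{..<d} = insert 0 {1..<d}" using assms by auto
  then have "(\<Sum>i<d. w_curve d s i * v_curve d s i) =
      w_curve d s 0 * v_curve d s 0 + (\<Sum>i\<in>{1..<d}. w_curve d s i * v_curve d s i)" by simp
  also have "(\<Sum>i\<in>{1..<d}. w_curve d s i * v_curve d s i) = (\<Sum>i\<in>{1..<d}. int s ^ (v_exp d i + w_exp d i))"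
    by (intro sum.cong) (auto simp: w_curve_def v_curve_def power_add)
  finally show ?thesis by (simp add: w_curve_def v_curve_def v_exp_def)
qed

text \<open>Lagrange interpolation over the integers: the values on \<open>S\<close> determine a
  polynomial of degree below \<open>card S\<close>, and \<open>q\<close> clears the denominators of
  the basis polynomials.\<close>

lemma coefficient_extraction:
  fixes S :: "nat set"
  assumes S: "finite S"
  obtains q :: int and c :: "nat \<Rightarrow> nat \<Rightarrow> int" where "q > 0"
    "\<And>e e'. e' < card S \<Longrightarrow> (\<Sum>s\<in>S. c e s * int s ^ e') = (if e = e' then q else 0)"
proof -
  define L where "L s = (\<Prod>t\<in>S - {s}. [:- int t, 1:])" for s
  have poly_L: "poly (L s) (int x) = (\<Prod>t\<in>S - {s}. int x - int t)" for s x
    by (simp add: L_def poly_prod)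
  have deg_L: "degree (L s) < card S" if "s \<in> S" for s
  proof -
    have "degree (L s) \<le> (\<Sum>t\<in>S - {s}. degree [:- int t, 1:])"
      unfolding L_def using S by (intro degree_prod_sum_le[unfolded comp_def]) auto
    also have "\<dots> = card (S - {s})" by simp
    also have "\<dots> < card S" using S that by (intro psubset_card_mono) auto
    finally show ?thesis .
  qed
  define D where "D s = poly (L s) (int s)" for s
  have D0: "D s \<noteq> 0" for s unfolding D_def poly_L using S by simp
  define q where "q = (\<Prod>s\<in>S. \<bar>D s\<bar>)"
  have q: "q > 0" unfolding q_def using D0 by (intro prod_pos) auto
  have "D s dvd q" if "s \<in> S" for s
    using dvd_prodI[OF S that, of "\<lambda>s. \<bar>D s\<bar>"] by (simp add: q_def)
  then have "\<forall>s\<in>S. \<exists>k. q = D s * k" by (auto simp: dvd_def)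
  then obtain k where k: "\<And>s. s \<in> S \<Longrightarrow> q = D s * k s" by metis
  have "(\<Sum>s\<in>S. Polynomial.coeff (L s) e * k s * int s ^ e') = (if e = e' then q else 0)" if e': "e' < card S" for e e'
  proof -
    \<comment> \<open>The interpolant of the monomial of degree \<open>e'\<close> minus that
      monomial, scaled by \<open>q\<close>; it has more roots than its degree permits unless it is
      0.\<close>
    define P where "P = (\<Sum>s\<in>S. Polynomial.smult (k s * int s ^ e') (L s)) - Polynomial.monom q e'"
    have "poly P (int t) = 0" if t: "t \<in> S" for t
    proof -
      have "poly (L s) (int t) = 0" if "s \<in> S - {t}" for s
        unfolding poly_L using S t that by (subst prod_zero_iff) auto
      then have "(\<Sum>s\<in>S. k s * int s ^ e' * poly (L s) (int t)) = k t * int t ^ e' * D t"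
        using S t by (subst sum.remove[of _ t]) (auto simp: D_def)
      then show ?thesis using k[OF t] by (simp add: P_def poly_sum poly_monom)
    qed
    then have roots: "int ` S \<subseteq> {x. poly P x = 0}" by auto
    have "P = 0"
    proof (rule ccontr)
      assume P: "P \<noteq> 0"
      have "card S = card (int ` S)" by (simp add: card_image)
      also have "\<dots> \<le> card {x. poly P x = 0}" using P roots by (intro card_mono poly_roots_finite)
      also have "\<dots> \<le> degree P" using P by (rule poly_roots_degree)
      finally have "card S \<le> degree P" .
      moreover have "degree P < card S"
      proof -
        have "degree (Polynomial.smult (k s * int s ^ e') (L s)) \<le> card S - 1" if "s \<in> S" for s
          using Polynomial.degree_smult_le[of "k s * int s ^ e'" "L s"] deg_L[OF that] by linarith
        then have "degree (\<Sum>s\<in>S. Polynomial.smult (k s * int s ^ e') (L s)) \<le> card S - 1"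
          using S by (intro degree_sum_le) auto
        moreover have "degree (Polynomial.monom q e') \<le> card S - 1" using e' degree_monom_le[of q e'] by linarith
        ultimately have "degree P \<le> card S - 1" unfolding P_def by (intro degree_diff_le)
        then show ?thesis using e' by linarith
      qed
      ultimately show False by simp
    qed
    then have "(\<Sum>s\<in>S. Polynomial.smult (k s * int s ^ e') (L s)) = Polynomial.monom q e'" by (simp add: P_def)
    then have "Polynomial.coeff (\<Sum>s\<in>S. Polynomial.smult (k s * int s ^ e') (L s)) e = Polynomial.coeff (Polynomial.monom q e') e" by simp
    then have "(\<Sum>s\<in>S. k s * int s ^ e' * Polynomial.coeff (L s) e) = (if e = e' then q else 0)"
      by (auto simp: coeff_sum)
    moreover have "(\<Sum>s\<in>S. Polynomial.coeff (L s) e * k s * int s ^ e') = (\<Sum>s\<in>S. k s * int s ^ e' * Polynomial.coeff (L s) e)"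
      by (intro sum.cong) (auto simp: mult_ac)
    ultimately show ?thesis by simp
  qed
  then show thesis using that[of q "\<lambda>e s. Polynomial.coeff (L s) e * k s"] q by blast
qed

text \<open>The exponents \<open>v_exp d i + w_exp d j\<close> and \<open>v_exp d i + v_exp d j + w_exp d j\<close> with
  \<open>i, j \<ge> 1\<close> are pairwise distinct, so a trace zero matrix determines a functional on
  polynomials in \<open>s\<close> that recovers its entries from the curve.\<close>

lemma coefficient_functional:
  fixes A :: "nat \<Rightarrow> nat \<Rightarrow> int"
  assumes d: "d \<ge> 2" and A: "(\<Sum>i<d. A i i) = 0"
  obtains \<kappa> :: "nat \<Rightarrow> int" where
    "\<And>i j. i < d \<Longrightarrow> 1 \<le> j \<Longrightarrow> j < d \<Longrightarrow> \<kappa> (v_exp d i + w_exp d j) = A i j"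
    "\<And>i. i < d \<Longrightarrow> (\<Sum>j\<in>{1..<d}. \<kappa> (v_exp d i + v_exp d j + w_exp d j)) = - A i 0"
proof -
  \<comment> \<open>Decodes an exponent. In column 0 only the sum over \<open>j\<close> is
    prescribed, so for \<open>i \<ge> 1\<close> the whole value is put on \<open>j = 1\<close>. For
    \<open>i = 0\<close> the exponents are those of the diagonal entries, and trace zero yields the
    required sum.\<close>
  define \<kappa> where "\<kappa> e = (let j = e div (5 * d) + 1; a = e mod (5 * d) in
    if a = 0 then A 0 j else if a < 2 * d then A (a - d) j
    else if j = 1 then - A (a - d - (d + 1)) 0 else 0)" for e
  have dec: "(a + w_exp d j) div (5 * d) + 1 = j" "(a + w_exp d j) mod (5 * d) = a"
    if "a < 5 * d" "1 \<le> j" for a j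
  proof -
    have "(a + 5 * d * (j - 1)) div (5 * d) = j - 1" using that d by (subst div_mult_self2) auto
    then show "(a + w_exp d j) div (5 * d) + 1 = j" using that unfolding w_exp_def by simp
    show "(a + w_exp d j) mod (5 * d) = a" using that unfolding w_exp_def by simp
  qed
  have one: "\<kappa> (v_exp d i + w_exp d j) = A i j" if "i < d" "1 \<le> j" for i j
  proof -
    have "v_exp d i < 5 * d" using that by (simp add: v_exp_def)
    then show ?thesis using that d unfolding \<kappa>_def Let_def dec[OF \<open>v_exp d i < 5 * d\<close> that(2)]
      by (auto simp: v_exp_def)
  qed
  have two: "\<kappa> (v_exp d i + v_exp d j + w_exp d j) = (if j = 1 then - A i 0 else 0)"
    if "1 \<le> i" "i < d" "1 \<le> j" "j < d" for i j
  proof -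
    have lt: "v_exp d i + v_exp d j < 5 * d" using that by (simp add: v_exp_def)
    show ?thesis using that d unfolding \<kappa>_def Let_def dec[OF lt that(3)]
      by (auto simp: v_exp_def)
  qed
  have "(\<Sum>j\<in>{1..<d}. \<kappa> (v_exp d i + v_exp d j + w_exp d j)) = - A i 0" if i: "i < d" for i
  proof (cases "i = 0")
    case True
    have "{..<d} = insert 0 {1..<d}" using d by auto
    then have "A 0 0 + (\<Sum>j\<in>{1..<d}. A j j) = 0" using A by simp
    moreover have "(\<Sum>j\<in>{1..<d}. \<kappa> (v_exp d i + v_exp d j + w_exp d j)) = (\<Sum>j\<in>{1..<d}. A j j)"
      using True one by (intro sum.cong) (auto simp: v_exp_def[of d 0])
    ultimately show ?thesis using True by simp
  next
    case False
    then have "(\<Sum>j\<in>{1..<d}. \<kappa> (v_exp d i + v_exp d j + w_exp d j)) = (\<Sum>j\<in>{1..<d}. if j = 1 then - A i 0 else 0)"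
      using i by (intro sum.cong two) auto
    then show ?thesis using d by (simp add: sum.delta)
  qed
  then show thesis using that[of \<kappa>] one by blast
qed

lemma exponent_bound:
  assumes "i < d" "j < d" "1 \<le> j"
  shows "v_exp d i + w_exp d j < 5 * d * d" "v_exp d i + v_exp d j + w_exp d j < 5 * d * d"
proof -
  have "5 * d * (j - 1) + 5 * d = 5 * d * j" using assms(3) by (cases j) auto
  also have "5 * d * j + 5 * d \<le> 5 * d * d"
    using mult_le_mono2[of "Suc j" d "5 * d"] assms(2) by simp
  finally have w: "w_exp d j + 5 * d + 5 * d \<le> 5 * d * d" by (simp add: w_exp_def)
  have v: "v_exp d i < 2 * d" "v_exp d j < 2 * d" using assms by (auto simp: v_exp_def)
  show "v_exp d i + w_exp d j < 5 * d * d" "v_exp d i + v_exp d j + w_exp d j < 5 * d * d"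
    using v w by linarith+
qed

text \<open>Entries of the curve are monomials in \<open>s\<close> or, in column 0, negated sums of
  monomials, all of degree below \<open>5 * d * d\<close>. Extracting coefficients and weighting
  them by the functional of \<open>A\<close> produces \<open>A\<close> up to the factor
  \<open>q\<close>, which depends on \<open>S\<close> only.\<close>

lemma curve_spans:
  assumes d: "d \<ge> 2" and S: "finite S" "card S \<ge> 5 * d * d"
  shows "\<exists>q>0. \<forall>A. (\<Sum>i<d. A i i) = (0::int) \<longrightarrow>
    (\<exists>z. \<forall>i<d. \<forall>j<d. (\<Sum>s\<in>S. z s * (v_curve d s i * w_curve d s j)) = q * A i j)"
proof -
  obtain q :: int and c where q: "q > 0"
    and c: "\<And>e e'. e' < card S \<Longrightarrow> (\<Sum>s\<in>S. c e s * int s ^ e') = (if e = e' then q else 0)"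
    using coefficient_extraction[OF S(1)] by metis
  have "\<exists>z. \<forall>i<d. \<forall>j<d. (\<Sum>s\<in>S. z s * (v_curve d s i * w_curve d s j)) = q * A i j"
    if A: "(\<Sum>i<d. A i i) = (0::int)" for A
  proof -
    obtain \<kappa> where \<kappa>: "\<And>i j. i < d \<Longrightarrow> 1 \<le> j \<Longrightarrow> j < d \<Longrightarrow> \<kappa> (v_exp d i + w_exp d j) = A i j"
      "\<And>i. i < d \<Longrightarrow> (\<Sum>j\<in>{1..<d}. \<kappa> (v_exp d i + v_exp d j + w_exp d j)) = - A i 0"
      using coefficient_functional[of d A, OF d A] by metis
    define z where "z s = (\<Sum>e<card S. \<kappa> e * c e s)" for s
    have z: "(\<Sum>s\<in>S. z s * int s ^ e') = q * \<kappa> e'" if "e' < 5 * d * d" for e'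
    proof -
      have e': "e' < card S" using that S by linarith
      have "(\<Sum>s\<in>S. z s * int s ^ e') = (\<Sum>e<card S. \<kappa> e * (\<Sum>s\<in>S. c e s * int s ^ e'))"
        unfolding z_def sum_distrib_right sum_distrib_left by (subst sum.swap) (simp add: mult_ac)
      also have "\<dots> = (\<Sum>e<card S. if e = e' then \<kappa> e * q else 0)"
        using c[OF e'] by (intro sum.cong) auto
      also have "\<dots> = q * \<kappa> e'" using e' by simp
      finally show ?thesis .
    qed
    have "(\<Sum>s\<in>S. z s * (v_curve d s i * w_curve d s j)) = q * A i j" if ij: "i < d" "j < d" for i j
    proof (cases "j = 0")
      case False
      have "(\<Sum>s\<in>S. z s * (v_curve d s i * w_curve d s j)) = (\<Sum>s\<in>S. z s * int s ^ (v_exp d i + w_exp d j))"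
        using False by (simp add: v_curve_def w_curve_def power_add)
      also have "\<dots> = q * A i j"
        using z[OF exponent_bound(1)[of i d j]] \<kappa>(1)[of i j] ij False by simp
      finally show ?thesis .
    next
      case True
      have "(\<Sum>s\<in>S. z s * (v_curve d s i * w_curve d s j)) =
          - (\<Sum>j\<in>{1..<d}. \<Sum>s\<in>S. z s * int s ^ (v_exp d i + v_exp d j + w_exp d j))"
        by (subst sum.swap) (simp add: True v_curve_def w_curve_def power_add sum_distrib_left sum_negf mult_ac)
      also have "\<dots> = - (\<Sum>j\<in>{1..<d}. q * \<kappa> (v_exp d i + v_exp d j + w_exp d j))"
        using ij by (intro arg_cong[of _ _ uminus] sum.cong z exponent_bound(2)) auto
      also have "\<dots> = q * A i j"
        using \<kappa>(2)[OF ij(1)] True by (simp add: sum_distrib_left[symmetric])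
      finally show ?thesis .
    qed
    then show ?thesis by blast
  qed
  then show ?thesis using q by blast
qed

section \<open>The rank-one matrices of the curve and conjugation by them\<close>

definition curve_mat :: "nat \<Rightarrow> nat \<Rightarrow> int mat" where
  "curve_mat d s = Matrix.mat d d (\<lambda>(i, j). v_curve d s i * w_curve d s j)"

definition curve_form :: "nat \<Rightarrow> int mat \<Rightarrow> nat \<Rightarrow> int" where
  "curve_form d f s = (\<Sum>i<d. \<Sum>j<d. w_curve d s i * f $$ (i, j) * v_curve d s j)"

lemma curve_mat_carrier [simp]: "curve_mat d s \<in> carrier_mat d d"
  by (simp add: curve_mat_def)

lemma curve_mat_trace0: "d \<ge> 2 \<Longrightarrow> curve_mat d s \<in> trace0_mats d"
  using w_v_orthogonal[of d s] by (simp add: trace0_mats_def curve_mat_def mult.commute)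

lemma curve_mat_square: "d \<ge> 2 \<Longrightarrow> curve_mat d s * curve_mat d s = 0\<^sub>m d d"
proof (rule eq_matI)
  fix i j assume d: "d \<ge> 2" and ij: "i < dim_row (0\<^sub>m d d :: int mat)" "j < dim_col (0\<^sub>m d d :: int mat)"
  have "(curve_mat d s * curve_mat d s) $$ (i, j) =
      (\<Sum>a<d. v_curve d s i * w_curve d s a * (v_curve d s a * w_curve d s j))"
    using ij by (simp add: curve_mat_def scalar_prod_def atLeast0LessThan)
  also have "\<dots> = v_curve d s i * w_curve d s j * (\<Sum>a<d. w_curve d s a * v_curve d s a)"
    by (simp add: sum_distrib_left mult_ac)
  finally show "(curve_mat d s * curve_mat d s) $$ (i, j) = 0\<^sub>m d d $$ (i, j)"
    using ij w_v_orthogonal[OF d] by simp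
qed (auto simp: curve_mat_def)

lemma curve_mat_sandwich:
  assumes "f \<in> carrier_mat d d"
  shows "curve_mat d s * f * curve_mat d s = curve_form d f s \<cdot>\<^sub>m curve_mat d s"
proof (rule eq_matI)
  fix i j assume ij: "i < dim_row (curve_form d f s \<cdot>\<^sub>m curve_mat d s)" "j < dim_col (curve_form d f s \<cdot>\<^sub>m curve_mat d s)"
  then have ij: "i < d" "j < d" by (auto simp: curve_mat_def)
  have "(curve_mat d s * f * curve_mat d s) $$ (i, j) =
      (\<Sum>b<d. (\<Sum>a<d. v_curve d s i * w_curve d s a * f $$ (a, b)) * (v_curve d s b * w_curve d s j))"
    using ij assms by (simp add: curve_mat_def scalar_prod_def atLeast0LessThan)
  also have "\<dots> = (\<Sum>b<d. \<Sum>a<d. w_curve d s a * f $$ (a, b) * v_curve d s b) * (v_curve d s i * w_curve d s j)"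
    by (simp add: sum_distrib_left sum_distrib_right mult_ac)
  also have "(\<Sum>b<d. \<Sum>a<d. w_curve d s a * f $$ (a, b) * v_curve d s b) = curve_form d f s"
    unfolding curve_form_def by (rule sum.swap)
  finally show "(curve_mat d s * f * curve_mat d s) $$ (i, j) = (curve_form d f s \<cdot>\<^sub>m curve_mat d s) $$ (i, j)"
    using ij by (simp add: curve_mat_def)
qed (use assms in \<open>auto simp: curve_mat_def\<close>)

text \<open>\<open>curve_form d f s\<close> is the trace pairing of \<open>f\<close> with the curve
  matrix. If it vanished at \<open>5 * d * d\<close> points, it would vanish on their span, which
  contains a multiple of the transpose of \<open>f\<close>; but that pairing is a multiple of the
  sum of the squared entries.\<close>

lemma curve_form_nonzero:
  assumes d: "d \<ge> 2" and f: "f \<in> trace0_mats d" "f \<noteq> 0\<^sub>m d d"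
  obtains s0 where "\<And>s. s \<ge> s0 \<Longrightarrow> curve_form d f s \<noteq> 0"
proof -
  have fc: "f \<in> carrier_mat d d" "(\<Sum>i<d. f $$ (i, i)) = 0" using f by (auto simp: trace0_mats_def)
  have "finite {s. curve_form d f s = 0}"
  proof (rule ccontr)
    assume "infinite {s. curve_form d f s = 0}"
    then obtain S where S: "S \<subseteq> {s. curve_form d f s = 0}" "finite S" "card S = 5 * d * d"
      by (meson infinite_arbitrarily_large)
    have le: "card S \<ge> 5 * d * d" using S(3) by simp
    obtain q :: int where q: "q > 0"
      "\<forall>A. (\<Sum>i<d. A i i) = (0::int) \<longrightarrow>
        (\<exists>z. \<forall>i<d. \<forall>j<d. (\<Sum>s\<in>S. z s * (v_curve d s i * w_curve d s j)) = q * A i j)"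
      using curve_spans[OF d S(2) le] by blast
    obtain z where z: "\<And>i j. i < d \<Longrightarrow> j < d \<Longrightarrow> (\<Sum>s\<in>S. z s * (v_curve d s i * w_curve d s j)) = q * f $$ (j, i)"
      using q(2)[THEN spec, of "\<lambda>i j. f $$ (j, i)"] fc by auto
    have "q * (\<Sum>i<d. \<Sum>j<d. (f $$ (i, j))\<^sup>2) = (\<Sum>i<d. \<Sum>j<d. f $$ (i, j) * (\<Sum>s\<in>S. z s * (v_curve d s j * w_curve d s i)))"
      using z by (simp add: sum_distrib_left power2_eq_square mult_ac)
    also have "\<dots> = (\<Sum>s\<in>S. z s * curve_form d f s)"
    proof -
      have "(\<Sum>i<d. \<Sum>j<d. f $$ (i, j) * (\<Sum>s\<in>S. z s * (v_curve d s j * w_curve d s i))) =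
          (\<Sum>i<d. \<Sum>j<d. \<Sum>s\<in>S. z s * (w_curve d s i * f $$ (i, j) * v_curve d s j))"
        by (simp add: sum_distrib_left mult_ac)
      also have "\<dots> = (\<Sum>i<d. \<Sum>s\<in>S. \<Sum>j<d. z s * (w_curve d s i * f $$ (i, j) * v_curve d s j))"
        by (intro sum.cong refl sum.swap)
      also have "\<dots> = (\<Sum>s\<in>S. \<Sum>i<d. \<Sum>j<d. z s * (w_curve d s i * f $$ (i, j) * v_curve d s j))"
        by (rule sum.swap)
      finally show ?thesis by (simp add: curve_form_def sum_distrib_left)
    qed
    also have "\<dots> = 0" using S(1) by (intro sum.neutral) auto
    finally have "(\<Sum>i<d. \<Sum>j<d. (f $$ (i, j))\<^sup>2) = 0" using q(1) by simp
    then have "\<forall>i<d. \<forall>j<d. f $$ (i, j) = 0"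
      by (simp add: sum_nonneg_eq_0_iff sum_nonneg)
    then have "f = 0\<^sub>m d d" using fc by (intro eq_matI) auto
    then show False using f(2) by simp
  qed
  then obtain s0 where s0: "\<forall>s\<in>{s. curve_form d f s = 0}. s < s0"
    unfolding finite_nat_set_iff_bounded ..
  have "curve_form d f s \<noteq> 0" if "s \<ge> s0" for s
    using s0 that by (auto simp: not_less[symmetric])
  then show thesis by (rule that)
qed

lemma char_poly_curve:
  assumes d: "d \<ge> 2" and f: "f \<in> carrier_mat d d"
  shows "char_poly (k \<cdot>\<^sub>m (f + n \<cdot>\<^sub>m (curve_mat d s * f - f * curve_mat d s)
      - (n\<^sup>2 * curve_form d f s) \<cdot>\<^sub>m curve_mat d s)) = char_poly (k \<cdot>\<^sub>m f)"
proof -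
  define R where "R = curve_mat d s"
  have R: "R \<in> carrier_mat d d" "R * R = 0\<^sub>m d d" "R * f * R = curve_form d f s \<cdot>\<^sub>m R"
    using curve_mat_square[OF d] curve_mat_sandwich[OF f] by (auto simp: R_def)
  define M where "M = n \<cdot>\<^sub>m R"
  have M: "M \<in> carrier_mat d d" using R by (simp add: M_def)
  have MM: "M * M = 0\<^sub>m d d"
    using R by (simp add: M_def mult_smult_assoc_mat[of _ d d _ d] mult_smult_distrib[of _ d d _ d])
  define P where "P = 1\<^sub>m d + M"
  define Q where "Q = 1\<^sub>m d - M"
  have PQ: "P \<in> carrier_mat d d" "Q \<in> carrier_mat d d" using M by (auto simp: P_def Q_def)
  have "P * Q = 1\<^sub>m d * (1\<^sub>m d - M) + M * (1\<^sub>m d - M)"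
    unfolding P_def Q_def using M by (intro add_mult_distrib_mat[of _ d d _ _ d]) auto
  also have "M * (1\<^sub>m d - M) = M - M * M"
    using M by (simp add: mult_minus_distrib_mat[of _ d d _ d])
  finally have one: "P * Q = 1\<^sub>m d" using M MM by (auto intro!: eq_matI)
  have "Q * P = (1\<^sub>m d - M) * 1\<^sub>m d + (1\<^sub>m d - M) * M"
    unfolding P_def Q_def using M by (intro mult_add_distrib_mat[of _ d d _ d]) auto
  also have "(1\<^sub>m d - M) * M = M - M * M"
    using M by (simp add: minus_mult_distrib_mat[of _ d d _ _ d])
  finally have two: "Q * P = 1\<^sub>m d" using M MM by (auto intro!: eq_matI)
  have "P * f * Q = (f + M * f) * (1\<^sub>m d - M)"
    using M f by (simp add: P_def Q_def add_mult_distrib_mat[of _ d d _ _ d])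
  also have "\<dots> = (f + M * f) - (f + M * f) * M"
    using M f by (simp add: mult_minus_distrib_mat[of _ d d _ d])
  also have "(f + M * f) * M = f * M + M * f * M"
    using M f by (intro add_mult_distrib_mat[of _ d d _ _ d]) auto
  also have "f * M = n \<cdot>\<^sub>m (f * R)" unfolding M_def using R f by (intro mult_smult_distrib) auto
  also have Mf: "M * f = n \<cdot>\<^sub>m (R * f)" unfolding M_def using R f by (intro mult_smult_assoc_mat) auto
  also have "n \<cdot>\<^sub>m (R * f) * M = (n\<^sup>2 * curve_form d f s) \<cdot>\<^sub>m R"
  proof -
    have "n \<cdot>\<^sub>m (R * f) * M = n \<cdot>\<^sub>m (R * f * (n \<cdot>\<^sub>m R))"
      unfolding M_def using R f by (intro mult_smult_assoc_mat) auto
    also have "R * f * (n \<cdot>\<^sub>m R) = n \<cdot>\<^sub>m (R * f * R)"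
      using R f by (intro mult_smult_distrib) auto
    finally show ?thesis using R by (auto intro!: eq_matI simp: power2_eq_square)
  qed
  finally have PfQ: "P * f * Q = f + n \<cdot>\<^sub>m (R * f - f * R) - (n\<^sup>2 * curve_form d f s) \<cdot>\<^sub>m R"
    using R f by (auto intro!: eq_matI simp: algebra_simps)
  \<comment> \<open>Dilation commutes with conjugation, so the whole sequence may be moved into
    \<open>k \<int>^N\<close>.\<close>
  have "k \<cdot>\<^sub>m (P * f * Q) = P * (k \<cdot>\<^sub>m f) * Q"
    using PQ f by (simp add: mult_smult_assoc_mat[of _ d d _ d] mult_smult_distrib[of _ d d _ d])
  then have "similar_mat (k \<cdot>\<^sub>m (P * f * Q)) (k \<cdot>\<^sub>m f)"
    using PQ f one two by (intro similar_matI[of _ _ P Q d]) auto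
  then show ?thesis using char_poly_similar unfolding PfQ R_def by blast
qed

section \<open>Traceless matrices in coordinates\<close>

lemma trace_commute:
  fixes A B :: "int mat"
  assumes "A \<in> carrier_mat d d" "B \<in> carrier_mat d d"
  shows "(\<Sum>i<d. (A * B) $$ (i, i)) = (\<Sum>i<d. (B * A) $$ (i, i))"
proof -
  have "(\<Sum>i<d. (A * B) $$ (i, i)) = (\<Sum>i<d. \<Sum>j<d. A $$ (i, j) * B $$ (j, i))"
    using assms by (intro sum.cong) (auto simp: scalar_prod_def atLeast0LessThan)
  also have "\<dots> = (\<Sum>j<d. \<Sum>i<d. B $$ (j, i) * A $$ (i, j))"
    by (subst sum.swap) (simp add: mult.commute)
  also have "\<dots> = (\<Sum>j<d. (B * A) $$ (j, j))"
    using assms by (intro sum.cong) (auto simp: scalar_prod_def atLeast0LessThan)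
  finally show ?thesis .
qed

locale traceless_basis =
  fixes d :: nat and bs :: "int mat list"
  assumes d: "d \<ge> 2" and basis: "trace0_basis d bs"
begin

abbreviation N :: nat where
  "N \<equiv> d\<^sup>2 - 1"

text \<open>\<open>Matrix.vec N\<close> cuts off the later coordinates, so this is additive on all
  of \<open>nat \<Rightarrow> int\<close>; it is injective on \<open>lat N\<close>.\<close>

definition mat_at :: "(nat \<Rightarrow> int) \<Rightarrow> int mat" where
  "mat_at w = mat_of_coords d bs (Matrix.vec N w)"

lemma length_bs: "length bs = N"
  using basis by (simp add: trace0_basis_def)

lemma mat_at_carrier [simp]: "mat_at w \<in> carrier_mat d d"
  by (simp add: mat_at_def mat_of_coords_def)

lemma mat_at_index: "r < d \<Longrightarrow> c < d \<Longrightarrow> mat_at w $$ (r, c) = (\<Sum>i<N. w i * (bs ! i) $$ (r, c))"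
  by (simp add: mat_at_def mat_of_coords_def length_bs)

lemma mat_at_trace0: "mat_at w \<in> trace0_mats d"
proof -
  have "mat_of_coords d bs ` carrier_vec N = trace0_mats d"
    using basis by (simp add: trace0_basis_def bij_betw_def)
  moreover have "Matrix.vec N w \<in> carrier_vec N" by simp
  ultimately show ?thesis unfolding mat_at_def using imageI[of "Matrix.vec N w"] by metis
qed

lemma mat_at_add: "mat_at (v + w) = mat_at v + mat_at w"
proof (rule eq_matI)
  fix i j assume "i < dim_row (mat_at v + mat_at w)" "j < dim_col (mat_at v + mat_at w)"
  then have "i < d" "j < d" using mat_at_carrier[of w] by auto
  then show "mat_at (v + w) $$ (i, j) = (mat_at v + mat_at w) $$ (i, j)"
    using carrier_matD[OF mat_at_carrier[of w]]
    by (simp add: mat_at_index fun_apply distrib_right sum.distrib)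
qed (use carrier_matD[OF mat_at_carrier] in auto)

lemma mat_at_sc: "mat_at (sc c w) = c \<cdot>\<^sub>m mat_at w"
proof (rule eq_matI)
  fix i j assume "i < dim_row (c \<cdot>\<^sub>m mat_at w)" "j < dim_col (c \<cdot>\<^sub>m mat_at w)"
  then have "i < d" "j < d" using mat_at_carrier[of w] by auto
  then show "mat_at (sc c w) $$ (i, j) = (c \<cdot>\<^sub>m mat_at w) $$ (i, j)"
    using carrier_matD[OF mat_at_carrier[of w]]
    by (simp add: mat_at_index sc_def sum_distrib_left mult.assoc)
qed (use carrier_matD[OF mat_at_carrier] in auto)

lemma mat_at_diff: "mat_at (v - w) = mat_at v - mat_at w"
proof -
  have "mat_at (v - w) + mat_at w = mat_at v" using mat_at_add[of "v - w" w] by simp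
  then have "mat_at v - mat_at w = (mat_at (v - w) + mat_at w) - mat_at w" by simp
  also have "\<dots> = mat_at (v - w)"
    using carrier_matD[OF mat_at_carrier] by (intro eq_matI) auto
  finally show ?thesis ..
qed

lemma mat_at_zero: "mat_at 0 = 0\<^sub>m d d"
proof -
  have "mat_at 0 = 0 \<cdot>\<^sub>m mat_at 0" using mat_at_sc[of 0 0] by simp
  also have "\<dots> = 0\<^sub>m d d" using carrier_matD[OF mat_at_carrier[of 0]] by (intro eq_matI) auto
  finally show ?thesis .
qed

lemma mat_at_inj: assumes "mat_at v = mat_at w" "v \<in> lat N" "w \<in> lat N" shows "v = w"
proof -
  have "inj_on (mat_of_coords d bs) (carrier_vec N)"
    using basis by (simp add: trace0_basis_def bij_betw_def)
  then have "Matrix.vec N v = Matrix.vec N w"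
    by (rule inj_onD) (use assms(1) in \<open>simp_all add: mat_at_def\<close>)
  then have *: "v i = w i" if "i < N" for i using that by (metis index_vec)
  show ?thesis
  proof
    fix i
    show "v i = w i" using *[of i] assms(2,3) by (cases "i < N") (auto simp: lat_def)
  qed
qed

definition coords_of :: "int mat \<Rightarrow> nat \<Rightarrow> int" where
  "coords_of A = (SOME w. w \<in> lat N \<and> mat_at w = A)"

lemma coords_of: assumes "A \<in> trace0_mats d" shows "coords_of A \<in> lat N" "mat_at (coords_of A) = A"
proof -
  have "A \<in> mat_of_coords d bs ` carrier_vec N"
    using basis assms by (simp add: trace0_basis_def bij_betw_def)
  then obtain v where v: "v \<in> carrier_vec N" "A = mat_of_coords d bs v" by blast
  define w where "w i = (if i < N then v $ i else 0)" for i
  have "Matrix.vec N w = v" using v(1) by (intro eq_vecI) (auto simp: w_def)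
  then have "w \<in> lat N \<and> mat_at w = A" using v by (auto simp: lat_def w_def mat_at_def)
  then have "coords_of A \<in> lat N \<and> mat_at (coords_of A) = A"
    unfolding coords_of_def by (rule someI[of "\<lambda>w. w \<in> lat N \<and> mat_at w = A" w])
  then show "coords_of A \<in> lat N" "mat_at (coords_of A) = A" by auto
qed

lemma spanning_curve: assumes "m \<ge> 5 * d * d" shows "spanning N (\<lambda>s. coords_of (curve_mat d s)) m"
  unfolding spanning_def
proof (intro conjI allI impI)
  fix s show "coords_of (curve_mat d s) \<in> lat N" using curve_mat_trace0[OF d] by (rule coords_of)
next
  fix S :: "nat set" assume S: "finite S \<and> card S = m"
  then obtain q :: int where q: "q > 0" "\<forall>A. (\<Sum>i<d. A i i) = (0::int) \<longrightarrow>
      (\<exists>z. \<forall>i<d. \<forall>j<d. (\<Sum>s\<in>S. z s * (v_curve d s i * w_curve d s j)) = q * A i j)"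
    using curve_spans[OF d, of S] assms by blast
  have "sc q (unit l) \<in> H" if H: "add_subgroup H \<and> (\<lambda>s. coords_of (curve_mat d s)) ` S \<subseteq> H" and l: "l < N" for H l
  proof -
    have "(\<Sum>i<d. mat_at (unit l) $$ (i, i)) = 0"
      using mat_at_trace0 by (auto simp: trace0_mats_def)
    then obtain z where z: "\<And>i j. i < d \<Longrightarrow> j < d \<Longrightarrow>
        (\<Sum>s\<in>S. z s * (v_curve d s i * w_curve d s j)) = q * mat_at (unit l) $$ (i, j)"
      using q(2)[THEN spec, of "\<lambda>i j. mat_at (unit l) $$ (i, j)"] by auto
    \<comment> \<open>Coordinates of the terms in the combination supplied by
      \<open>curve_spans\<close> for the matrix of \<open>unit l\<close>. The identity is checked on
      matrices and pulled back by injectivity.\<close>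
    define u where "u s = sc (z s) (coords_of (curve_mat d s))" for s
    have u: "u s \<in> lat N" "mat_at (u s) = z s \<cdot>\<^sub>m curve_mat d s" for s
      using coords_of[OF curve_mat_trace0[OF d]] by (auto simp: u_def mat_at_sc)
    have sum_index: "mat_at (\<Sum>s\<in>T. u s) $$ (i, j) = (\<Sum>s\<in>T. mat_at (u s) $$ (i, j))"
      if "i < d" "j < d" for T i j
    proof (induction T rule: infinite_finite_induct)
      case (insert s T)
      then show ?case using that carrier_matD[OF mat_at_carrier] by (simp add: mat_at_add)
    qed (use that in \<open>auto simp: mat_at_zero\<close>)
    have sum_lat: "(\<Sum>s\<in>T. u s) \<in> lat N" for T
      using u(1) by (induction T rule: infinite_finite_induct) auto
    have "sc q (unit l) = (\<Sum>s\<in>S. u s)"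
    proof (rule mat_at_inj)
      show "mat_at (sc q (unit l)) = mat_at (\<Sum>s\<in>S. u s)"
      proof (rule eq_matI)
        fix i j assume "i < dim_row (mat_at (\<Sum>s\<in>S. u s))" "j < dim_col (mat_at (\<Sum>s\<in>S. u s))"
        then have ij: "i < d" "j < d" using carrier_matD[OF mat_at_carrier] by auto
        have "mat_at (\<Sum>s\<in>S. u s) $$ (i, j) = (\<Sum>s\<in>S. z s * (v_curve d s i * w_curve d s j))"
          unfolding sum_index[OF ij] using ij by (simp add: u(2) curve_mat_def)
        then show "mat_at (sc q (unit l)) $$ (i, j) = mat_at (\<Sum>s\<in>S. u s) $$ (i, j)"
          using z[OF ij] ij carrier_matD[OF mat_at_carrier] by (simp add: mat_at_sc)
      qed (use carrier_matD[OF mat_at_carrier] in auto)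
    qed (use l sum_lat in auto)
    also have "\<dots> \<in> H"
      using H unfolding u_def by (intro add_subgroup_sum add_subgroup_sc) auto
    finally show ?thesis .
  qed
  then show "\<exists>q>0. \<forall>H. add_subgroup H \<and> (\<lambda>s. coords_of (curve_mat d s)) ` S \<subseteq> H \<longrightarrow> (\<forall>l<N. sc q (unit l) \<in> H)"
    using q(1) by blast
qed

text \<open>The linear coefficient of each sequence is a commutator, hence traceless, and
  \<open>curve_form\<close> is the quadratic one. The zero matrix has vanishing form and is set
  apart; it returns with the shift 0. Removing it may lower the cardinality, so only an upper bound
  on the size of the family is carried along.\<close>

lemma char_poly_pattern:
  assumes f: "\<And>x. 0 \<le> f x" "\<And>x. f x \<le> 1" and t0: "t0 > 0"
  shows "\<exists>\<epsilon>>0. \<forall>k t. k > 0 \<and> t \<ge> t0 \<and> reaches N f k t \<and> (\<forall>j>0. \<not> reaches N f (k * j) (t + \<epsilon>)) \<longrightarrow>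
    (\<forall>F. F \<subseteq> trace0_mats d \<and> finite F \<and> card F \<le> m \<longrightarrow>
      (\<exists>z. f z > 0 \<and> (\<forall>A\<in>F. \<exists>w. char_poly (mat_at w) = char_poly (int k \<cdot>\<^sub>m A) \<and> f (z + w) > 0)))"
proof -
  define r where "r = 5 * d * d"
  have "r \<le> 2 ^ r" by (simp add: less_imp_le)
  then have span: "spanning N (\<lambda>s. coords_of (curve_mat d s)) (2 ^ r)"
    unfolding r_def by (rule spanning_curve)
  obtain \<epsilon> where "\<epsilon> > 0 \<and> (\<forall>k t y b a s0 (I :: int mat set). k > 0 \<longrightarrow> t \<ge> t0 \<longrightarrow> reaches N f k t \<longrightarrow>
      (\<forall>j>0. \<not> reaches N f (k * j) (t + \<epsilon>)) \<longrightarrow> finite I \<longrightarrow> card I \<le> m \<longrightarrow>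
      (\<forall>i\<in>I. \<forall>s. y i s \<in> lat N) \<longrightarrow> (\<forall>i\<in>I. \<forall>s. b i s \<in> lat N) \<longrightarrow>
      (\<forall>i\<in>I. \<forall>s\<ge>s0 i. a i s \<noteq> 0) \<longrightarrow>
      (\<exists>z. f z > 0 \<and> (\<forall>i\<in>I. \<exists>s n. f (z + sc (int k) (y i s + sc (int n) (b i s) -
        sc ((int n)\<^sup>2 * a i s) (coords_of (curve_mat d s)))) > 0)))"
    using polynomial_pattern[where m = m and 'a = "int mat", OF span f t0] ..
  note \<epsilon> = this[THEN conjunct1] and core = this[THEN conjunct2, rule_format]
  have "\<exists>z. f z > 0 \<and> (\<forall>A\<in>F. \<exists>w. char_poly (mat_at w) = char_poly (int k \<cdot>\<^sub>m A) \<and> f (z + w) > 0)"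
    if k: "k > 0" "t \<ge> t0" "reaches N f k t" "\<And>j. j > 0 \<Longrightarrow> \<not> reaches N f (k * j) (t + \<epsilon>)"
      and F: "F \<subseteq> trace0_mats d" "finite F" "card F \<le> m" for k t F
  proof -
    define I where "I = F - {0\<^sub>m d d}"
    have "card I \<le> card F" using F(2) unfolding I_def by (intro card_mono) auto
    then have I: "finite I" "card I \<le> m" using F by (auto simp: I_def)
    have tr: "A \<in> trace0_mats d" "A \<in> carrier_mat d d" if "A \<in> F" for A
      using that F(1) by (auto simp: trace0_mats_def)
    define B where "B A s = curve_mat d s * A - A * curve_mat d s" for A s
    have B: "B A s \<in> trace0_mats d" if "A \<in> F" for A s
    proof -
      have "(\<Sum>i<d. B A s $$ (i, i)) = (\<Sum>i<d. (curve_mat d s * A) $$ (i, i)) - (\<Sum>i<d. (A * curve_mat d s) $$ (i, i))"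
        using carrier_matD[OF tr(2)[OF that]] carrier_matD[OF curve_mat_carrier[of d s]]
        unfolding B_def sum_subtractf[symmetric] by (intro sum.cong) auto
      also have "\<dots> = 0"
        using trace_commute[OF curve_mat_carrier tr(2)[OF that], of s] by (simp only: right_minus_eq)
      finally have "(\<Sum>i<d. B A s $$ (i, i)) = 0" .
      moreover have "B A s \<in> carrier_mat d d"
        using tr(2)[OF that] curve_mat_carrier[of d s] unfolding B_def by (intro minus_carrier_mat mult_carrier_mat)
      ultimately show ?thesis unfolding trace0_mats_def by (intro CollectI conjI)
    qed
    have "\<exists>s0. \<forall>s\<ge>s0. curve_form d A s \<noteq> 0" if "A \<in> I" for A
    proof -
      have "A \<in> trace0_mats d" "A \<noteq> 0\<^sub>m d d" using that tr by (auto simp: I_def)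
      then show ?thesis using curve_form_nonzero[OF d, of A] by blast
    qed
    then obtain s0 where s0: "\<And>A s. A \<in> I \<Longrightarrow> s \<ge> s0 A \<Longrightarrow> curve_form d A s \<noteq> 0" by metis
    have "\<exists>z. f z > 0 \<and> (\<forall>A\<in>I. \<exists>s n. f (z + sc (int k) (coords_of A + sc (int n) (coords_of (B A s)) -
        sc ((int n)\<^sup>2 * curve_form d A s) (coords_of (curve_mat d s)))) > 0)"
      using B tr s0 by (intro core[OF k I, where ?s0.0 = s0] coords_of) (auto simp: I_def)
    then obtain z where z: "f z > 0" "\<And>A. A \<in> I \<Longrightarrow> \<exists>s n. f (z + sc (int k) (coords_of A + sc (int n) (coords_of (B A s)) -
        sc ((int n)\<^sup>2 * curve_form d A s) (coords_of (curve_mat d s)))) > 0" by blast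
    have "\<exists>w. char_poly (mat_at w) = char_poly (int k \<cdot>\<^sub>m A) \<and> f (z + w) > 0" if A: "A \<in> F" for A
    proof (cases "A = 0\<^sub>m d d")
      case True
      then have "mat_at 0 = int k \<cdot>\<^sub>m A" by (auto simp: mat_at_zero intro!: eq_matI)
      then show ?thesis using z(1) by (intro exI[of _ 0]) simp
    next
      case False
      then obtain s n where sn: "f (z + sc (int k) (coords_of A + sc (int n) (coords_of (B A s)) -
        sc ((int n)\<^sup>2 * curve_form d A s) (coords_of (curve_mat d s)))) > 0" using z(2)[of A] A by (auto simp: I_def)
      have "char_poly (mat_at (sc (int k) (coords_of A + sc (int n) (coords_of (B A s)) -
        sc ((int n)\<^sup>2 * curve_form d A s) (coords_of (curve_mat d s))))) = char_poly (int k \<cdot>\<^sub>m A)"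
        unfolding mat_at_sc mat_at_diff mat_at_add coords_of[OF tr(1)[OF A]] coords_of[OF B[OF A]]
          coords_of[OF curve_mat_trace0[OF d]]
        unfolding B_def
        by (rule char_poly_curve[OF d tr(2)[OF A]])
      then show ?thesis using sn by blast
    qed
    then show ?thesis using z(1) by blast
  qed
  then show ?thesis using \<epsilon> by (intro exI[of _ \<epsilon>]) blast
qed

end

section \<open>Densities over boxes\<close>

definition box :: "nat set \<Rightarrow> nat \<Rightarrow> (nat \<Rightarrow> int) set" where
  "box A L = {v. \<forall>i. if i \<in> A then 0 \<le> v i \<and> v i < int L else v i = 0}"

lemma avs_eq_box_sum:
  assumes "distinct ls"
  shows "finite (box (set ls) L) \<and> avs (map unit ls) L f x = (\<Sum>v\<in>box (set ls) L. f (x + v)) / real L ^ length ls"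
  using assms
proof (induction ls arbitrary: x)
  case Nil
  have "box {} L = {0}" by (auto simp: box_def fun_eq_iff fun_apply)
  then show ?case by simp
next
  case (Cons l ls)
  have bij: "bij_betw (\<lambda>(n, v). sc (int n) (unit l) + v) ({..<L} \<times> box (set ls) L) (box (set (l # ls)) L)"
  proof (rule bij_betw_byWitness[where f' = "\<lambda>v. (nat (v l), v(l := 0))"])
    show "\<forall>p\<in>{..<L} \<times> box (set ls) L. (\<lambda>v. (nat (v l), v(l := 0))) ((\<lambda>(n, v). sc (int n) (unit l) + v) p) = p"
    proof
      fix p assume "p \<in> {..<L} \<times> box (set ls) L"
      then obtain n v where p: "p = (n, v)" "v \<in> box (set ls) L" by blast
      then have "v l = 0" using Cons.prems by (auto simp: box_def)
      then show "(\<lambda>v. (nat (v l), v(l := 0))) ((\<lambda>(n, v). sc (int n) (unit l) + v) p) = p"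
        by (auto simp: p(1) fun_apply sc_def unit_def)
    qed
    show "\<forall>v\<in>box (set (l # ls)) L. (\<lambda>(n, v). sc (int n) (unit l) + v) (nat (v l), v(l := 0)) = v"
    proof
      fix v assume "v \<in> box (set (l # ls)) L"
      then have "0 \<le> v l" unfolding box_def by (metis (mono_tags, lifting) list.set_intros(1) mem_Collect_eq)
      then show "(\<lambda>(n, v). sc (int n) (unit l) + v) (nat (v l), v(l := 0)) = v"
        by (auto simp: fun_apply sc_def unit_def fun_eq_iff)
    qed
    show "(\<lambda>(n, v). sc (int n) (unit l) + v) ` ({..<L} \<times> box (set ls) L) \<subseteq> box (set (l # ls)) L"
    proof (rule image_subsetI)
      fix p assume "p \<in> {..<L} \<times> box (set ls) L"
      then obtain n v where p: "p = (n, v)" and n: "n \<in> {..<L}" and v: "v \<in> box (set ls) L" by blast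
      have "if i \<in> set (l # ls) then 0 \<le> (sc (int n) (unit l) + v) i \<and> (sc (int n) (unit l) + v) i < int L
          else (sc (int n) (unit l) + v) i = 0" for i
      proof -
        have "if i \<in> set ls then 0 \<le> v i \<and> v i < int L else v i = 0" using v by (simp add: box_def)
        then show ?thesis using n Cons.prems by (auto simp: fun_apply sc_def unit_def split: if_splits)
      qed
      then show "(\<lambda>(n, v). sc (int n) (unit l) + v) p \<in> box (set (l # ls)) L" by (simp add: box_def p)
    qed
    show "(\<lambda>v. (nat (v l), v(l := 0))) ` box (set (l # ls)) L \<subseteq> {..<L} \<times> box (set ls) L"
    proof (rule image_subsetI)
      fix v assume "v \<in> box (set (l # ls)) L"
      then have v: "if i \<in> set (l # ls) then 0 \<le> v i \<and> v i < int L else v i = 0" for i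
        by (simp add: box_def)
      have "if i \<in> set ls then 0 \<le> (v(l := 0)) i \<and> (v(l := 0)) i < int L else (v(l := 0)) i = 0" for i
        using v[of i] Cons.prems by (cases "i = l") auto
      moreover have "nat (v l) < L" using v[of l] by (simp add: nat_less_iff)
      ultimately show "(nat (v l), v(l := 0)) \<in> {..<L} \<times> box (set ls) L" unfolding box_def by blast
    qed
  qed
  have fin: "finite (box (set ls) L)" using Cons by simp
  then have "finite (box (set (l # ls)) L)" using bij bij_betw_finite by blast
  moreover have "(\<Sum>v\<in>box (set (l # ls)) L. f (x + v)) = (\<Sum>n<L. \<Sum>v\<in>box (set ls) L. f (x + sc (int n) (unit l) + v))"
    using sum.reindex_bij_betw[OF bij, of "\<lambda>v. f (x + v)"]
    by (simp add: sum.cartesian_product case_prod_unfold add.assoc)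
  moreover have "avs (map unit (l # ls)) L f x =
      (\<Sum>n<L. (\<Sum>v\<in>box (set ls) L. f (x + sc (int n) (unit l) + v)) / real L ^ length ls) / real L"
    using Cons by (simp add: av_def)
  ultimately show ?case by (simp add: sum_divide_distrib[symmetric])
qed

lemma box_density:
  fixes E :: "int vec set"
  assumes a: "a \<in> carrier_vec N"
  defines "f \<equiv> \<lambda>z. of_bool (Matrix.vec N z \<in> E)"
  shows "real (card (E \<inter> (\<lambda>v. v + a) ` int_box N n)) / real (card (int_box N n)) =
    avs (units N) (2 * n + 1) f (\<lambda>i. if i < N then a $ i - int n else 0)"
proof -
  \<comment> \<open>The symmetric box around \<open>a\<close> has its lowest corner at
    \<open>a - n\<close> and side \<open>2 * n + 1\<close>.\<close>
  define x where "x = (\<lambda>i. if i < N then a $ i - int n else 0)"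
  define L where "L = 2 * n + 1"
  define B where "B = box (set [0..<N]) L"
  have B: "finite B" "\<And>f y. avs (units N) L f y = (\<Sum>v\<in>B. f (y + v)) / real L ^ N"
    using avs_eq_box_sum[of "[0..<N]" L] by (auto simp: B_def)
  have L: "L > 0" by (simp add: L_def)
  have "real (card B) / real L ^ N = 1"
    using B(2)[of "\<lambda>_. 1" 0] L by (simp add: avs_const)
  then have cB: "real (card B) = real L ^ N" using L by simp
  have bij: "bij_betw (\<lambda>v. Matrix.vec N (x + v)) B ((\<lambda>v. v + a) ` int_box N n)"
  proof (rule bij_betw_byWitness[where f' = "\<lambda>u i. if i < N then u $ i - x i else 0"])
    show "\<forall>v\<in>B. (\<lambda>i. if i < N then Matrix.vec N (x + v) $ i - x i else 0) = v"
      by (auto simp: B_def box_def fun_apply fun_eq_iff split: if_splits)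
    show "\<forall>u\<in>(\<lambda>v. v + a) ` int_box N n. Matrix.vec N (x + (\<lambda>i. if i < N then u $ i - x i else 0)) = u"
      using a by (auto simp: int_box_def fun_apply intro!: eq_vecI)
    show "(\<lambda>v. Matrix.vec N (x + v)) ` B \<subseteq> (\<lambda>v. v + a) ` int_box N n"
    proof (rule image_subsetI)
      fix v assume "v \<in> B"
      then have v: "0 \<le> v i \<and> v i < int L" if "i < N" for i using that by (auto simp: B_def box_def split: if_splits)
      have "Matrix.vec N (x + v) = Matrix.vec N (\<lambda>i. v i - int n) + a"
        using a by (auto simp: x_def fun_apply intro!: eq_vecI)
      moreover have "Matrix.vec N (\<lambda>i. v i - int n) \<in> int_box N n"
        using v by (fastforce simp: int_box_def L_def)
      ultimately show "Matrix.vec N (x + v) \<in> (\<lambda>v. v + a) ` int_box N n" by blast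
    qed
    show "(\<lambda>u i. if i < N then u $ i - x i else 0) ` (\<lambda>v. v + a) ` int_box N n \<subseteq> B"
      unfolding image_image
    proof (rule image_subsetI)
      fix v assume "v \<in> int_box N n"
      then have v: "v \<in> carrier_vec N" "\<And>i. i < N \<Longrightarrow> - int n \<le> v $ i \<and> v $ i \<le> int n"
        by (auto simp: int_box_def)
      have "if i \<in> set [0..<N] then 0 \<le> (if i < N then (v + a) $ i - x i else 0) \<and> (if i < N then (v + a) $ i - x i else 0) < int L
          else (if i < N then (v + a) $ i - x i else 0) = 0" for i
        using v(2)[of i] v(1) a by (auto simp: x_def L_def)
      then show "(\<lambda>i. if i < N then (v + a) $ i - x i else 0) \<in> B"
        unfolding B_def box_def by blast
    qed
  qed
  have "inj_on (\<lambda>v. v + a) (int_box N n)"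
  proof (rule inj_onI)
    fix u v assume uv: "u \<in> int_box N n" "v \<in> int_box N n" "u + a = v + a"
    then have c: "u \<in> carrier_vec N" "v \<in> carrier_vec N" by (auto simp: int_box_def)
    show "u = v"
    proof (rule eq_vecI)
      fix i assume "i < dim_vec v"
      then have "i < N" using c by auto
      then have "(u + a) $ i = u $ i + a $ i" "(v + a) $ i = v $ i + a $ i" using c a by auto
      then show "u $ i = v $ i" using uv(3) by simp
    qed (use c in auto)
  qed
  then have "card (int_box N n) = card ((\<lambda>v. v + a) ` int_box N n)" by (simp add: card_image)
  also have "\<dots> = card B" using bij_betw_same_card[OF bij] by simp
  finally have c1: "card (int_box N n) = card B" .
  have fin: "finite ((\<lambda>v. v + a) ` int_box N n)" using bij_betw_finite[OF bij] B(1) by simp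
  have "real (card (E \<inter> (\<lambda>v. v + a) ` int_box N n)) = (\<Sum>u\<in>(\<lambda>v. v + a) ` int_box N n. of_bool (u \<in> E))"
    using fin by (simp add: of_bool_def sum.If_cases Int_commute)
  also have "\<dots> = (\<Sum>v\<in>B. f (x + v))"
    unfolding f_def using sum.reindex_bij_betw[OF bij, of "\<lambda>u. of_bool (u \<in> E) :: real"] by simp
  finally show ?thesis
    using B(2)[of f x] cB c1 by (simp add: x_def L_def)
qed

text \<open>For modulus 1 the local energy is the square of a box average, and the limsup supplies
  boxes of arbitrarily large side with average above a fixed \<open>c\<close>.\<close>

lemma upper_density_reaches:
  fixes E :: "int vec set"
  assumes "upper_banach_density N E > 0"
  defines "f \<equiv> \<lambda>z. of_bool (Matrix.vec N z \<in> E)"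
  shows "\<exists>t0>0. reaches N f 1 t0"
proof -
  define X where "X a n = real (card (E \<inter> (\<lambda>v. v + a) ` int_box N n)) / real (card (int_box N n))" for a n
  obtain a where a: "\<And>n. a n \<in> carrier_vec N" "limsup (\<lambda>n. ereal (X (a n) n)) > 0"
    using assms(1) unfolding upper_banach_density_def less_SUP_iff X_def by blast
  then obtain c' where c': "0 < c'" "c' < limsup (\<lambda>n. ereal (X (a n) n))" using dense by blast
  then obtain c where c: "c > 0" "ereal c < limsup (\<lambda>n. ereal (X (a n) n))"
    by (cases c') auto
  have "\<exists>n\<ge>n0. X (a n) n > c" for n0
  proof (rule ccontr)
    assume "\<not> ?thesis"
    then have "\<forall>\<^sub>F n in sequentially. ereal (X (a n) n) \<le> ereal c"
      unfolding eventually_sequentially by (auto simp: not_less)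
    then have "limsup (\<lambda>n. ereal (X (a n) n)) \<le> ereal c" by (rule Limsup_bounded)
    then show False using c(2) by simp
  qed
  moreover have "X (a n) n = avs (units N) (2 * n + 1) f (\<lambda>i. if i < N then a n $ i - int n else 0)" for n
    unfolding X_def f_def by (rule box_density[OF a(1)])
  ultimately have large: "\<exists>n\<ge>n0. \<exists>x. avs (units N) (2 * n + 1) f x > c" for n0 by metis
  have "reaches N f 1 (c\<^sup>2)"
  proof (rule reaches_if_local_energy)
    fix H0
    obtain n x where n: "n \<ge> H0" "avs (units N) (2 * n + 1) f x > c" using large by blast
    have one: "avs cs 1 g y = g y" for cs g y
      by (induction cs arbitrary: y) (auto simp: av_def)
    have m: "map (sc (int 1)) (units N) = units N" by (simp add: comp_def)
    have "c\<^sup>2 \<le> (avs (units N) (2 * n + 1) f x)\<^sup>2" using n(2) c by (intro power_mono) auto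
    then show "\<exists>H\<ge>H0. \<exists>x. c\<^sup>2 \<le> avs (units N) 1 (\<lambda>y. (avs (map (sc (int 1)) (units N)) H f y)\<^sup>2) x"
      unfolding one m using n(1) by (intro exI[of _ "2 * n + 1"] conjI exI[of _ x]) auto
  qed (auto simp: f_def)
  then show ?thesis using c by (intro exI[of _ "c\<^sup>2"]) auto
qed

text \<open>Saturation over all positive moduli fixes \<open>k\<close> before any \<open>F\<close>
  is given; the common return point \<open>z\<close> becomes \<open>b\<close>.\<close>

lemma (in traceless_basis) positive_density_pattern:
  assumes E: "E \<subseteq> trace0_mats d" and dens: "upper_banach_density N (coords_set d bs E) > 0"
  shows "\<exists>k>0. charpoly_pattern d m E k"
proof -
  define f :: "(nat \<Rightarrow> int) \<Rightarrow> real" where "f z = of_bool (Matrix.vec N z \<in> coords_set d bs E)" for z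
  have f: "0 \<le> f x" "f x \<le> 1" "f x > 0 \<longleftrightarrow> mat_at x \<in> E" for x
    by (auto simp: f_def coords_set_def mat_at_def)
  obtain t0 where t0: "t0 > 0" "reaches N f 1 t0"
    using upper_density_reaches[OF dens] unfolding f_def[abs_def] by blast
  obtain \<epsilon> where \<epsilon>: "\<epsilon> > 0" "\<forall>k t. k > 0 \<and> t \<ge> t0 \<and> reaches N f k t \<and> (\<forall>j>0. \<not> reaches N f (k * j) (t + \<epsilon>)) \<longrightarrow>
    (\<forall>F. F \<subseteq> trace0_mats d \<and> finite F \<and> card F \<le> m \<longrightarrow>
      (\<exists>z. f z > 0 \<and> (\<forall>A\<in>F. \<exists>w. char_poly (mat_at w) = char_poly (int k \<cdot>\<^sub>m A) \<and> f (z + w) > 0)))"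
    using char_poly_pattern[of f t0 m, OF f(1,2) t0(1)] by blast
  obtain k t where k: "k \<in> {0<..}" "t \<ge> t0" "reaches N f k t" "\<And>j. j \<in> {0<..} \<Longrightarrow> \<not> reaches N f (k * j) (t + \<epsilon>)"
    using exists_energy_saturated[where f = f and J = "{0<..}", OF f(1,2) _ _ _ t0(2) \<epsilon>(1)] by auto
  have "charpoly_pattern d m E k"
    unfolding charpoly_pattern_def
  proof (intro allI impI)
    fix F :: "int mat set" assume F: "F \<subseteq> trace0_mats d \<and> finite F \<and> card F = m"
    then obtain z where z: "f z > 0" "\<And>A. A \<in> F \<Longrightarrow> \<exists>w. char_poly (mat_at w) = char_poly (int k \<cdot>\<^sub>m A) \<and> f (z + w) > 0"
      using \<epsilon>(2) k by (metis greaterThan_iff order_refl)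
    show "\<exists>b\<in>E. char_poly ` ((\<lambda>f. int k \<cdot>\<^sub>m f) ` F) \<subseteq> char_poly ` ((\<lambda>e. e - b) ` E)"
    proof (intro bexI[of _ "mat_at z"] subsetI)
      fix p assume "p \<in> char_poly ` ((\<lambda>f. int k \<cdot>\<^sub>m f) ` F)"
      then obtain A where A: "A \<in> F" "p = char_poly (int k \<cdot>\<^sub>m A)" by blast
      obtain w where w: "char_poly (mat_at w) = char_poly (int k \<cdot>\<^sub>m A)" "f (z + w) > 0" using z(2)[OF A(1)] by blast
      have "mat_at w = mat_at (z + w) - mat_at z" using mat_at_diff[of "z + w" z] by simp
      then show "p \<in> char_poly ` ((\<lambda>e. e - mat_at z) ` E)"
        using w f(3) A(2) by (metis imageI)
    qed (use z(1) f(3) in auto)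
  qed
  then show ?thesis using k(1) by auto
qed

section \<open>Bohr sets\<close>

definition trunc :: "nat \<Rightarrow> (nat \<Rightarrow> int) \<Rightarrow> nat \<Rightarrow> int" where
  "trunc N w = (\<lambda>i. if i < N then w i else 0)"

lemma trunc_lat [simp]: "trunc N w \<in> lat N"
  by (simp add: trunc_def lat_def)

text \<open>The homomorphism is extended to the whole type; the condition with \<open>trunc\<close>
  says that it factors through the first \<open>N\<close> coordinates.\<close>

locale dense_hom =
  fixes N :: nat and T :: "(nat \<Rightarrow> int) \<Rightarrow> 'k::{topological_ab_group_add, t2_space, second_countable_topology}"
  assumes add: "T (v + w) = T v + T w"
    and trunc: "T (trunc N w) = T w"
    and dense: "closure (range T) = UNIV"
    and compact: "compact (UNIV :: 'k set)"
begin

lemma zero: "T 0 = 0"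
  using add[of 0 0] by simp

lemma uminus: "T (- w) = - T w"
  using add[of w "- w"] zero by (simp add: eq_neg_iff_add_eq_0 add.commute)

lemma diff: "T (v - w) = T v - T w"
  using add[of v "- w"] uminus by simp

lemma meets_open: assumes "open U" "U \<noteq> {}" shows "\<exists>w\<in>lat N. T w \<in> U"
proof -
  have "U \<inter> closure (range T) \<noteq> {}" using dense assms by simp
  then have "U \<inter> range T \<noteq> {}" using assms(1) open_Int_closure_eq_empty by metis
  then obtain w where "T w \<in> U" by blast
  then show ?thesis using trunc[of w] by (intro bexI[of _ "trunc N w"]) auto
qed

text \<open>The closure \<open>C\<close> of the image of the \<open>j\<close>-multiples is a closed
  subgroup, and finitely many closed cosets of it, one for each residue class, cover the group. So
  the complement of \<open>C\<close> is closed as well, and connectedness leaves only the whole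
  group.\<close>

lemma dense_multiples:
  assumes conn: "connected (UNIV :: 'k set)" and j: "j > 0"
  shows "closure (range (\<lambda>w. T (sc (int j) w))) = UNIV"
proof -
  define H where "H = range (\<lambda>w. T (sc (int j) w))"
  define C where "C = closure H"
  have H: "x - y \<in> H" if "x \<in> H" "y \<in> H" for x y
    using that unfolding H_def by (auto simp: diff[symmetric] sc_add(4)[symmetric])
  have sub: "x - y \<in> C" if x: "x \<in> C" and y: "y \<in> C" for x y
  proof -
    have cl: "closed C" by (simp add: C_def)
    have 1: "x - y \<in> C" if x: "x \<in> H" and y: "y \<in> C" for x y
    proof -
      have "closed ((\<lambda>y. x - y) -` C)"
        by (intro closed_vimage cl continuous_intros)
      moreover have "H \<subseteq> (\<lambda>y. x - y) -` C" using H[OF x] closure_subset[of H] by (auto simp: C_def)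
      ultimately have "C \<subseteq> (\<lambda>y. x - y) -` C" unfolding C_def by (intro closure_minimal)
      then show ?thesis using y by auto
    qed
    have "closed ((\<lambda>x. x - y) -` C)"
      by (intro closed_vimage cl continuous_intros)
    moreover have "H \<subseteq> (\<lambda>x. x - y) -` C" using 1 y by auto
    ultimately have "C \<subseteq> (\<lambda>x. x - y) -` C" unfolding C_def by (intro closure_minimal)
    then show ?thesis using x by auto
  qed
  define U where "U = box {..<N} j"
  have U: "finite U" unfolding U_def using avs_eq_box_sum[of "[0..<N]" j] by (simp add: atLeast0LessThan)
  define coset where "coset u = (\<lambda>y. y - T u) -` C" for u
  have closed_coset: "closed (coset u)" for u
    unfolding coset_def C_def by (intro closed_vimage closed_closure continuous_intros)
  have "range T \<subseteq> (\<Union>u\<in>U. coset u)"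
  proof
    fix y assume "y \<in> range T"
    then obtain w where w: "y = T w" by blast
    define u where "u = (\<lambda>i. if i < N then w i mod int j else 0)"
    define q where "q = (\<lambda>i. if i < N then w i div int j else 0)"
    have "u \<in> U" using j by (auto simp: U_def box_def u_def)
    moreover have "trunc N w = u + sc (int j) q"
      by (auto simp: trunc_def u_def q_def fun_apply sc_def fun_eq_iff)
    then have "T w = T u + T (sc (int j) q)" by (metis add trunc)
    then have "T w - T u = T (sc (int j) q)" by simp
    then have "y \<in> coset u" using closure_subset[of H] by (auto simp: coset_def C_def H_def w)
    ultimately show "y \<in> (\<Union>u\<in>U. coset u)" by blast
  qed
  moreover have "closed (\<Union>u\<in>U. coset u)" using U closed_coset by (intro closed_UN) auto
  ultimately have cover: "(\<Union>u\<in>U. coset u) = UNIV"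
    using dense closure_minimal by (metis top.extremum_uniqueI)
  have "0 \<in> H" unfolding H_def by (rule range_eqI[of _ _ 0]) (simp add: zero)
  then have zeroC: "0 \<in> C" using closure_subset[of H] by (auto simp: C_def)
  have memC: "coset u = C" if "T u \<in> C" for u
  proof (intro Set.set_eqI iffI)
    fix y assume "y \<in> C" then show "y \<in> coset u" using sub that by (auto simp: coset_def)
  next
    fix y assume "y \<in> coset u"
    then have "y - T u \<in> C" by (simp add: coset_def)
    moreover have "0 - T u \<in> C" using sub[OF zeroC that] .
    ultimately have "(y - T u) - (0 - T u) \<in> C" by (rule sub)
    then show "y \<in> C" by simp
  qed
  have "- C = (\<Union>u\<in>{u\<in>U. T u \<notin> C}. coset u)"
  proof (intro Set.set_eqI iffI)
    fix y assume y: "y \<in> - C"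
    then obtain u where "u \<in> U" "y \<in> coset u" using cover by blast
    then show "y \<in> (\<Union>u\<in>{u\<in>U. T u \<notin> C}. coset u)" using memC y by auto
  next
    fix y assume "y \<in> (\<Union>u\<in>{u\<in>U. T u \<notin> C}. coset u)"
    then obtain u where u: "T u \<notin> C" "y - T u \<in> C" by (auto simp: coset_def)
    have False if "y \<in> C"
    proof -
      have "y - (y - T u) \<in> C" using sub[OF that u(2)] .
      then show False using u(1) by simp
    qed
    then show "y \<in> - C" by blast
  qed
  then have "closed (- C)" using U closed_coset by (auto intro!: closed_UN)
  then have "open C" by (simp add: open_closed)
  moreover have "closed C" by (simp add: C_def)
  ultimately have "C = UNIV" using conn zeroC unfolding connected_clopen by (metis closedin_closed_eq closed_UNIV empty_iff open_openin closed_closedin subtopology_UNIV)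
  then show ?thesis by (simp add: C_def H_def)
qed

text \<open>A continuous bump replaces the indicator of \<open>W\<close>, because uniform continuity
  makes it insensitive to small translations.\<close>

lemma Urysohn_at_zero:
  assumes "open W" "0 \<in> W"
  obtains \<phi> :: "'k \<Rightarrow> real" where "continuous_on UNIV \<phi>" "\<And>x. 0 \<le> \<phi> x" "\<And>x. \<phi> x \<le> 1" "\<phi> 0 = 1"
    "\<And>x. \<phi> x > 0 \<Longrightarrow> x \<in> W"
proof -
  have "normal_space (euclidean :: 'k topology)"
  proof (rule compact_Hausdorff_or_regular_imp_normal_space)
    show "compact_space (euclidean :: 'k topology)" using compact by (simp add: compact_space_def)
    have "Hausdorff_space (euclidean :: 'k topology)"
      unfolding Hausdorff_space_def disjnt_def using hausdorff by (metis open_openin)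
    then show "Hausdorff_space (euclidean :: 'k topology) \<or> regular_space (euclidean :: 'k topology)" ..
  qed
  then obtain \<phi> where \<phi>: "continuous_map euclidean (top_of_set {0..1::real}) \<phi>" "\<phi> ` (- W) \<subseteq> {0}" "\<phi> ` {0} \<subseteq> {1}"
    using Urysohn_lemma[of euclidean "- W" "{0}" 0 1] assms by (auto simp: disjnt_def)
  have "continuous_on UNIV \<phi>" "\<And>x. \<phi> x \<in> {0..1}"
    using \<phi>(1) by (auto simp: continuous_map_in_subtopology)
  then show thesis using that[of \<phi>] \<phi>(2,3) by (force simp: image_subset_iff)
qed

text \<open>The tube lemma makes \<open>V\<close> independent of \<open>x\<close>.\<close>

lemma uniformly_continuous:
  fixes \<phi> :: "'k \<Rightarrow> real"
  assumes \<phi>: "continuous_on UNIV \<phi>" and \<eta>: "\<eta> > 0"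
  obtains V where "open V" "0 \<in> V" "\<And>x v. v \<in> V \<Longrightarrow> \<bar>\<phi> (x + v) - \<phi> x\<bar> < \<eta>"
proof -
  define G where "G = (\<lambda>(v, x). \<bar>\<phi> (x + v) - \<phi> x\<bar>) -` {..<\<eta>}"
  have "continuous_on UNIV (\<lambda>p. \<bar>\<phi> (snd p + fst p) - \<phi> (snd p)\<bar>)"
    by (intro continuous_intros continuous_on_compose2[OF \<phi>]) auto
  then have "open G" unfolding G_def case_prod_unfold by (intro open_vimage) auto
  moreover have "{0} \<times> UNIV \<subseteq> G" using \<eta> by (auto simp: G_def)
  ultimately obtain V where "0 \<in> V" "open V" "V \<times> UNIV \<subseteq> G"
    using Elementary_Topology.tube_lemma[OF compact] by metis
  moreover have "\<bar>\<phi> (x + v) - \<phi> x\<bar> < \<eta>" if "v \<in> V" for x v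
  proof -
    have "(v, x) \<in> G" using \<open>V \<times> UNIV \<subseteq> G\<close> that by blast
    then show ?thesis by (simp add: G_def)
  qed
  ultimately show thesis using that by blast
qed

text \<open>Finitely many translates of {\<phi> > 1/2} cover the compact group, so the matching
  translates of the function add up to at least 1/2 everywhere. By pigeonhole, for each side one of
  them has box average at least \<open>1 / (2 * real (card D))\<close>.\<close>

lemma mean_positive:
  fixes \<phi> :: "'k \<Rightarrow> real"
  assumes \<phi>: "continuous_on UNIV \<phi>" "\<And>x. 0 \<le> \<phi> x" "\<And>x. \<phi> x \<le> 1" "\<phi> 0 = 1"
  shows "\<exists>t0>0. reaches N (\<lambda>w. \<phi> (T w)) 1 t0"
proof -
  define U where "U = \<phi> -` {1/2<..}"
  have U: "open U" unfolding U_def using \<phi>(1) by (intro open_vimage) auto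
  define P where "P w = (\<lambda>x. x - T w) -` U" for w
  have "open (P w)" for w unfolding P_def using U by (intro open_vimage continuous_intros)
  moreover have "\<exists>w. x \<in> P w" for x
  proof -
    have "open ((\<lambda>y. x - y) -` U)" using U by (intro open_vimage continuous_intros)
    moreover have "x \<in> (\<lambda>y. x - y) -` U" using \<phi>(4) by (simp add: U_def)
    ultimately obtain w where "T w \<in> (\<lambda>y. x - y) -` U" using meets_open by blast
    then show ?thesis by (auto simp: P_def)
  qed
  then have "UNIV \<subseteq> (\<Union>w\<in>UNIV. P w)" by blast
  ultimately obtain D where D: "finite D" "UNIV \<subseteq> (\<Union>w\<in>D. P w)"
    using compactE_image[OF compact, of UNIV P] by metis
  then have D0: "D \<noteq> {}" by auto
  define f where "f w = \<phi> (T w)" for w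
  have sum: "1 / 2 \<le> (\<Sum>w\<in>D. f (y - w))" for y
  proof -
    obtain w where w: "w \<in> D" "T y \<in> P w" using D(2) by blast
    then have "1 / 2 \<le> f (y - w)" by (simp add: f_def P_def U_def diff)
    also have "\<dots> \<le> (\<Sum>w\<in>D. f (y - w))" using D(1) w \<phi>(2) by (intro member_le_sum) (auto simp: f_def)
    finally show ?thesis .
  qed
  define c where "c = 1 / (2 * real (card D))"
  have c: "c > 0" using D D0 by (simp add: c_def card_gt_0_iff)
  have "reaches N f 1 (c\<^sup>2)"
  proof (rule reaches_if_local_energy)
    fix H0 :: nat
    define H where "H = Suc H0"
    have "\<exists>w\<in>D. c \<le> avs (units N) H f (- w)"
    proof (rule ccontr)
      assume "\<not> ?thesis"
      then have "(\<Sum>w\<in>D. avs (units N) H f (0 - w)) < (\<Sum>w\<in>D. c)"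
        using D D0 by (intro sum_strict_mono) auto
      also have "\<dots> = 1 / 2" using D D0 by (simp add: c_def)
      finally have "(\<Sum>w\<in>D. avs (units N) H f (0 - w)) < 1 / 2" .
      moreover have "(\<Sum>w\<in>D. avs (units N) H f (0 - w)) = avs (units N) H (\<lambda>y. \<Sum>w\<in>D. f (y - w)) 0"
      proof -
        have "avs (units N) H (\<lambda>y. \<Sum>w\<in>A. f (y - w)) x = (\<Sum>w\<in>A. avs (units N) H f (x - w))" for A x
        proof (induction A rule: infinite_finite_induct)
          case (insert w A)
          then show ?case using avs_shift[of "units N" H f "- w"] by (simp add: avs_add)
        qed (auto simp: avs_const H_def)
        then show ?thesis by simp
      qed
      moreover have "avs (units N) H (\<lambda>y. 1 / 2) 0 \<le> avs (units N) H (\<lambda>y. \<Sum>w\<in>D. f (y - w)) 0"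
        by (intro avs_mono sum)
      ultimately show False by (simp add: avs_const H_def)
    qed
    then obtain w where w: "c \<le> avs (units N) H f (- w)" by blast
    have one: "avs cs 1 g y = g y" for cs g y
      by (induction cs arbitrary: y) (auto simp: av_def)
    have m: "map (sc (int 1)) (units N) = units N" by (simp add: comp_def)
    have "c\<^sup>2 \<le> (avs (units N) H f (- w))\<^sup>2" using w c by (intro power_mono) auto
    then show "\<exists>H\<ge>H0. \<exists>x. c\<^sup>2 \<le> avs (units N) 1 (\<lambda>y. (avs (map (sc (int 1)) (units N)) H f y)\<^sup>2) x"
      unfolding one m by (intro exI[of _ H] conjI exI[of _ "- w"]) (auto simp: H_def)
  qed (use \<phi> in \<open>auto simp: f_def\<close>)
  then show ?thesis using c unfolding f_def[abs_def] by (intro exI[of _ "c\<^sup>2"]) auto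
qed

text \<open>Translations by \<open>j\<close>-multiples are dense in a connected group, so \<open>\<phi> \<circ> T\<close> has almost
  the same density on all cosets modulo \<open>j\<close>.\<close>

lemma reaches_connected:
  fixes \<phi> :: "'k \<Rightarrow> real"
  assumes conn: "connected (UNIV :: 'k set)"
    and \<phi>: "continuous_on UNIV \<phi>" "\<And>x. 0 \<le> \<phi> x" "\<And>x. \<phi> x \<le> 1"
    and j: "j > 0" and reach: "reaches N (\<lambda>w. \<phi> (T w)) j (t + \<epsilon>)" and \<epsilon>: "\<epsilon> > 0"
  shows "reaches N (\<lambda>w. \<phi> (T w)) 1 t"
proof -
  define f where "f w = \<phi> (T w)" for w
  have f: "0 \<le> f x" "f x \<le> 1" for x using \<phi> by (auto simp: f_def)
  then have abs_f: "\<bar>f x\<bar> \<le> 1" for x by simp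
  then have bf: "bd f" by (rule bdI)
  obtain l where l: "invariant_mean N l" "t + \<epsilon> \<le> l (\<lambda>x. (invariant_mean.coset_density N l j f x)\<^sup>2)"
    using reach by (auto simp: reaches_def f_def[abs_def])
  interpret invariant_mean N l by (rule l)
  define p where "p = coset_density j f"
  have p: "0 \<le> p x" "p x \<le> 1" for x
    unfolding p_def using coset_density_bounds[of f j x, OF f j] by auto
  then have bp: "bd p" by (intro bdI[of _ 1]) simp
  define \<eta> where "\<eta> = min 1 (\<epsilon> / 3)"
  have \<eta>: "\<eta> > 0" "\<eta> \<le> 1" "3 * \<eta> \<le> \<epsilon>" using \<epsilon> by (auto simp: \<eta>_def)
  obtain V where V: "open V" "0 \<in> V" "\<And>x v. v \<in> V \<Longrightarrow> \<bar>\<phi> (x + v) - \<phi> x\<bar> < \<eta>"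
    using uniformly_continuous[OF \<phi>(1) \<eta>(1)] by metis
  \<comment> \<open>The translation from \<open>y\<close> to \<open>y'\<close> is replaced by a
    \<open>j\<close>-multiple, which preserves cosets. By density its image under \<open>T\<close>
    can be matched up to an element of \<open>V\<close>.\<close>
  have close: "p y' \<le> p y + \<eta>" for y y'
  proof -
    define u where "u = trunc N (y' - y)"
    have u: "u \<in> lat N" by (simp add: u_def)
    have "open ((\<lambda>c. T u - c) -` V)" using V(1) by (intro open_vimage continuous_intros)
    moreover have "T u \<in> (\<lambda>c. T u - c) -` V" using V(2) by simp
    ultimately have "(\<lambda>c. T u - c) -` V \<inter> range (\<lambda>w. T (sc (int j) w)) \<noteq> {}"
      using dense_multiples[OF conn j] open_Int_closure_eq_empty by (metis Int_UNIV_right empty_iff)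
    then obtain w0 where w0: "T u - T (sc (int j) w0) \<in> V" by auto
    define w where "w = trunc N w0"
    have "trunc N (sc (int j) w) = trunc N (sc (int j) w0)"
      by (auto simp: w_def trunc_def sc_def)
    then have w: "T u - T (sc (int j) w) \<in> V" "w \<in> lat N"
      using w0 trunc[of "sc (int j) w"] trunc[of "sc (int j) w0"] by (auto simp: w_def)
    have fu: "f (z + u) \<le> f (z + sc (int j) w) + \<eta>" for z
    proof -
      have "\<bar>\<phi> (T z + T (sc (int j) w) + (T u - T (sc (int j) w))) - \<phi> (T z + T (sc (int j) w))\<bar> < \<eta>"
        using V(3) w(1) by blast
      then show ?thesis by (simp add: f_def add)
    qed
    have chi_u: "chi N j y' (z + u) = chi N j y z" for z
      by (auto simp: chi_def u_def trunc_def fun_apply)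
    have chi_w: "chi N j y (z + sc (int j) w) = chi N j y z" for z
      using periodic_shift[OF periodic_chi] by blast
    have "l (\<lambda>z. f z * chi N j y' z) = l (\<lambda>z. f (z + u) * chi N j y' (z + u))"
      using bf u by (intro mean_shift[symmetric]) auto
    also have "\<dots> \<le> l (\<lambda>z. f (z + sc (int j) w) * chi N j y (z + sc (int j) w) + \<eta> * chi N j y z)"
    proof (rule mean_mono)
      fix z
      show "f (z + u) * chi N j y' (z + u) \<le> f (z + sc (int j) w) * chi N j y (z + sc (int j) w) + \<eta> * chi N j y z"
        using mult_right_mono[OF fu[of z] chi_nonneg[of N j y z]] unfolding chi_u chi_w
        by (simp add: distrib_right)
    qed (use bf in auto)
    also have "\<dots> = l (\<lambda>z. f (z + sc (int j) w) * chi N j y (z + sc (int j) w)) + \<eta> * l (chi N j y)"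
      using bf by (subst mean_add) (auto simp: mean_cmult)
    also have "l (\<lambda>z. f (z + sc (int j) w) * chi N j y (z + sc (int j) w)) = l (\<lambda>z. f z * chi N j y z)"
      using bf w by (intro mean_shift[of "\<lambda>z. f z * chi N j y z"]) auto
    finally have "real j ^ N * l (\<lambda>z. f z * chi N j y' z) \<le> real j ^ N * (l (\<lambda>z. f z * chi N j y z) + \<eta> * l (chi N j y))"
      by (intro mult_left_mono) auto
    then show ?thesis using j by (simp add: p_def coset_density_def mean_chi distrib_left)
  qed
  have lp: "l p = l f"
    using coset_density_adjoint[of f j "\<lambda>_. 1", OF f j] by (simp add: p_def periodic_def)
  \<comment> \<open>\<open>p\<close> averages to \<open>l f\<close> and oscillates by at most
    \<eta>, so no value exceeds \<open>l f + \<eta>\<close>; squaring costs at most 3 \<eta>, as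
    \<open>l f\<close> and \<eta> are at most 1.\<close>
  have "l (\<lambda>y. p x) \<le> l (\<lambda>y. p y + \<eta>)" for x using close bp by (intro mean_mono) auto
  then have px: "p x \<le> l f + \<eta>" for x using bp by (simp add: mean_const mean_add lp)
  have lf: "0 \<le> l f" "l f \<le> 1" using f bf mean_bound[of f 1, OF abs_f] by (auto intro: mean_nonneg)
  have "(p x)\<^sup>2 \<le> (l f + \<eta>)\<^sup>2" for x using px p by (intro power_mono)
  then have "l (\<lambda>x. (p x)\<^sup>2) \<le> l (\<lambda>x. (l f + \<eta>)\<^sup>2)" using bp by (intro mean_mono) auto
  also have "\<dots> = (l f)\<^sup>2 + (2 * l f + \<eta>) * \<eta>" by (simp add: mean_const power2_eq_square algebra_simps)
  also have "\<dots> \<le> (l f)\<^sup>2 + 3 * \<eta>" using lf \<eta> by (intro add_left_mono mult_right_mono) auto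
  also have "\<dots> \<le> (l f)\<^sup>2 + \<epsilon>" using \<eta> by simp
  finally have "t \<le> (l f)\<^sup>2" using l(2) by (simp add: p_def)
  moreover have "coset_density 1 f x = l f" for x by (simp add: coset_density_def chi_def)
  ultimately have "t \<le> l (\<lambda>x. (coset_density 1 f x)\<^sup>2)" by (simp add: mean_const)
  then show ?thesis using l(1) unfolding reaches_def f_def[abs_def] by blast
qed

end

text \<open>The bump lives on \<open>V1 \<inter> V2\<close> with V1 - V2 inside \<open>W\<close>. A
  return from \<open>z\<close> to \<open>z + w\<close> within its support makes \<open>T w\<close> a
  difference of two such points, hence an element of \<open>W\<close>.\<close>

lemma (in traceless_basis) char_poly_in_neighbourhood:
  assumes hom: "dense_hom N T" and conn: "connected (UNIV :: 'k::{topological_ab_group_add, t2_space, second_countable_topology} set)"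
    and W: "open (W :: 'k set)" "0 \<in> W" and A: "A \<in> trace0_mats d"
  shows "\<exists>w. char_poly (mat_at w) = char_poly A \<and> T w \<in> W"
proof -
  interpret dense_hom N T by (rule hom)
  define D where "D = (\<lambda>p. fst p - snd p) -` W"
  have "open D" "(0, 0) \<in> D" using W by (auto simp: D_def intro!: open_vimage continuous_intros)
  then obtain V1 V2 where V: "open V1" "open V2" "(0, 0) \<in> V1 \<times> V2" "V1 \<times> V2 \<subseteq> D"
    by (rule open_prod_elim)
  obtain \<phi> :: "'k \<Rightarrow> real" where \<phi>: "continuous_on UNIV \<phi>" "\<And>x. 0 \<le> \<phi> x" "\<And>x. \<phi> x \<le> 1" "\<phi> 0 = 1"
    "\<And>x. \<phi> x > 0 \<Longrightarrow> x \<in> V1 \<inter> V2"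
    using Urysohn_at_zero[of "V1 \<inter> V2"] V by (auto intro: open_Int)
  define f where "f w = \<phi> (T w)" for w
  have f: "0 \<le> f x" "f x \<le> 1" for x using \<phi> by (auto simp: f_def)
  obtain t0 where t0: "t0 > 0" "reaches N f 1 t0"
    using mean_positive[OF \<phi>(1-4)] unfolding f_def[abs_def] by blast
  obtain \<epsilon> where \<epsilon>: "\<epsilon> > 0" "\<forall>k t. k > 0 \<and> t \<ge> t0 \<and> reaches N f k t \<and> (\<forall>j>0. \<not> reaches N f (k * j) (t + \<epsilon>)) \<longrightarrow>
    (\<forall>F. F \<subseteq> trace0_mats d \<and> finite F \<and> card F \<le> 1 \<longrightarrow>
      (\<exists>z. f z > 0 \<and> (\<forall>A\<in>F. \<exists>w. char_poly (mat_at w) = char_poly (int k \<cdot>\<^sub>m A) \<and> f (z + w) > 0)))"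
    using char_poly_pattern[of f t0 1, OF f t0(1)] by blast
  \<comment> \<open>Saturation for the single modulus 1 uses half of the gap;
    \<open>reaches_connected\<close> spends the other half to exclude every modulus
    \<open>j\<close>.\<close>
  obtain t where t: "t \<ge> t0" "reaches N f 1 t" "\<not> reaches N f 1 (t + \<epsilon> / 2)"
    using exists_energy_saturated[where f = f and J = "{1}", OF f _ _ _ t0(2), of "\<epsilon> / 2"] \<epsilon>(1) by auto
  have "\<not> reaches N f j (t + \<epsilon>)" if j: "j > 0" for j
  proof
    have "t + \<epsilon> = t + \<epsilon> / 2 + \<epsilon> / 2" by simp
    moreover assume "reaches N f j (t + \<epsilon>)"
    ultimately have "reaches N f j (t + \<epsilon> / 2 + \<epsilon> / 2)" by (simp only:)
    then have "reaches N f 1 (t + \<epsilon> / 2)"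
      unfolding f_def[abs_def] using \<epsilon>(1)
      by (intro reaches_connected[OF conn \<phi>(1-3) j, where t = "t + \<epsilon> / 2" and \<epsilon> = "\<epsilon> / 2"]) auto
    then show False using t(3) by blast
  qed
  then have "\<exists>z. f z > 0 \<and> (\<forall>B\<in>{A}. \<exists>w. char_poly (mat_at w) = char_poly (int 1 \<cdot>\<^sub>m B) \<and> f (z + w) > 0)"
    using A t by (intro \<epsilon>(2)[rule_format, of 1 t "{A}"]) auto
  then obtain z w where zw: "f z > 0" "char_poly (mat_at w) = char_poly (int 1 \<cdot>\<^sub>m A)" "f (z + w) > 0" by blast
  have "int 1 \<cdot>\<^sub>m A = A" by (intro eq_matI) auto
  moreover have "T w \<in> W"
  proof -
    have "T (z + w) \<in> V1" "T z \<in> V2" using zw \<phi>(5) by (auto simp: f_def)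
    then have "T (z + w) - T z \<in> W" using V(4) by (auto simp: D_def)
    then show ?thesis by (simp add: add)
  qed
  ultimately show ?thesis using zw(2) by auto
qed

section \<open>Bohr sets in coordinates\<close>

context traceless_basis
begin

lemma dense_hom_of_bohr_datum:
  assumes "bohr_datum N \<mu> \<tau> U"
  shows "dense_hom N (\<lambda>w. \<tau> (Matrix.vec N w))"
proof
  show "\<tau> (Matrix.vec N (v + w)) = \<tau> (Matrix.vec N v) + \<tau> (Matrix.vec N w)" for v w
  proof -
    have "Matrix.vec N (v + w) = Matrix.vec N v + Matrix.vec N w" by (auto simp: fun_apply intro!: eq_vecI)
    then show ?thesis using assms by (simp add: bohr_datum_def)
  qed
  show "\<tau> (Matrix.vec N (trunc N w)) = \<tau> (Matrix.vec N w)" for w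
  proof -
    have "Matrix.vec N (trunc N w) = Matrix.vec N w" by (auto simp: trunc_def intro!: eq_vecI)
    then show ?thesis by simp
  qed
  have "range (\<lambda>w. \<tau> (Matrix.vec N w)) = \<tau> ` carrier_vec N"
  proof (intro equalityI subsetI)
    fix x assume "x \<in> \<tau> ` carrier_vec N"
    then obtain v where v: "v \<in> carrier_vec N" "x = \<tau> v" by blast
    have "Matrix.vec N (\<lambda>i. v $ i) = v" using v by (intro eq_vecI) auto
    then show "x \<in> range (\<lambda>w. \<tau> (Matrix.vec N w))" using v by (metis rangeI)
  qed auto
  then show "closure (range (\<lambda>w. \<tau> (Matrix.vec N w))) = UNIV" "compact (UNIV :: 'a set)"
    using assms by (auto simp: bohr_datum_def)
qed

lemma mem_bohr_set:
  assumes E: "E \<subseteq> trace0_mats d" "coords_set d bs E = {v \<in> carrier_vec N. \<tau> v \<in> U}"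
  shows "mat_at w \<in> E \<longleftrightarrow> \<tau> (Matrix.vec N w) \<in> U"
proof -
  have "Matrix.vec N w \<in> coords_set d bs E \<longleftrightarrow> mat_at w \<in> E"
    by (simp add: coords_set_def mat_at_def)
  then show ?thesis unfolding E(2) by simp
qed

text \<open>Translating \<open>U\<close> by one of its points \<open>T z\<close> gives a
  neighbourhood of the identity. The base point \<open>mat_at z\<close> is fixed once, and each
  matrix of \<open>F\<close> then finds its own difference.\<close>

lemma aperiodic_bohr_pattern:
  assumes E: "E \<subseteq> trace0_mats d"
    and bohr: "aperiodic_bohr_set TYPE('k::{topological_ab_group_add, t2_space, second_countable_topology}) N (coords_set d bs E)"
  shows "charpoly_pattern d m E 1"
proof -
  obtain \<mu> :: "'k measure" and \<tau> U where conn: "connected (UNIV :: 'k set)" and datum: "bohr_datum N \<mu> \<tau> U"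
    and EU: "coords_set d bs E = {v \<in> carrier_vec N. \<tau> v \<in> U}"
    using bohr by (auto simp: aperiodic_bohr_set_def)
  define T where "T w = \<tau> (Matrix.vec N w)" for w
  have hom: "dense_hom N T" unfolding T_def using datum by (rule dense_hom_of_bohr_datum)
  interpret dense_hom N T by (rule hom)
  have mem: "mat_at w \<in> E \<longleftrightarrow> T w \<in> U" for w unfolding T_def by (rule mem_bohr_set[OF E EU])
  have U: "open U" "U \<noteq> {}" using datum by (auto simp: bohr_datum_def)
  obtain z where z: "T z \<in> U" using meets_open[OF U] by blast
  define W where "W = (\<lambda>x. T z + x) -` U"
  have W: "open W" "0 \<in> W" using U z by (auto simp: W_def intro!: open_vimage continuous_intros)
  show ?thesis
    unfolding charpoly_pattern_def
  proof (intro allI impI)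
    fix F :: "int mat set" assume F: "F \<subseteq> trace0_mats d \<and> finite F \<and> card F = m"
    show "\<exists>b\<in>E. char_poly ` ((\<lambda>f. int 1 \<cdot>\<^sub>m f) ` F) \<subseteq> char_poly ` ((\<lambda>e. e - b) ` E)"
    proof (intro bexI[of _ "mat_at z"] subsetI)
      fix p assume "p \<in> char_poly ` ((\<lambda>f. int 1 \<cdot>\<^sub>m f) ` F)"
      then obtain A where A: "A \<in> F" "p = char_poly (int 1 \<cdot>\<^sub>m A)" by blast
      have "int 1 \<cdot>\<^sub>m A = A" by (intro eq_matI) auto
      then obtain w where w: "char_poly (mat_at w) = p" "T w \<in> W"
        using char_poly_in_neighbourhood[OF hom conn W, of A] A F by auto
      have "mat_at (z + w) \<in> E" using w(2) by (simp add: mem W_def add)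
      moreover have "mat_at w = mat_at (z + w) - mat_at z" using mat_at_diff[of "z + w" z] by simp
      ultimately show "p \<in> char_poly ` ((\<lambda>e. e - mat_at z) ` E)" using w(1) by blast
    qed (simp add: mem z)
  qed
qed

text \<open>Here \<open>U\<close> itself is a neighbourhood of the identity, so the base point may
  be 0 and the differences are elements of \<open>E\<close>.\<close>

lemma aperiodic_bohr0_char_poly:
  assumes E: "E \<subseteq> trace0_mats d"
    and bohr: "aperiodic_bohr0_set TYPE('k::{topological_ab_group_add, t2_space, second_countable_topology}) N (coords_set d bs E)"
  shows "char_poly ` E = char_poly ` trace0_mats d"
proof
  obtain \<mu> :: "'k measure" and \<tau> U where conn: "connected (UNIV :: 'k set)" and datum: "bohr_datum N \<mu> \<tau> U"
    and U0: "0 \<in> U" and EU: "coords_set d bs E = {v \<in> carrier_vec N. \<tau> v \<in> U}"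
    using bohr by (auto simp: aperiodic_bohr0_set_def)
  define T where "T w = \<tau> (Matrix.vec N w)" for w
  have hom: "dense_hom N T" unfolding T_def using datum by (rule dense_hom_of_bohr_datum)
  have mem: "mat_at w \<in> E \<longleftrightarrow> T w \<in> U" for w unfolding T_def by (rule mem_bohr_set[OF E EU])
  have U: "open U" using datum by (auto simp: bohr_datum_def)
  show "char_poly ` trace0_mats d \<subseteq> char_poly ` E"
  proof (rule image_subsetI)
    fix A assume "A \<in> trace0_mats d"
    then obtain w where "char_poly (mat_at w) = char_poly A" "T w \<in> U"
      using char_poly_in_neighbourhood[OF hom conn U U0] by blast
    then show "char_poly A \<in> char_poly ` E" using mem by (metis imageI)
  qed
qed (use E in blast)

end

theorem theorem1p4:
  fixes d m :: nat and bs :: "int mat list" and E :: "int mat set"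
  assumes "d \<ge> 2" and "trace0_basis d bs" and "E \<subseteq> trace0_mats d" and "m > 0"
  shows "(upper_banach_density (d\<^sup>2 - 1) (coords_set d bs E) > 0 \<longrightarrow>
            (\<exists>k>0. charpoly_pattern d m E k))
       \<and> (aperiodic_bohr_set
            TYPE('k::{topological_ab_group_add, t2_space, second_countable_topology})
            (d\<^sup>2 - 1) (coords_set d bs E) \<longrightarrow>
            charpoly_pattern d m E 1)
       \<and> (aperiodic_bohr0_set TYPE('k) (d\<^sup>2 - 1) (coords_set d bs E) \<longrightarrow>
            char_poly ` E = char_poly ` trace0_mats d)"
proof -
  interpret traceless_basis d bs using assms by unfold_locales
  show ?thesis
    using positive_density_pattern[OF assms(3)] aperiodic_bohr_pattern[OF assms(3)]
      aperiodic_bohr0_char_poly[OF assms(3)] by blast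
qed

end
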